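(* Let $L_M\ge1$ and $L^{\mathrm I}:=L_1^{\mathrm I}+\dots+L_{M-1}^{\mathrm I}+L_M$. The rational $\mathfrak{gl}_{M+1}$ partition function $\psi=\psi(\bm x^{(1)},\dots,\bm x^{(M)}|\{\bm y_{\mathrm I}^{(1)},\bm y_{\mathrm{II}}^{(1)}\},\dots,\{\bm y_{\mathrm I}^{(M-1)},\bm y_{\mathrm{II}}^{(M-1)}\},\bm y^{(M)}|\bm I)$ satisfies: 1. (Case A) If $i^{(M)}_{L^{\mathrm I}}\ne M+1$, then $\psi$ is a polynomial in $y^{(M)}_{L_M}$ of degree at most $k_M-1$. 2. $\psi$ is symmetric with respect to $x^{(M)}_1,\dots,x^{(M)}_{k_M}$. 3. (Case A, $M\ge2$) If $i^{(M)}_{L^{\mathrm I}}\ne M+1$, then $$\psi\big|_{y^{(M)}_{L_M}=x^{(M)}_{k_M}+1}=\prod_{j=1}^{L_M-1}\big(x^{(M)}_{k_M}-y^{(M)}_j\big)\prod_{j=1}^{k_M-1}\big(x^{(M)}_j-x^{(M)}_{k_M}-1\big)$$ $$\times\ \psi\big(\bm x^{(1)},\dots,\bm x^{(M-1)},\bm x^{(M)}\setminus\{x^{(M)}_{k_M}\}\,\big|\,\{\bm y_{\mathrm I}^{(1)},\bm y_{\mathrm{II}}^{(1)}\},\dots,\{\bm y_{\mathrm I}^{(M-1)},\{x^{(M)}_{k_M}\}\cup\bm y_{\mathrm{II}}^{(M-1)}\},\bm y^{(M)}\setminus\{y^{(M)}_{L_M}\}\,\big|\,\bm J\big),$$ where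 the right-hand partition function has sizes $k_M-1$, $L_{M-1}^{\mathrm{II}}+1$, $L_M-1$ in place of $k_M,L_{M-1}^{\mathrm{II}},L_M$ (others unchanged), and $\bm J^{(i)}=\bm I^{(i)}$ for $1\le i\le M-1$, $\bm J^{(M)}=\bm I^{(M)}\setminus\{L^{\mathrm I}\}$, $\widetilde{\bm J}^{(i)}=\widetilde{\bm I}^{(i)}$ for $1\le i\le M-1$. 4. (Case B) If $i^{(M)}_{L^{\mathrm I}}=M+1$, then $$\psi=\prod_{j=1}^{k_M}\big(x^{(M)}_j-y^{(M)}_{L_M}+1\big)\ \psi\big(\bm x^{(1)},\dots,\bm x^{(M)}\,\big|\,\{\bm y_{\mathrm I}^{(1)},\bm y_{\mathrm{II}}^{(1)}\},\dots,\{\bm y_{\mathrm I}^{(M-1)},\bm y_{\mathrm{II}}^{(M-1)}\},\bm y^{(M)}\setminus\{y^{(M)}_{L_M}\}\,\big|\,\bm J\big),$$ where $L_M$ is replaced by $L_M-1$ (other sizes unchanged), and $\bm J^{(i)}=\{j\in\bm I^{(i)}:j\le L^{\mathrm I}\}\cup\{j-1:j\in\bm I^{(i)},\,j>L^{\mathrm I}\}$ for $1\le i\le M-1$, $\bm J^{(M)}=\bm I^{(M)}$, $\widetilde{\bm J}^{(i)}=\widetilde{\bm I}^{(i)}$ for $1\le i\le M-1$. 5. (Initial condition, $M\ge2$) If $k_M=1$ and $i^{(M)}_{L^{\mathrm I}}\ne M+1$, then $$\psi=\prod_{j=1}^{L_M-1}\big(x^{(M)}_1-y^{(M)}_j\big)\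 \psi\big(\bm x^{(1)},\dots,\bm x^{(M-1)}\,\big|\,\{\bm y_{\mathrm I}^{(1)},\bm y_{\mathrm{II}}^{(1)}\},\dots,\{\bm y_{\mathrm I}^{(M-2)},\bm y_{\mathrm{II}}^{(M-2)}\},\bm y_{\mathrm I}^{(M-1)}\cup\{x^{(M)}_1\}\cup\bm y_{\mathrm{II}}^{(M-1)}\,\big|\,\bm J\big),$$ where the right-hand side is a $\mathfrak{gl}_M$ partition function ($M-1$ layers) with sizes $k_1,\dots,k_{M-1}$, $L_p^{\mathrm I},L_p^{\mathrm{II}}$ ($p\le M-2$) and top-layer size $L_{M-1}^{\mathrm I}+L_{M-1}^{\mathrm{II}}+1$, and $\bm J^{(i)}=\{j\in\bm I^{(i)}:j<L^{\mathrm I}\}\cup\{j-L_M+1:j\in\bm I^{(i)},\,j\ge L^{\mathrm I}\}$ for $1\le i\le M-1$. Moreover $\widetilde{\bm J}^{(i)}=\widetilde{\bm I}^{(i)}$ for $1\le i\le M-1$, where for $i=M-1$ (the top layer of the $\mathfrak{gl}_M$ function) $\widetilde{\bm J}^{(M-1)}$ denotes $\bm J^{(M-1)}$ shifted down by $L_1^{\mathrm I}+\dots+L_{M-2}^{\mathrm I}$. Here unions and set differences of lists of variables denote concatenation and deletion of ordered lists.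
   Context: **Sizes, variables, coordinates.** Fix $M\ge1$ and nonnegative integers $k_1,\dots,k_M$, $L_p^{\mathrm I},L_p^{\mathrm{II}}$ ($1\le p\le M-1$), $L_M$. There are ordered lists of variables $\bm x^{(p)}=(x^{(p)}_1,\dots,x^{(p)}_{k_p})$ ($1\le p\le M$), $\bm y^{(p)}_{\mathrm I}=(y^{(p)}_{\mathrm I,1},\dots,y^{(p)}_{\mathrm I,L^{\mathrm I}_p})$, $\bm y^{(p)}_{\mathrm{II}}=(y^{(p)}_{\mathrm{II},1},\dots,y^{(p)}_{\mathrm{II},L^{\mathrm{II}}_p})$ ($1\le p\le M-1$), $\bm y^{(M)}=(y^{(M)}_1,\dots,y^{(M)}_{L_M})$. The sizes are the lengths of the lists and are omitted from the notation of functions. Order the $y$-variables as $\bm y_{\mathrm I}^{(1)},\dots,\bm y_{\mathrm I}^{(M-1)},\bm y^{(M)},\bm y_{\mathrm{II}}^{(M-1)},\dots,\bm y_{\mathrm{II}}^{(1)}$; the $c$-th variable in this list defines the coordinate $c\in\{1,2,\dots\}$. A coordinate is in layer $p<M$ if its variable belongs to $\bm y_{\mathrm I}^{(p)}$ or $\bm y_{\mathrm{II}}^{(p)}$, and in layer $M$ if it belongs to $\bm y^{(M)}$. (Thus $L^{\mathrm I}$ is the coordinate of $y^{(M)}_{L_M}$.) **Colourings.** A colouring assigns to each coordinate $c$ of layer $p$ a colour $i_c^{(p)}\in\{1,\dots,p+1\}$. For $1\le j\le M$, let $\widehat{\bm I}^{(j)}$ be the set of coordinates in layers $j,\dots,M$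 and $\bm I^{(j)}=\bm I^{(j)}_{k_j}\subset\widehat{\bm I}^{(j)}$ the subset of those with colour in $\{1,\dots,j\}$. Colourings are always assumed admissible, i.e. $|\bm I^{(j)}|=k_j$ for all $j$. The tuple $\bm I=(\bm I^{(1)},\dots,\bm I^{(M)})$ determines the colouring. For $1\le j\le M-1$, the elements of $\widehat{\bm I}^{(j)}$ with colour in $\{1,\dots,j+1\}$ number $k_{j+1}+L_j^{\mathrm I}+L_j^{\mathrm{II}}$; relabel them in increasing order by $1,2,\dots,k_{j+1}+L_j^{\mathrm I}+L_j^{\mathrm{II}}$, and let $\widetilde{\bm I}^{(j)}$ be the image of $\bm I^{(j)}$. For another colouring given by a tuple $\bm J$, the sets $\widetilde{\bm J}^{(j)}$ are defined in the same way. **Partition function.** Put $N_p=L_p^{\mathrm I}+k_{p+1}+L_p^{\mathrm{II}}$ for $p<M$, $N_M=L_M$. Layer $p$ is a grid with rows $r=1,\dots,k_p$ (top to bottom; row $r$ carries $x^{(p)}_r$) and columns $s=1,\dots,N_p$ (left to right; column $s$ carries the $s$-th entry of the concatenated list $(\bm y^{(p)}_{\mathrm I},\bm x^{(p+1)},\bm y^{(p)}_{\mathrm{II}})$ if $p<M$, and $y^{(M)}_s$ if $p=M$). Edges carry colours in $\{1,\dots,M+1\}$: horizontal $h^{(p)}_{r,s}$ ($0\le s\le N_p$) and vertical $v^{(p)}_{r,s}$ ($0\le r\le k_p$); vertex $(r,s)$ has left, right, bottom, top edges $h^{(p)}_{r,s-1},h^{(p)}_{r,s},v^{(p)}_{r,s},v^{(p)}_{r-1,s}$.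 Boundary conditions: $h^{(p)}_{r,N_p}=p+1$ for all $r$; $v^{(p)}_{k_p,s}=p+1$ for all $s$ as bottom boundary colours; $h^{(1)}_{r,0}=1$; $h^{(p+1)}_{r,0}=v^{(p)}_{0,L_p^{\mathrm I}+r}$ for $1\le r\le k_{p+1}$, $p<M$; and the top edge $v^{(p)}_{0,s}$ of a column carrying a $y$-variable has the colour of the corresponding coordinate. A vertex with left, bottom, right, top colours $(a,b,c,d)$, row variable $x$ and column variable $y$ has weight: $x-y+1$ if $a=b=c=d$; $x-y$ if $c=a\ne b=d$; $1$ if $c=b\neq a=d$; $0$ otherwise. Then $\psi$ is the sum over all edge colourings satisfying the boundary conditions of the product of the weights of all vertices in all layers. *)

theory Defs
  imports "HOL-Computational_Algebra.Polynomial" "HOL-Library.FuncSet" "HOL-Library.Multiset"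
begin

text \<open>
  The number of layers \<open>M\<close> together with the ordered lists of variables; \<open>ytop\<close> is the list
  \<open>y^(M)\<close>. All sizes are lengths of these lists. Layers, rows, columns and coordinates are numbered
  from 1. Only \<open>xvars p\<close> for \<open>1 \<le> p \<le> M\<close> and \<open>yI p\<close>, \<open>yII p\<close> for \<open>1 \<le> p < M\<close> are ever used.
\<close>

record 'a variables =
  layers :: nat
  xvars :: "nat \<Rightarrow> 'a list"
  yI :: "nat \<Rightarrow> 'a list"
  yII :: "nat \<Rightarrow> 'a list"
  ytop :: "'a list"

abbreviation k_size :: "'a variables \<Rightarrow> nat \<Rightarrow> nat" where
  "k_size V p \<equiv> length (xvars V p)"

abbreviation L_I :: "'a variables \<Rightarrow> nat \<Rightarrow> nat" where
  "L_I V p \<equiv> length (yI V p)"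

abbreviation L_II :: "'a variables \<Rightarrow> nat \<Rightarrow> nat" where
  "L_II V p \<equiv> length (yII V p)"

abbreviation L_top :: "'a variables \<Rightarrow> nat" where
  "L_top V \<equiv> length (ytop V)"


subsection \<open>Coordinates and colourings\<close>

text \<open>
  The \<open>y\<close>-variables are ordered as \<open>yI 1, ..., yI (M-1), ytop, yII (M-1), ..., yII 1\<close>. The following
  two numbers count the variables preceding \<open>yI p\<close> and \<open>yII p\<close> respectively; \<open>offset_I V M\<close> is the
  number of variables preceding \<open>ytop\<close>.
\<close>

definition offset_I :: "'a variables \<Rightarrow> nat \<Rightarrow> nat" where
  "offset_I V p = (\<Sum>q\<in>{1..<p}. L_I V q)"

definition offset_II :: "'a variables \<Rightarrow> nat \<Rightarrow> nat" where
  "offset_II V p = offset_I V (layers V) + L_top V + (\<Sum>q\<in>{p<..<layers V}. L_II V q)"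

text \<open>The coordinate of the last variable of \<open>ytop\<close>, written \<open>L^I\<close> in the mathematical text.\<close>

definition L_sum :: "'a variables \<Rightarrow> nat" where
  "L_sum V = offset_I V (layers V) + L_top V"

definition layer_coords :: "'a variables \<Rightarrow> nat \<Rightarrow> nat set" where
  "layer_coords V p =
     (if p < layers V
      then {offset_I V p<..offset_I V p + L_I V p} \<union> {offset_II V p<..offset_II V p + L_II V p}
      else {offset_I V p<..offset_I V p + L_top V})"

definition is_colouring :: "'a variables \<Rightarrow> (nat \<Rightarrow> nat) \<Rightarrow> bool" where
  "is_colouring V i \<longleftrightarrow> (\<forall>p\<in>{1..layers V}. \<forall>c\<in>layer_coords V p. i c \<in> {1..p + 1})"

definition I_hat :: "'a variables \<Rightarrow> nat \<Rightarrow> nat set" where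
  "I_hat V j = (\<Union>p\<in>{j..layers V}. layer_coords V p)"

definition colour_set :: "'a variables \<Rightarrow> (nat \<Rightarrow> nat) \<Rightarrow> nat \<Rightarrow> nat set" where
  "colour_set V i j = {c \<in> I_hat V j. i c \<in> {1..j}}"

text \<open>\<open>i\<close> is an admissible colouring and \<open>I\<close> is its tuple of sets (indexed by \<open>1, ..., M\<close>).\<close>

definition admissible :: "'a variables \<Rightarrow> (nat \<Rightarrow> nat) \<Rightarrow> (nat \<Rightarrow> nat set) \<Rightarrow> bool" where
  "admissible V i I \<longleftrightarrow>
     is_colouring V i \<and> (\<forall>j\<in>{1..layers V}. I j = colour_set V i j \<and> card (I j) = k_size V j)"

definition admissible_tuple :: "'a variables \<Rightarrow> (nat \<Rightarrow> nat set) \<Rightarrow> bool" where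
  "admissible_tuple V I \<longleftrightarrow> (\<exists>i. admissible V i I)"

text \<open>
  The colour of a coordinate \<open>c\<close> of layer \<open>p\<close> recovered from the tuple \<open>I\<close>: for \<open>1 \<le> j \<le> p\<close>,
  \<open>c\<close> lies in \<open>I j\<close> iff its colour is at most \<open>j\<close>.
\<close>

definition colour_of :: "(nat \<Rightarrow> nat set) \<Rightarrow> nat \<Rightarrow> nat \<Rightarrow> nat" where
  "colour_of I p c = (LEAST j. j = p + 1 \<or> (j \<in> {1..p} \<and> c \<in> I j))"

lemma colour_of_admissible:
  assumes "admissible V i I" "p \<in> {1..layers V}" "c \<in> layer_coords V p"
  shows "colour_of I p c = i c"
proof -
  have ic: "i c \<in> {1..p + 1}"
    using assms unfolding admissible_def is_colouring_def by blast
  have mem: "c \<in> I j \<longleftrightarrow> i c \<le> j" if "j \<in> {1..p}" for j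
  proof -
    have "I j = colour_set V i j"
      using assms(1,2) that unfolding admissible_def by auto
    moreover have "c \<in> I_hat V j"
      using assms(2,3) that unfolding I_hat_def by auto
    ultimately show ?thesis
      using ic unfolding colour_set_def by auto
  qed
  show ?thesis
    unfolding colour_of_def
  proof (rule Least_equality)
    show "i c = p + 1 \<or> (i c \<in> {1..p} \<and> c \<in> I (i c))"
      using ic mem[of "i c"] by auto
  next
    fix j assume "j = p + 1 \<or> (j \<in> {1..p} \<and> c \<in> I j)"
    then show "i c \<le> j"
      using ic mem[of j] by auto
  qed
qed

text \<open>
  \<open>relabelled V I j\<close> is the image of \<open>I j\<close> under the increasing relabelling by \<open>1, 2, ...\<close> of those
  coordinates in layers \<open>j, ..., M\<close> whose colour is at most \<open>j + 1\<close>.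
\<close>

definition low_coords :: "'a variables \<Rightarrow> (nat \<Rightarrow> nat set) \<Rightarrow> nat \<Rightarrow> nat set" where
  "low_coords V I j =
     (\<Union>p\<in>{j..layers V}. {c \<in> layer_coords V p. colour_of I p c \<in> {1..j + 1}})"

definition relabelled :: "'a variables \<Rightarrow> (nat \<Rightarrow> nat set) \<Rightarrow> nat \<Rightarrow> nat set" where
  "relabelled V I j = (\<lambda>c. card {a \<in> low_coords V I j. a \<le> c}) ` I j"


subsection \<open>The partition function\<close>

definition columns :: "'a variables \<Rightarrow> nat \<Rightarrow> 'a list" where
  "columns V p = (if p < layers V then yI V p @ xvars V (p + 1) @ yII V p else ytop V)"

abbreviation N_size :: "'a variables \<Rightarrow> nat \<Rightarrow> nat" where
  "N_size V p \<equiv> length (columns V p)"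

text \<open>The colours \<open>a, b, c, d\<close> are those of the left, bottom, right and top edge.\<close>

definition weight :: "'a::comm_ring_1 \<Rightarrow> 'a \<Rightarrow> nat \<Rightarrow> nat \<Rightarrow> nat \<Rightarrow> nat \<Rightarrow> 'a" where
  "weight x y a b c d =
     (if a = b \<and> b = c \<and> c = d then x - y + 1
      else if c = a \<and> a \<noteq> b \<and> b = d then x - y
      else if c = b \<and> b \<noteq> a \<and> a = d then 1
      else 0)"

text \<open>Edges are triples \<open>(p, r, s)\<close>: layer, row, column.\<close>

definition h_edges :: "'a variables \<Rightarrow> (nat \<times> nat \<times> nat) set" where
  "h_edges V = {(p, r, s). p \<in> {1..layers V} \<and> r \<in> {1..k_size V p} \<and> s \<in> {0..N_size V p}}"

definition v_edges :: "'a variables \<Rightarrow> (nat \<times> nat \<times> nat) set" where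
  "v_edges V = {(p, r, s). p \<in> {1..layers V} \<and> r \<in> {0..k_size V p} \<and> s \<in> {1..N_size V p}}"

definition boundary ::
  "'a variables \<Rightarrow> (nat \<Rightarrow> nat set) \<Rightarrow>
   (nat \<times> nat \<times> nat \<Rightarrow> nat) \<Rightarrow> (nat \<times> nat \<times> nat \<Rightarrow> nat) \<Rightarrow> bool" where
  "boundary V I h v \<longleftrightarrow>
     (\<forall>p\<in>{1..layers V}. \<forall>r\<in>{1..k_size V p}. h (p, r, N_size V p) = p + 1) \<and>
     (\<forall>p\<in>{1..layers V}. \<forall>s\<in>{1..N_size V p}. v (p, k_size V p, s) = p + 1) \<and>
     (\<forall>r\<in>{1..k_size V 1}. h (1, r, 0) = 1) \<and>
     (\<forall>p\<in>{1..<layers V}. \<forall>r\<in>{1..k_size V (p + 1)}. h (p + 1, r, 0) = v (p, 0, L_I V p + r)) \<and>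
     (\<forall>p\<in>{1..<layers V}. \<forall>s\<in>{1..L_I V p}.
        v (p, 0, s) = colour_of I p (offset_I V p + s)) \<and>
     (\<forall>p\<in>{1..<layers V}. \<forall>s\<in>{1..L_II V p}.
        v (p, 0, L_I V p + k_size V (p + 1) + s) = colour_of I p (offset_II V p + s)) \<and>
     (\<forall>s\<in>{1..L_top V}.
        v (layers V, 0, s) = colour_of I (layers V) (offset_I V (layers V) + s))"

definition configurations ::
  "'a variables \<Rightarrow> (nat \<Rightarrow> nat set) \<Rightarrow>
   ((nat \<times> nat \<times> nat \<Rightarrow> nat) \<times> (nat \<times> nat \<times> nat \<Rightarrow> nat)) set" where
  "configurations V I =
     {(h, v). h \<in> h_edges V \<rightarrow>\<^sub>E {1..layers V + 1} \<and> v \<in> v_edges V \<rightarrow>\<^sub>E {1..layers V + 1} \<and>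
        boundary V I h v}"

definition psi :: "'a::comm_ring_1 variables \<Rightarrow> (nat \<Rightarrow> nat set) \<Rightarrow> 'a" where
  "psi V I =
     (\<Sum>(h, v)\<in>configurations V I.
        \<Prod>p\<in>{1..layers V}. \<Prod>r\<in>{1..k_size V p}. \<Prod>s\<in>{1..N_size V p}.
          weight (xvars V p ! (r - 1)) (columns V p ! (s - 1))
            (h (p, r, s - 1)) (v (p, r, s)) (h (p, r, s)) (v (p, r - 1, s)))"

end

theory Submission
  imports Defs
begin

text \<open>
  Summing over the colours \<open>g\<close> of the edges that join layer \<open>M - 1\<close> to layer \<open>M\<close> writes \<open>psi\<close> as
  \<open>\<Sum>g. A g * Z g\<close>, where \<open>Z g\<close> is the partition function of the rectangular top layer and \<open>A g\<close> that
  of all lower layers. In the last column of the top layer the right and bottom edges have colour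
  \<open>M + 1\<close>, so the column is frozen in case B, and in case A it is determined by the single row in
  which the path ending at its top edge enters. A vertex below that row has weight \<open>x' - y + 1\<close>, and for the
  bottom row this vanishes at \<open>y = x + 1\<close>; so the path enters in the bottom row, which is then frozen
  as well. The variables \<open>x\<close> of layer
  \<open>M\<close> label rows of \<open>Z\<close> and columns of \<open>A\<close>. With \<open>u = x1 - x2\<close> and \<open>P\<close> the transposition of the
  colours of two adjacent edges, the Yang-Baxter equation moves \<open>1 + u P\<close> through the rows of \<open>Z\<close> and
  through the columns of \<open>A\<close>; on the constant right and bottom boundaries it acts by \<open>u + 1\<close>.
\<close>

text \<open>It carries the colour of the coordinate \<open>L_sum\<close> to its left end, which is
  the top edge of the last x-column of layer \<open>M - 1\<close>. With this colour prescribed, the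
  column is indistinguishable from that of a y-variable, and it stands just before
  \<open>yII (M - 1)\<close>.

  For the symmetry, neither factor is invariant by itself: exchanging rows of Z leaves P on its left
  edges, exchanging columns of A leaves P on its top edges. Both sets of edges carry
  \<open>g\<close>, and in a sum over all \<open>g\<close> the transposition can be moved from one
  factor to the other, so the two remainders match. The exchange relations are therefore needed for
  arbitrary left and top colours.

  The initial condition compares partition functions with colours up to \<open>M + 1\<close> and up
  to \<open>M\<close>. Hence the palette is a parameter \<open>n\<close>, and conservation of
  colours at each vertex is used to change it.

  The definition of \<open>psi\<close> sums over all edges at once, while the arguments are
  inductions over rows and columns; the bridge is a nested sum over words of vertical
  colours.\<close>

definition words :: "nat \<Rightarrow> nat \<Rightarrow> nat list set" where
  "words n m = {w. length w = m \<and> set w \<subseteq> {1..n}}"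

lemma finite_words [simp]: "finite (words n m)"
  unfolding words_def using finite_lists_length_eq[of "{1..n}" m] by (simp add: conj_commute)

lemma words_0 [simp]: "words n 0 = {[]}"
  by (auto simp: words_def)

lemma Cons_words [simp]: "c # w \<in> words n (Suc m) \<longleftrightarrow> c \<in> {1..n} \<and> w \<in> words n m"
  by (auto simp: words_def)

lemma append_words:
  "length u = k \<Longrightarrow> u @ v \<in> words n (k + m) \<longleftrightarrow> u \<in> words n k \<and> v \<in> words n m"
  by (auto simp: words_def)

lemma length_words: "w \<in> words n m \<Longrightarrow> length w = m"
  by (simp add: words_def)

lemma sum_words_Cons: "(\<Sum>w\<in>words n (Suc m). f w) = (\<Sum>c\<in>{1..n}. \<Sum>w\<in>words n m. f (c # w))"
proof -
  have "words n (Suc m) = (\<lambda>(c, w). c # w) ` ({1..n} \<times> words n m)"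
    by (auto simp: words_def image_iff length_Suc_conv)
  then show ?thesis
    by (simp add: sum.cartesian_product sum.reindex inj_on_def case_prod_unfold)
qed

lemma sum_words_snoc: "(\<Sum>w\<in>words n (Suc m). f w) = (\<Sum>w\<in>words n m. \<Sum>c\<in>{1..n}. f (w @ [c]))"
proof -
  have "words n (Suc m) = (\<lambda>(w, c). w @ [c]) ` (words n m \<times> {1..n})"
    by (auto simp: words_def image_iff length_Suc_conv_rev)
  then show ?thesis
    by (simp add: sum.cartesian_product sum.reindex inj_on_def case_prod_unfold)
qed

text \<open>The transposition P on the colours of a line of edges. Outside the range of positions it
  is the identity, so it is an involution of \<open>words n m\<close> for every
  \<open>k\<close>.\<close>

fun swapl :: "nat \<Rightarrow> 'b list \<Rightarrow> 'b list" where
  "swapl 0 (a # b # xs) = b # a # xs"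
| "swapl (Suc k) (a # xs) = a # swapl k xs"
| "swapl _ xs = xs"

lemma length_swapl [simp]: "length (swapl k xs) = length xs"
  by (induction k xs rule: swapl.induct) auto

lemma set_swapl [simp]: "set (swapl k xs) = set xs"
  by (induction k xs rule: swapl.induct) auto

lemma swapl_swapl [simp]: "swapl k (swapl k xs) = xs"
  by (induction k xs rule: swapl.induct) auto

lemma swapl_append1: "swapl (length pre + k) (pre @ xs) = pre @ swapl k xs"
  by (induction pre) auto

lemma swapl_append2: "Suc k < length xs \<Longrightarrow> swapl k (xs @ post) = swapl k xs @ post"
  by (induction k xs rule: swapl.induct) auto

lemma swapl_replicate [simp]: "swapl k (replicate m q) = replicate m q"
  by (metis length_swapl in_set_replicate replicate_eqI set_swapl length_replicate)

lemma sum_words_swapl: "(\<Sum>w\<in>words n m. f (swapl k w)) = (\<Sum>w\<in>words n m. f w)"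
  by (rule sum.reindex_bij_witness[of _ "swapl k" "swapl k"]) (auto simp: words_def)

section \<open>Yang-Baxter exchange relations\<close>

text \<open>The weight is the rational R-matrix \<open>(x - y) + P\<close>: either both lines pass
  straight through or they exchange colours. When all four colours agree both indicators are 1,
  which gives \<open>x - y + 1\<close>.\<close>

lemma weight_eq:
  "weight x y a b c d = (x - y) * of_bool (a = c) * of_bool (b = d) + of_bool (a = d) * of_bool (b = c)"
  by (auto simp: weight_def)

lemma sum_of_bool_eq:
  fixes f :: "nat \<Rightarrow> 'a::comm_ring_1"
  assumes "a \<in> S" "finite S"
  shows "(\<Sum>e\<in>S. of_bool (e = a) * f e) = f a" "(\<Sum>e\<in>S. of_bool (a = e) * f e) = f a"
proof -
  have *: "of_bool (e = a) * f e = (if e = a then f e else 0)" for e by simp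
  show "(\<Sum>e\<in>S. of_bool (e = a) * f e) = f a" unfolding * using assms by simp
  then show "(\<Sum>e\<in>S. of_bool (a = e) * f e) = f a" by (simp add: eq_commute)
qed

text \<open>At most two colours of the free edge contribute, so a vertex acts on functions of that
  colour as a two-term operator. This removes the sums from the Yang-Baxter equation and leaves an
  identity between products of indicators.\<close>

lemma sum_weight_bottom:
  assumes "c \<in> {1..n}" "d \<in> {1..n}"
  shows "(\<Sum>e\<in>{1..n}. weight x y a e c d * F e) = (x - y) * of_bool (a = c) * F d + of_bool (a = d) * F c"
proof -
  have "weight x y a e c d * F e
      = (x - y) * of_bool (a = c) * (of_bool (e = d) * F e) + of_bool (a = d) * (of_bool (e = c) * F e)" for e
    by (simp add: weight_eq algebra_simps)
  then show ?thesis
    using assms by (simp add: sum.distrib sum_distrib_left[symmetric] sum_of_bool_eq del: sum_of_bool_mult_eq)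
qed

lemma sum_weight_right:
  assumes "a \<in> {1..n}" "b \<in> {1..n}"
  shows "(\<Sum>e\<in>{1..n}. weight x y a b e d * F e) = (x - y) * of_bool (b = d) * F a + of_bool (a = d) * F b"
proof -
  have "weight x y a b e d * F e
      = (x - y) * of_bool (b = d) * (of_bool (a = e) * F e) + of_bool (a = d) * (of_bool (b = e) * F e)" for e
    by (simp add: weight_eq algebra_simps)
  then show ?thesis
    using assms by (simp add: sum.distrib sum_distrib_left[symmetric] sum_of_bool_eq del: sum_of_bool_mult_eq)
qed

text \<open>The Yang-Baxter equation with the crossing \<open>1 + u P\<close>, where \<open>P\<close> transposes the colours of two
  adjacent edges. Writing the action of \<open>P\<close> as an exchange of arguments avoids sums over the edges of
  the crossing.\<close>

lemma weight_exchange_rows: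
  fixes x1 x2 y :: "'a::comm_ring_1"
  assumes "f1 \<in> {1..n}" "f2 \<in> {1..n}" "d \<in> {1..n}"
  shows "(x1 - x2) * (\<Sum>e\<in>{1..n}. weight x1 y a1 e f2 d * weight x2 y a2 b f1 e)
       + (\<Sum>e\<in>{1..n}. weight x1 y a1 e f1 d * weight x2 y a2 b f2 e)
       = (x1 - x2) * (\<Sum>e\<in>{1..n}. weight x2 y a2 e f1 d * weight x1 y a1 b f2 e)
       + (\<Sum>e\<in>{1..n}. weight x2 y a1 e f1 d * weight x1 y a2 b f2 e)"
  unfolding sum_weight_bottom[OF assms(1,3)] sum_weight_bottom[OF assms(2,3)]
  unfolding weight_eq by (simp add: algebra_simps)

lemma weight_exchange_columns:
  fixes x y1 y2 :: "'a::comm_ring_1"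
  assumes "a \<in> {1..n}" "b1 \<in> {1..n}" "b2 \<in> {1..n}"
  shows "(y1 - y2) * (\<Sum>e\<in>{1..n}. weight x y1 a b1 e d2 * weight x y2 e b2 c d1)
       + (\<Sum>e\<in>{1..n}. weight x y1 a b1 e d1 * weight x y2 e b2 c d2)
       = (y1 - y2) * (\<Sum>e\<in>{1..n}. weight x y2 a b2 e d1 * weight x y1 e b1 c d2)
       + (\<Sum>e\<in>{1..n}. weight x y2 a b1 e d1 * weight x y1 e b2 c d2)"
  unfolding sum_weight_right[OF assms(1,2)] sum_weight_right[OF assms(1,3)]
  unfolding weight_eq by (simp add: algebra_simps)

text \<open>In \<open>row_pf n x ys a bs c ds\<close> and \<open>grid_pf n xs ys as bs q ds\<close> the boundary colours are listed in
  the order left, bottom, right, top; all edges on the right of the grid have the colour \<open>q\<close>. The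
  values are meaningful only if the lengths of the lists match.\<close>

primrec row_pf :: "nat \<Rightarrow> 'a::comm_ring_1 \<Rightarrow> 'a list \<Rightarrow> nat \<Rightarrow> nat list \<Rightarrow> nat \<Rightarrow> nat list \<Rightarrow> 'a" where
  "row_pf n x [] a bs c ds = of_bool (a = c)"
| "row_pf n x (y # ys) a bs c ds =
     (\<Sum>e\<in>{1..n}. weight x y a (hd bs) e (hd ds) * row_pf n x ys e (tl bs) c (tl ds))"

primrec grid_pf :: "nat \<Rightarrow> 'a::comm_ring_1 list \<Rightarrow> 'a list \<Rightarrow> nat list \<Rightarrow> nat list \<Rightarrow> nat \<Rightarrow> nat list \<Rightarrow> 'a" where
  "grid_pf n [] ys as bs q ds = of_bool (bs = ds)"
| "grid_pf n (x # xs) ys as bs q ds =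
     (\<Sum>es\<in>words n (length ys). row_pf n x ys (hd as) es q ds * grid_pf n xs ys (tl as) bs q es)"

section \<open>Cutting a row or a grid in two\<close>

lemma row_pf_append:
  assumes "a \<in> {1..n}" "length bs1 = length ys1" "length ds1 = length ys1"
  shows "row_pf n x (ys1 @ ys2) a (bs1 @ bs2) c (ds1 @ ds2) =
    (\<Sum>e\<in>{1..n}. row_pf n x ys1 a bs1 e ds1 * row_pf n x ys2 e bs2 c ds2)"
  using assms
proof (induction ys1 arbitrary: a bs1 ds1)
  case Nil
  then show ?case by (simp add: sum_of_bool_eq del: sum_of_bool_mult_eq)
next
  case (Cons y ys)
  obtain b bs d ds where [simp]: "bs1 = b # bs" "ds1 = d # ds"
    using Cons.prems by (metis length_Suc_conv)
  have "row_pf n x ((y # ys) @ ys2) a (bs1 @ bs2) c (ds1 @ ds2) =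
    (\<Sum>f\<in>{1..n}. \<Sum>e\<in>{1..n}. weight x y a b f d * row_pf n x ys f bs e ds * row_pf n x ys2 e bs2 c ds2)"
    using Cons by (simp add: sum_distrib_left mult.assoc)
  also have "\<dots> = (\<Sum>e\<in>{1..n}. \<Sum>f\<in>{1..n}. weight x y a b f d * row_pf n x ys f bs e ds * row_pf n x ys2 e bs2 c ds2)"
    by (rule sum.swap)
  finally show ?case by (simp add: sum_distrib_right)
qed

lemma row_pf_snoc:
  assumes "a \<in> {1..n}" "c \<in> {1..n}" "length bs = length ys" "length ds = length ys"
  shows "row_pf n x (ys @ [y]) a (bs @ [b]) c (ds @ [d]) =
    (\<Sum>e\<in>{1..n}. row_pf n x ys a bs e ds * weight x y e b c d)"
proof -
  have "(\<Sum>f\<in>{1..n}. weight x y e b f d * of_bool (f = c)) = weight x y e b c d" for e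
    using assms(2) by (subst mult.commute) (simp add: sum_of_bool_eq del: sum_mult_of_bool_eq sum_of_bool_mult_eq)
  then show ?thesis
    using assms by (simp add: row_pf_append)
qed

text \<open>The recursion defining \<open>grid_pf\<close> splits off the top row. Splitting off the
  bottom row is what \<open>sum_layer_colourings\<close> needs, where a new row adds an index at the
  end of \<open>{0..length xs}\<close>.\<close>

lemma grid_pf_snoc:
  assumes "length as = length xs" "ds \<in> words n (length ys)" "bs \<in> words n (length ys)"
  shows "grid_pf n (xs @ [x]) ys (as @ [a]) bs q ds =
    (\<Sum>es\<in>words n (length ys). grid_pf n xs ys as es q ds * row_pf n x ys a bs q es)"
  using assms(1,2)
proof (induction xs arbitrary: as ds)
  case Nil
  have "row_pf n x ys a es q ds * of_bool (bs = es) = (if es = bs then row_pf n x ys a es q ds else 0)"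
     "of_bool (es = ds) * row_pf n x ys a bs q es = (if es = ds then row_pf n x ys a bs q es else 0)" for es
    by auto
  then show ?case using Nil assms(3)
    by (simp del: sum_mult_of_bool_eq sum_of_bool_mult_eq)
next
  case (Cons z xs)
  obtain a' as' where [simp]: "as = a' # as'"
    using Cons.prems by (metis length_Suc_conv)
  have "grid_pf n ((z # xs) @ [x]) ys (as @ [a]) bs q ds =
    (\<Sum>es\<in>words n (length ys). \<Sum>fs\<in>words n (length ys).
       row_pf n z ys a' es q ds * grid_pf n xs ys as' fs q es * row_pf n x ys a bs q fs)"
    using Cons by (simp add: sum_distrib_left mult.assoc)
  also have "\<dots> = (\<Sum>fs\<in>words n (length ys). \<Sum>es\<in>words n (length ys).
       row_pf n z ys a' es q ds * grid_pf n xs ys as' fs q es * row_pf n x ys a bs q fs)"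
    by (rule sum.swap)
  finally show ?case by (simp add: sum_distrib_right)
qed

section \<open>Exchange of adjacent columns\<close>

lemma sum_regroup:
  fixes u :: "'a::comm_ring_1"
  shows "u * (\<Sum>f\<in>S. G f * R f) + (\<Sum>f\<in>S. H f * R f) = (\<Sum>f\<in>S. (u * G f + H f) * R f)"
  by (simp add: sum_distrib_left sum.distrib distrib_right mult.assoc)

lemma sum_regroup':
  fixes u :: "'a::comm_ring_1"
  shows "u * (\<Sum>f\<in>S. R f * G f) + (\<Sum>f\<in>S. R f * H f) = (\<Sum>f\<in>S. R f * (u * G f + H f))"
  by (simp add: sum_distrib_left sum.distrib distrib_left mult.left_commute)

text \<open>A crossing of two column lines above the row equals one below it, so P acts on
  \<open>ds\<close> on one side and on \<open>bs\<close> on the other. Induction on \<open>k\<close>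
  strips the columns to the left of the pair; the local relation then applies to the first
  two.\<close>

lemma row_pf_swap_columns:
  assumes "Suc k < length ys" "a \<in> {1..n}" "bs \<in> words n (length ys)" "ds \<in> words n (length ys)"
  defines "u \<equiv> ys ! k - ys ! Suc k"
  shows "u * row_pf n x ys a bs c (swapl k ds) + row_pf n x ys a bs c ds =
    u * row_pf n x (swapl k ys) a (swapl k bs) c ds + row_pf n x (swapl k ys) a bs c ds"
  using assms(1-4) unfolding u_def
proof (induction k arbitrary: ys a bs ds)
  case 0
  obtain y1 y2 ys' where ys: "ys = y1 # y2 # ys'"
    using 0(1) by (cases ys; cases "tl ys") auto
  obtain b1 b2 bs' where bs: "bs = b1 # b2 # bs'"
    using 0(3) ys by (cases bs; cases "tl bs") (auto simp: words_def)
  obtain d1 d2 ds' where ds: "ds = d1 # d2 # ds'"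
    using 0(4) ys by (cases ds; cases "tl ds") (auto simp: words_def)
  have two: "row_pf n x (z1 # z2 # ys') a (c1 # c2 # bs') c (e1 # e2 # ds') =
    (\<Sum>f\<in>{1..n}. (\<Sum>e\<in>{1..n}. weight x z1 a c1 e e1 * weight x z2 e c2 f e2) * row_pf n x ys' f bs' c ds')"
    for z1 z2 c1 c2 e1 e2
    by (simp add: sum_distrib_left sum_distrib_right mult.assoc) (rule sum.swap)
  show ?case
    using 0 weight_exchange_columns[of a n b1 b2 y1 y2 x]
    by (simp add: ys bs ds two sum_regroup del: row_pf.simps)
next
  case (Suc k)
  obtain y ys' where ys: "ys = y # ys'"
    using Suc.prems by (cases ys) auto
  obtain b bs' where bs: "bs = b # bs'"
    using Suc.prems ys by (cases bs) (auto simp: words_def)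
  obtain d ds' where ds: "ds = d # ds'"
    using Suc.prems ys by (cases ds) (auto simp: words_def)
  show ?case
    using Suc by (simp add: ys bs ds sum_regroup')
qed

lemma swapl_eq_iff: "swapl k xs = ys \<longleftrightarrow> xs = swapl k ys"
  by auto

lemma grid_pf_swap_columns:
  assumes "Suc k < length ys" "length as = length xs" "set as \<subseteq> {1..n}"
    "bs \<in> words n (length ys)" "ds \<in> words n (length ys)"
  defines "u \<equiv> ys ! k - ys ! Suc k"
  shows "u * grid_pf n xs ys as bs q (swapl k ds) + grid_pf n xs ys as bs q ds =
    u * grid_pf n xs (swapl k ys) as (swapl k bs) q ds + grid_pf n xs (swapl k ys) as bs q ds"
  using assms(2,3,5)
proof (induction xs arbitrary: as ds)
  case Nil
  then show ?case by (simp add: swapl_eq_iff)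
next
  case (Cons x xs)
  obtain a as' where as: "as = a # as'"
    using Cons.prems by (cases as) auto
  let ?W = "words n (length ys)"
  note row = row_pf_swap_columns[OF assms(1), of a n _ _ x, folded u_def]
  have "u * grid_pf n (x # xs) ys as bs q (swapl k ds) + grid_pf n (x # xs) ys as bs q ds =
    (\<Sum>es\<in>?W. (u * row_pf n x ys a es q (swapl k ds) + row_pf n x ys a es q ds) * grid_pf n xs ys as' bs q es)"
    by (simp add: as sum_regroup)
  also have "\<dots> = (\<Sum>es\<in>?W. (u * row_pf n x (swapl k ys) a (swapl k es) q ds + row_pf n x (swapl k ys) a es q ds) * grid_pf n xs ys as' bs q es)"
    using row Cons.prems as by simp
  \<comment> \<open>\<open>es\<close> is written as its double swap, so that reindexing by the
    bijection \<open>swapl k\<close> moves P from the bottom edges of the first row to the top edges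
    of the rest, where the induction hypothesis applies.\<close>
  also have "\<dots> = u * (\<Sum>es\<in>?W. row_pf n x (swapl k ys) a (swapl k es) q ds * grid_pf n xs ys as' bs q (swapl k (swapl k es))) +
     (\<Sum>es\<in>?W. row_pf n x (swapl k ys) a es q ds * grid_pf n xs ys as' bs q es)"
    by (simp add: sum_regroup)
  also have "(\<Sum>es\<in>?W. row_pf n x (swapl k ys) a (swapl k es) q ds * grid_pf n xs ys as' bs q (swapl k (swapl k es))) =
      (\<Sum>es\<in>?W. row_pf n x (swapl k ys) a es q ds * grid_pf n xs ys as' bs q (swapl k es))"
    by (rule sum_words_swapl)
  also have "u * (\<Sum>es\<in>?W. row_pf n x (swapl k ys) a es q ds * grid_pf n xs ys as' bs q (swapl k es)) +
     (\<Sum>es\<in>?W. row_pf n x (swapl k ys) a es q ds * grid_pf n xs ys as' bs q es) =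
     (\<Sum>es\<in>?W. row_pf n x (swapl k ys) a es q ds * (u * grid_pf n xs ys as' bs q (swapl k es) + grid_pf n xs ys as' bs q es))"
    by (rule sum_regroup')
  also have "\<dots> = (\<Sum>es\<in>?W. row_pf n x (swapl k ys) a es q ds *
     (u * grid_pf n xs (swapl k ys) as' (swapl k bs) q es + grid_pf n xs (swapl k ys) as' bs q es))"
    using Cons as by simp
  finally show ?case by (simp add: as sum_regroup')
qed

text \<open>Two stacked rows with independent right colours. \<open>grid_pf\<close> allows only a
  constant right boundary, but in the induction along the columns the crossing sits between
  horizontal edges of different colours.\<close>

definition double_row_pf where
  "double_row_pf n x1 x2 ys a1 a2 bs c1 c2 ds =
     (\<Sum>es\<in>words n (length ys). row_pf n x1 ys a1 es c1 ds * row_pf n x2 ys a2 bs c2 es)"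

lemma double_row_pf_Nil: "double_row_pf n x1 x2 [] a1 a2 bs c1 c2 ds = of_bool (a1 = c1) * of_bool (a2 = c2)"
  by (simp add: double_row_pf_def)

lemma double_row_pf_Cons:
  "double_row_pf n x1 x2 (y # ys) a1 a2 bs c1 c2 ds =
    (\<Sum>f1\<in>{1..n}. \<Sum>f2\<in>{1..n}.
      (\<Sum>e\<in>{1..n}. weight x1 y a1 e f1 (hd ds) * weight x2 y a2 (hd bs) f2 e) *
      double_row_pf n x1 x2 ys f1 f2 (tl bs) c1 c2 (tl ds))"
proof -
  let ?F = "\<lambda>e es f1 f2. weight x1 y a1 e f1 (hd ds) * row_pf n x1 ys f1 es c1 (tl ds) *
        (weight x2 y a2 (hd bs) f2 e * row_pf n x2 ys f2 (tl bs) c2 es)"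
  let ?C = "{1..n}" and ?W = "words n (length ys)"
  have "double_row_pf n x1 x2 (y # ys) a1 a2 bs c1 c2 ds =
    (\<Sum>e\<in>?C. \<Sum>es\<in>?W. \<Sum>f1\<in>?C. \<Sum>f2\<in>?C. ?F e es f1 f2)"
    by (simp add: double_row_pf_def sum_words_Cons sum_product)
  also have "\<dots> = (\<Sum>e\<in>?C. \<Sum>f1\<in>?C. \<Sum>es\<in>?W. \<Sum>f2\<in>?C. ?F e es f1 f2)"
    by (intro sum.cong refl sum.swap)
  also have "\<dots> = (\<Sum>f1\<in>?C. \<Sum>e\<in>?C. \<Sum>f2\<in>?C. \<Sum>es\<in>?W. ?F e es f1 f2)"
    by (subst sum.swap) (intro sum.cong refl sum.swap)
  also have "\<dots> = (\<Sum>f1\<in>?C. \<Sum>f2\<in>?C. \<Sum>e\<in>?C. \<Sum>es\<in>?W. ?F e es f1 f2)"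
    by (intro sum.cong refl sum.swap)
  finally show ?thesis
    by (simp add: double_row_pf_def sum_product mult.assoc mult.left_commute)
qed

lemma double_row_pf_swap:
  fixes x1 x2 :: "'a::comm_ring_1"
  assumes "ds \<in> words n (length ys)"
  defines "u \<equiv> x1 - x2"
  shows "u * double_row_pf n x1 x2 ys a1 a2 bs c2 c1 ds + double_row_pf n x1 x2 ys a1 a2 bs c1 c2 ds =
    u * double_row_pf n x2 x1 ys a2 a1 bs c1 c2 ds + double_row_pf n x2 x1 ys a1 a2 bs c1 c2 ds"
  using assms(1)
proof (induction ys arbitrary: a1 a2 bs ds)
  case Nil
  then show ?case by (simp add: double_row_pf_Nil)
next
  case (Cons y ys)
  obtain d ds' where ds: "ds = d # ds'" "d \<in> {1..n}" "ds' \<in> words n (length ys)"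
    using Cons.prems by (cases ds) (auto simp: words_def)
  let ?C = "{1..n}"
  define D where "D x1 x2 a1 a2 f1 f2 = (\<Sum>e\<in>?C. weight x1 y a1 e f1 d * weight x2 y a2 (hd bs) f2 e)"
    for x1 x2 a1 a2 f1 f2
  define R where "R x1 x2 f1 f2 c1 c2 = double_row_pf n x1 x2 ys f1 f2 (tl bs) c1 c2 ds'" for x1 x2 f1 f2 c1 c2
  have step: "double_row_pf n x1 x2 (y # ys) a1 a2 bs c1 c2 ds = (\<Sum>f1\<in>?C. \<Sum>f2\<in>?C. D x1 x2 a1 a2 f1 f2 * R x1 x2 f1 f2 c1 c2)"
    for x1 x2 a1 a2 c1 c2
    by (simp add: double_row_pf_Cons D_def R_def ds(1))
  have IH: "u * R x1 x2 f1 f2 c2 c1 + R x1 x2 f1 f2 c1 c2 = u * R x2 x1 f2 f1 c1 c2 + R x2 x1 f1 f2 c1 c2" for f1 f2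
    using Cons.IH[OF ds(3)] by (simp add: R_def)
  have ex: "u * D x1 x2 a1 a2 f2 f1 + D x1 x2 a1 a2 f1 f2 = u * D x2 x1 a2 a1 f1 f2 + D x2 x1 a1 a2 f1 f2"
    if "f1 \<in> ?C" "f2 \<in> ?C" for f1 f2
    using weight_exchange_rows[OF that ds(2)] by (simp add: D_def u_def)
  let ?P = "?C \<times> ?C"
  have "u * double_row_pf n x1 x2 (y # ys) a1 a2 bs c2 c1 ds + double_row_pf n x1 x2 (y # ys) a1 a2 bs c1 c2 ds
      = (\<Sum>(f1, f2)\<in>?P. D x1 x2 a1 a2 f1 f2 * (u * R x1 x2 f1 f2 c2 c1 + R x1 x2 f1 f2 c1 c2))"
    by (simp add: step sum.cartesian_product case_prod_unfold sum_regroup' del: atLeastAtMost_iff)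
  also have "\<dots> = u * (\<Sum>(f1, f2)\<in>?P. D x1 x2 a1 a2 f1 f2 * R x2 x1 f2 f1 c1 c2) +
     (\<Sum>(f1, f2)\<in>?P. D x1 x2 a1 a2 f1 f2 * R x2 x1 f1 f2 c1 c2)"
    by (simp add: IH case_prod_unfold sum_regroup')
  \<comment> \<open>Renaming \<open>(f1, f2)\<close> to \<open>(f2, f1)\<close> moves P from the
    left edges of the remaining columns to the right edges of the first one, where \<open>ex\<close>
    applies.\<close>
  also have "(\<Sum>(f1, f2)\<in>?P. D x1 x2 a1 a2 f1 f2 * R x2 x1 f2 f1 c1 c2) =
      (\<Sum>(f1, f2)\<in>?P. D x1 x2 a1 a2 f2 f1 * R x2 x1 f1 f2 c1 c2)"
    by (rule sum.reindex_bij_witness[of _ prod.swap prod.swap]) auto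
  also have "u * \<dots> + (\<Sum>(f1, f2)\<in>?P. D x1 x2 a1 a2 f1 f2 * R x2 x1 f1 f2 c1 c2) =
     (\<Sum>(f1, f2)\<in>?P. (u * D x1 x2 a1 a2 f2 f1 + D x1 x2 a1 a2 f1 f2) * R x2 x1 f1 f2 c1 c2)"
    by (simp add: case_prod_unfold sum_regroup)
  also have "\<dots> = (\<Sum>(f1, f2)\<in>?P. (u * D x2 x1 a2 a1 f1 f2 + D x2 x1 a1 a2 f1 f2) * R x2 x1 f1 f2 c1 c2)"
    by (intro sum.cong refl) (auto simp: ex)
  finally show ?case
    by (simp add: step sum.cartesian_product case_prod_unfold sum_regroup)
qed

lemma grid_pf_swap_rows:
  assumes "Suc k < length xs" "length as = length xs" "ds \<in> words n (length ys)"
  defines "u \<equiv> xs ! k - xs ! Suc k"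
  shows "(u + 1) * grid_pf n xs ys as bs q ds =
    u * grid_pf n (swapl k xs) ys (swapl k as) bs q ds + grid_pf n (swapl k xs) ys as bs q ds"
  using assms(1-3) unfolding u_def
proof (induction k arbitrary: xs as ds)
  case 0
  obtain x1 x2 xs' where xs: "xs = x1 # x2 # xs'"
    using 0(1) by (cases xs; cases "tl xs") auto
  obtain a1 a2 as' where as: "as = a1 # a2 # as'"
    using 0 xs by (cases as; cases "tl as") auto
  have two: "grid_pf n (z1 # z2 # xs') ys (c1 # c2 # as') bs q ds =
    (\<Sum>es\<in>words n (length ys). double_row_pf n z1 z2 ys c1 c2 es q q ds * grid_pf n xs' ys as' bs q es)"
    for z1 z2 c1 c2
    by (simp add: double_row_pf_def sum_distrib_left sum_distrib_right mult.assoc) (rule sum.swap)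
  have "((x1 - x2) + 1) * double_row_pf n x1 x2 ys a1 a2 es q q ds =
     (x1 - x2) * double_row_pf n x2 x1 ys a2 a1 es q q ds + double_row_pf n x2 x1 ys a1 a2 es q q ds" for es
    using double_row_pf_swap[OF 0(3), of x1 x2 a1 a2 es q q] by (simp add: algebra_simps)
  then show ?case
    by (simp add: xs as two sum_distrib_left mult.assoc[symmetric] sum.distrib[symmetric]
        distrib_right[symmetric] del: grid_pf.simps)
next
  case (Suc k)
  obtain x xs' where xs: "xs = x # xs'"
    using Suc.prems by (cases xs) auto
  obtain a as' where as: "as = a # as'"
    using Suc.prems xs by (cases as) auto
  have "(xs' ! k - xs' ! Suc k + 1) * (r * grid_pf n xs' ys as' bs q es) =
     r * ((xs' ! k - xs' ! Suc k) * grid_pf n (swapl k xs') ys (swapl k as') bs q es + grid_pf n (swapl k xs') ys as' bs q es)"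
     if "es \<in> words n (length ys)" for es r
    using Suc.IH[of xs' as' es] Suc.prems that by (simp add: xs as mult.left_commute)
  then show ?case
    by (simp add: xs as sum_distrib_left sum.distrib distrib_left mult.left_commute)
qed

section \<open>The last column and the last row\<close>

text \<open>If the lines turned at some vertex, the horizontal one would take the bottom colour
  \<open>q\<close> and keep it to the right end, because every bottom edge has colour
  \<open>q\<close>. As \<open>c \<noteq> q\<close>, every vertex is crossed straight, with weight
  \<open>x - y\<close>.\<close>

lemma row_pf_frozen:
  assumes "q \<in> {1..n}" "a \<in> {1..n}" "c \<in> {1..n}" "c \<noteq> q" "length ds = length ys"
  shows "row_pf n x ys a (replicate (length ys) q) c ds =
    of_bool (a = c \<and> ds = replicate (length ys) q) * (\<Prod>y\<leftarrow>ys. x - y)"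
  using assms(2,5)
proof (induction ys arbitrary: a ds)
  case Nil
  then show ?case by simp
next
  case (Cons y ys)
  obtain d ds' where ds: "ds = d # ds'" "length ds' = length ys"
    using Cons.prems by (metis length_Suc_conv)
  have "row_pf n x (y # ys) a (replicate (length (y # ys)) q) c ds =
    (x - y) * of_bool (q = d) * row_pf n x ys a (replicate (length ys) q) c ds' +
    of_bool (a = d) * row_pf n x ys q (replicate (length ys) q) c ds'"
    unfolding ds(1) by (simp add: sum_weight_right[OF Cons.prems(1) assms(1)] del: One_nat_def)
  then show ?case
    using Cons.IH[OF Cons.prems(1) ds(2)] Cons.IH[OF assms(1) ds(2)] assms(4) by (auto simp: ds(1))
qed

text \<open>The right edge is known to be \<open>q\<close>, so the left edge of the last vertex is
  \<open>q\<close> if the lines cross straight and \<open>d\<close> if they turn; the second case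
  needs \<open>d\<close> to lie in the palette over which that edge is summed.\<close>

lemma row_pf_last_column:
  assumes "a \<in> {1..n}" "q \<in> {1..n}" "e \<in> {1..n}"
    "length es = length ys" "length ds = length ys"
  shows "row_pf n x (ys @ [y]) a (es @ [e]) q (ds @ [d]) =
    (x - y) * of_bool (e = d) * row_pf n x ys a es q ds +
    (if d \<in> {1..n} then of_bool (e = q) * row_pf n x ys a es d ds else 0)"
proof -
  have "(\<Sum>f\<in>{1..n}. row_pf n x ys a es f ds * weight x y f e q d) =
    (\<Sum>f\<in>{1..n}. (x - y) * of_bool (e = d) * (of_bool (f = q) * row_pf n x ys a es f ds) +
       of_bool (e = q) * (of_bool (f = d) * row_pf n x ys a es f ds))"
    by (rule sum.cong) (auto simp: weight_eq algebra_simps)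
  also have "\<dots> = (x - y) * of_bool (e = d) * (\<Sum>f\<in>{1..n}. of_bool (f = q) * row_pf n x ys a es f ds) +
     of_bool (e = q) * (\<Sum>f\<in>{1..n}. of_bool (f = d) * row_pf n x ys a es f ds)"
    by (simp only: sum.distrib sum_distrib_left)
  also have "(\<Sum>f\<in>{1..n}. of_bool (f = d) * row_pf n x ys a es f ds) =
      (if d \<in> {1..n} then row_pf n x ys a es d ds else 0)"
    by (cases "d \<in> {1..n}") (simp_all only: sum_of_bool_eq finite_atLeastAtMost if_True if_False, auto intro!: sum.neutral)
  finally show ?thesis
    using assms by (simp add: row_pf_snoc sum_of_bool_eq del: sum_mult_of_bool_eq sum_of_bool_mult_eq)
qed

text \<open>For top colour \<open>q\<close> both summands of \<open>row_pf_last_column\<close> force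
  the next vertical edge to be \<open>q\<close> and differ only in the factor \<open>x - y\<close>
  versus 1. So \<open>q\<close> runs down the whole column, with one factor \<open>x - y + 1\<close>
  per row.\<close>

lemma grid_pf_last_column:
  assumes "q \<in> {1..n}" "length as = length xs" "set as \<subseteq> {1..n}" "length bs = length ys"
     "ds \<in> words n (length ys)"
  shows "grid_pf n xs (ys @ [y]) as (bs @ [q]) q (ds @ [q]) =
    (\<Prod>x\<leftarrow>xs. x - y + 1) * grid_pf n xs ys as bs q ds"
  using assms(2,3,5)
proof (induction xs arbitrary: as ds)
  case Nil
  then show ?case by simp
next
  case (Cons x xs)
  obtain a as' where as: "as = a # as'" "a \<in> {1..n}" "length as' = length xs" "set as' \<subseteq> {1..n}"
    using Cons.prems by (cases as) auto
  have "grid_pf n (x # xs) (ys @ [y]) as (bs @ [q]) q (ds @ [q]) =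
    (\<Sum>es\<in>words n (length ys). \<Sum>e\<in>{1..n}. of_bool (e = q) * ((x - y + 1) * row_pf n x ys a es q ds *
       grid_pf n xs (ys @ [y]) as' (bs @ [q]) q (es @ [e])))"
    using Cons.prems as assms(1)
    by (auto simp: sum_words_snoc row_pf_last_column length_words algebra_simps intro!: sum.cong)
  also have "\<dots> = (\<Sum>es\<in>words n (length ys). (x - y + 1) * row_pf n x ys a es q ds *
       grid_pf n xs (ys @ [y]) as' (bs @ [q]) q (es @ [q]))"
    by (intro sum.cong refl sum_of_bool_eq) (use assms in auto)
  also have "\<dots> = (\<Sum>es\<in>words n (length ys). (x - y + 1) * row_pf n x ys a es q ds *
       ((\<Prod>x\<leftarrow>xs. x - y + 1) * grid_pf n xs ys as' bs q es))"
    using Cons.IH as by simp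
  finally show ?case
    using as by (simp add: sum_distrib_left mult.assoc mult.left_commute)
qed

text \<open>The path of colour \<open>d\<close> leaves the last column in exactly one row: either the top one
  (second summand) or a lower one.\<close>

lemma grid_pf_last_column_Cons:
  assumes "q \<in> {1..n}" "d \<in> {1..n}" "d \<noteq> q" "length as = length xs" "a \<in> {1..n}" "set as \<subseteq> {1..n}"
     "length bs = length ys" "ds \<in> words n (length ys)"
  shows "grid_pf n (x # xs) (ys @ [y]) (a # as) (bs @ [q]) q (ds @ [d]) =
    (x - y) * (\<Sum>es\<in>words n (length ys). row_pf n x ys a es q ds * grid_pf n xs (ys @ [y]) as (bs @ [q]) q (es @ [d])) +
    (\<Prod>x\<leftarrow>xs. x - y + 1) * (\<Sum>es\<in>words n (length ys). row_pf n x ys a es d ds * grid_pf n xs ys as bs q es)"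
proof -
  let ?W = "words n (length ys)"
  let ?G = "\<lambda>es e. grid_pf n xs (ys @ [y]) as (bs @ [q]) q (es @ [e])"
  have "grid_pf n (x # xs) (ys @ [y]) (a # as) (bs @ [q]) q (ds @ [d]) =
    (\<Sum>es\<in>?W. \<Sum>e\<in>{1..n}. of_bool (e = d) * ((x - y) * row_pf n x ys a es q ds * ?G es e) +
       of_bool (e = q) * (row_pf n x ys a es d ds * ?G es e))"
    using assms
    by (auto simp: sum_words_snoc row_pf_last_column length_words algebra_simps intro!: sum.cong)
  also have "\<dots> = (\<Sum>es\<in>?W. (x - y) * row_pf n x ys a es q ds * ?G es d + row_pf n x ys a es d ds * ?G es q)"
    using assms(1,2) by (simp only: sum.distrib sum_of_bool_eq finite_atLeastAtMost)
  also have "\<dots> = (\<Sum>es\<in>?W. (x - y) * row_pf n x ys a es q ds * ?G es d +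
       row_pf n x ys a es d ds * ((\<Prod>x\<leftarrow>xs. x - y + 1) * grid_pf n xs ys as bs q es))"
    using assms by (simp add: grid_pf_last_column)
  finally show ?thesis
    by (simp add: sum.distrib sum_distrib_left mult.assoc mult.left_commute)
qed

section \<open>Dependence on the variable of the last column\<close>

lemma degree_prod_list_linear: "degree (\<Prod>x\<leftarrow>xs. [:x + 1, -1:] :: 'a::idom poly) \<le> length xs"
proof (induction xs)
  case (Cons x xs)
  then show ?case
    using degree_mult_le[of "[:x + 1, -1:]" "\<Prod>x\<leftarrow>xs. [:x + 1, -1:]"] by simp
qed simp

lemma poly_prod_list: "poly (\<Prod>x\<leftarrow>xs. f x) y = (\<Prod>x\<leftarrow>xs. poly (f x) y)"
  by (induction xs) auto

lemma ex_poly_sum: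
  fixes F :: "'b \<Rightarrow> 'a::idom \<Rightarrow> 'a"
  assumes "\<And>e. e \<in> S \<Longrightarrow> \<exists>p. degree p \<le> m \<and> (\<forall>y. F e y = poly p y)" "finite S"
  shows "\<exists>p. degree p \<le> m \<and> (\<forall>y. (\<Sum>e\<in>S. G e * F e y) = poly p y)"
proof -
  obtain p where p: "degree (p e) \<le> m" "F e y = poly (p e) y" if "e \<in> S" for e y
    using assms(1) by metis
  have "degree (\<Sum>e\<in>S. smult (G e) (p e)) \<le> m"
    by (intro degree_sum_le assms(2)) (use p order.trans[OF degree_smult_le] in blast)
  moreover have "(\<Sum>e\<in>S. G e * F e y) = poly (\<Sum>e\<in>S. smult (G e) (p e)) y" for y
    by (simp add: poly_sum p)
  ultimately show ?thesis by blast
qed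

text \<open>Each row contributes a factor linear in \<open>y\<close>, except the one in which the
  path of colour \<open>d\<close> enters the column: there the lines turn with weight 1. This
  accounts for the \<open>- 1\<close> in the bound.\<close>

lemma grid_pf_degree:
  fixes xs :: "'a::idom list"
  assumes "q \<in> {1..n}" "d \<in> {1..n}" "d \<noteq> q" "length as = length xs" "set as \<subseteq> {1..n}"
     "length bs = length ys" "ds \<in> words n (length ys)"
  shows "\<exists>p. degree p \<le> length xs - 1 \<and>
    (\<forall>y. grid_pf n xs (ys @ [y]) as (bs @ [q]) q (ds @ [d]) = poly p y)"
  using assms(4,5,7)
proof (induction xs arbitrary: as ds)
  case Nil
  then show ?case using assms(3) by (intro exI[of _ 0]) auto
next
  case (Cons x xs)
  obtain a as' where as: "as = a # as'" "a \<in> {1..n}" "length as' = length xs" "set as' \<subseteq> {1..n}"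
    using Cons.prems by (cases as) auto
  let ?W = "words n (length ys)"
  define c where "c = (\<Sum>es\<in>?W. row_pf n x ys a es d ds * grid_pf n xs ys as' bs q es)"
  have "\<exists>p. degree p \<le> length xs - 1 \<and> (\<forall>y. (\<Sum>es\<in>?W. row_pf n x ys a es q ds *
      grid_pf n xs (ys @ [y]) as' (bs @ [q]) q (es @ [d])) = poly p y)"
    by (rule ex_poly_sum) (use Cons.IH as in auto)
  then obtain p where p: "degree p \<le> length xs - 1"
    "\<And>y. (\<Sum>es\<in>?W. row_pf n x ys a es q ds *
      grid_pf n xs (ys @ [y]) as' (bs @ [q]) q (es @ [d])) = poly p y"
    by blast
  have eq: "grid_pf n (x # xs) (ys @ [y]) as (bs @ [q]) q (ds @ [d]) =
    (x - y) * poly p y + (\<Prod>x\<leftarrow>xs. x - y + 1) * c" for y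
    using grid_pf_last_column_Cons[OF assms(1-3) as(3,2,4) assms(6) Cons.prems(3), of x y] p(2)
    by (simp add: as(1) c_def del: grid_pf.simps)
  show ?case
  proof (cases "xs = []")
    case True
    \<comment> \<open>With truncated subtraction the bound on \<open>p\<close> is still 0 when no
      lower row is left, which would allow \<open>(x - y) * poly p y\<close> to be linear. But then
      the sum behind \<open>p\<close> vanishes, because a top edge \<open>d\<close> cannot be joined
      directly to a bottom edge \<open>q\<close>.\<close>
    have "poly p y = 0" for y
      using p(2)[of y] assms(3) True by (simp add: sum.neutral)
    then show ?thesis
      using True eq by (intro exI[of _ "[:c:]"]) simp
  next
    case False
    let ?p = "[:x, -1:] * p + smult c (\<Prod>x\<leftarrow>xs. [:x + 1, -1:])"
    have "degree ([:x, -1:] * p) \<le> 1 + degree p"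
      using degree_mult_le[of "[:x, -1:]" p] by simp
    then have "degree ?p \<le> length (x # xs) - 1"
      using p(1) False degree_prod_list_linear[of xs] degree_smult_le[of c]
      by (intro degree_add_le) (auto intro: order.trans simp: Suc_le_eq elim!: le_trans)
    moreover have "grid_pf n (x # xs) (ys @ [y]) as (bs @ [q]) q (ds @ [d]) = poly ?p y" for y
      unfolding eq by (simp add: poly_prod_list algebra_simps)
    ultimately show ?thesis by blast
  qed
qed

text \<open>With one row the path has to turn in the last column, with weight 1, so \<open>y\<close>
  disappears; the rest of the row is frozen by \<open>row_pf_frozen\<close>. This is the base case
  of \<open>grid_pf_specialize\<close> and, for \<open>k_M = 1\<close>, the source of the initial
  condition.\<close>

lemma grid_pf_single_row:
  assumes "q \<in> {1..n}" "d \<in> {1..n}" "d \<noteq> q" "a \<in> {1..n}" "ds \<in> words n (length ys)"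
  defines "bs \<equiv> replicate (length ys) q"
  shows "grid_pf n [x] (ys @ [y]) [a] (bs @ [q]) q (ds @ [d]) =
    of_bool (a = d \<and> bs = ds) * (\<Prod>y\<leftarrow>ys. x - y)"
proof -
  have len: "length bs = length ys"
    by (simp add: bs_def)
  have "bs \<in> words n (length ys)"
    using assms(1) by (auto simp: words_def bs_def)
  then have "(\<Sum>es\<in>words n (length ys). row_pf n x ys a es d ds * grid_pf n [] ys [] bs q es) = row_pf n x ys a bs d ds"
    by (simp add: of_bool_def if_distrib cong: if_cong)
  moreover have "row_pf n x ys a bs d ds = of_bool (a = d \<and> ds = bs) * (\<Prod>y\<leftarrow>ys. x - y)"
    unfolding bs_def using assms by (intro row_pf_frozen) (auto simp: words_def)
  moreover have "(\<Sum>es\<in>words n (length ys). row_pf n x ys a es q ds *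
      grid_pf n [] (ys @ [y]) [] (bs @ [q]) q (es @ [d])) = 0"
    using assms(3) by (intro sum.neutral) auto
  ultimately show ?thesis
    using grid_pf_last_column_Cons[OF assms(1-3), of "[]" "[]" a bs ys ds x y] assms(3-5)
    by (auto simp: len of_bool_conj eq_commute[of ds] simp del: row_pf.simps sum_mult_of_bool_eq sum_of_bool_mult_eq)
qed

lemma grid_pf_specialize:
  assumes "q \<in> {1..n}" "d \<in> {1..n}" "d \<noteq> q" "length as = length xs" "set (as @ [a]) \<subseteq> {1..n}"
     "ds \<in> words n (length ys)"
  defines "bs \<equiv> replicate (length ys) q"
  shows "grid_pf n (xs @ [x]) (ys @ [x + 1]) (as @ [a]) (bs @ [q]) q (ds @ [d]) =
    (\<Prod>z\<leftarrow>xs. z - x - 1) * (\<Prod>y\<leftarrow>ys. x - y) * of_bool (a = d) * grid_pf n xs ys as bs q ds"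
  using assms(4-6)
proof (induction xs arbitrary: as ds)
  case Nil
  then show ?case
    using grid_pf_single_row[OF assms(1-3), of a ds ys x "x + 1"]
    by (simp add: bs_def of_bool_conj mult_ac del: grid_pf.simps(2) row_pf.simps)
next
  case (Cons z xs)
  obtain a' as' where as: "as = a' # as'" "a' \<in> {1..n}" "length as' = length xs" "set as' \<subseteq> {1..n}"
    using Cons.prems by (cases as) auto
  have "0 \<in> set (map (\<lambda>z. z - (x + 1) + 1) (xs @ [x]))" by simp
  then have zero: "(\<Prod>z\<leftarrow>xs @ [x]. z - (x + 1) + 1) = 0"
    by simp
  have "grid_pf n ((z # xs) @ [x]) (ys @ [x + 1]) (as @ [a]) (bs @ [q]) q (ds @ [d]) =
    (z - (x + 1)) * (\<Sum>es\<in>words n (length ys). row_pf n z ys a' es q ds *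
      grid_pf n (xs @ [x]) (ys @ [x + 1]) (as' @ [a]) (bs @ [q]) q (es @ [d]))"
    using grid_pf_last_column_Cons[OF assms(1-3), of "as' @ [a]" "xs @ [x]" a' bs ys ds z "x + 1"]
      Cons.prems as zero by (simp add: bs_def del: grid_pf.simps)
  also have "\<dots> = (z - (x + 1)) * (\<Sum>es\<in>words n (length ys). row_pf n z ys a' es q ds *
      ((\<Prod>z\<leftarrow>xs. z - x - 1) * (\<Prod>y\<leftarrow>ys. x - y) * of_bool (a = d) * grid_pf n xs ys as' bs q es))"
    using Cons.IH[of as'] Cons.prems as by simp
  finally show ?case
    by (simp add: as(1) sum_distrib_left mult.assoc mult.left_commute diff_diff_eq)
qed

text \<open>By \<open>weight_eq\<close> the right and top colours of a vertex are its left and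
  bottom colours in some order. So colours at most \<open>n\<close> entering from the left and from
  below never produce a larger one, and enlarging the palette adds no configurations.\<close>

lemma row_pf_restrict_colours:
  assumes "n \<le> n'" "a \<in> {1..n}" "set bs \<subseteq> {1..n}" "length bs = length ys" "length ds = length ys"
  shows "row_pf n' x ys a bs c ds = (if c \<in> {1..n} \<and> set ds \<subseteq> {1..n} then row_pf n x ys a bs c ds else 0)"
  using assms(2-5)
proof (induction ys arbitrary: a bs ds)
  case Nil
  then show ?case by auto
next
  case (Cons y ys)
  obtain b bs' where bs: "bs = b # bs'" "b \<in> {1..n}" "set bs' \<subseteq> {1..n}" "length bs' = length ys"
    using Cons.prems by (cases bs) auto
  obtain d ds' where ds: "ds = d # ds'" "length ds' = length ys"
    using Cons.prems by (cases ds) auto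
  have "a \<in> {1..n'}" "b \<in> {1..n'}" using Cons.prems bs assms(1) by auto
  then show ?case
    using Cons.IH[OF Cons.prems(1) bs(3,4) ds(2)] Cons.IH[OF bs(2,3,4) ds(2)] Cons.prems(1) bs(2)
    by (auto simp: bs(1) ds(1) sum_weight_right simp del: One_nat_def)
qed

lemma sum_words_restrict:
  assumes "n \<le> n'"
  shows "(\<Sum>w\<in>words n' m. if set w \<subseteq> {1..n} then f w else 0) = (\<Sum>w\<in>words n m. f w)"
proof -
  have "words n m = {w \<in> words n' m. set w \<subseteq> {1..n}}"
    using assms by (auto simp: words_def subset_iff)
  then show ?thesis by (simp only: sum.inter_filter finite_words)
qed

lemma grid_pf_restrict_colours:
  assumes "n \<le> n'" "set as \<subseteq> {1..n}" "length as = length xs" "set bs \<subseteq> {1..n}" "length bs = length ys"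
    "q \<in> {1..n}" "length ds = length ys"
  shows "grid_pf n' xs ys as bs q ds = (if set ds \<subseteq> {1..n} then grid_pf n xs ys as bs q ds else 0)"
  using assms(2,3,7)
proof (induction xs arbitrary: as ds)
  case Nil
  then show ?case using assms by auto
next
  case (Cons x xs)
  obtain a as' where as: "as = a # as'" "a \<in> {1..n}" "length as' = length xs" "set as' \<subseteq> {1..n}"
    using Cons.prems by (cases as) auto
  have "grid_pf n' (x # xs) ys as bs q ds =
    (\<Sum>es\<in>words n' (length ys). if set es \<subseteq> {1..n} then
        (if set ds \<subseteq> {1..n} then row_pf n x ys a es q ds else 0) * grid_pf n xs ys as' bs q es else 0)"
    using Cons as assms
    by (auto simp: length_words row_pf_restrict_colours intro!: sum.cong)
  also have "\<dots> = (\<Sum>es\<in>words n (length ys).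
        (if set ds \<subseteq> {1..n} then row_pf n x ys a es q ds else 0) * grid_pf n xs ys as' bs q es)"
    by (rule sum_words_restrict[OF assms(1)])
  finally show ?case by (simp add: as)
qed

section \<open>The layers below the top layer\<close>

definition top_I :: "'a variables \<Rightarrow> (nat \<Rightarrow> nat set) \<Rightarrow> nat \<Rightarrow> nat list" where
  "top_I V I p = map (\<lambda>s. colour_of I p (offset_I V p + s)) [1..<Suc (L_I V p)]"

definition top_II :: "'a variables \<Rightarrow> (nat \<Rightarrow> nat set) \<Rightarrow> nat \<Rightarrow> nat list" where
  "top_II V I p = map (\<lambda>s. colour_of I p (offset_II V p + s)) [1..<Suc (L_II V p)]"

definition top_colours :: "'a variables \<Rightarrow> (nat \<Rightarrow> nat set) \<Rightarrow> nat list" where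
  "top_colours V I = map (\<lambda>s. colour_of I (layers V) (offset_I V (layers V) + s)) [1..<Suc (L_top V)]"

text \<open>\<open>low_pf n V I p g\<close> is the partition function of the layers \<open>1, ..., p\<close> when the edges joining
  layer \<open>p\<close> to layer \<open>p + 1\<close> have colours \<open>g\<close>, and all edges have colours in \<open>{1..n}\<close>.\<close>

primrec low_pf :: "nat \<Rightarrow> 'a::comm_ring_1 variables \<Rightarrow> (nat \<Rightarrow> nat set) \<Rightarrow> nat \<Rightarrow> nat list \<Rightarrow> 'a" where
  "low_pf n V I 0 g = of_bool (set g \<subseteq> {1})"
| "low_pf n V I (Suc p) g =
     (let ys = yI V (Suc p) @ xvars V (Suc (Suc p)) @ yII V (Suc p) in
      \<Sum>l\<in>words n (k_size V (Suc p)). low_pf n V I p l *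
        grid_pf n (xvars V (Suc p)) ys l (replicate (length ys) (p + 2)) (p + 2)
          (top_I V I (Suc p) @ g @ top_II V I (Suc p)))"

lemma colour_of_bounds: "colour_of I p c \<in> {1..Suc p}"
proof -
  let ?P = "\<lambda>j. j = p + 1 \<or> (j \<in> {1..p} \<and> c \<in> I j)"
  have "?P (LEAST j. ?P j)" by (rule LeastI[of ?P "p + 1"]) simp
  then show ?thesis by (auto simp: colour_of_def)
qed

lemma top_I_words: "p < n \<Longrightarrow> top_I V I p \<in> words n (L_I V p)"
  and top_II_words: "p < n \<Longrightarrow> top_II V I p \<in> words n (L_II V p)"
  and top_colours_words: "layers V < n \<Longrightarrow> top_colours V I \<in> words n (L_top V)"
  using colour_of_bounds[of I]
  by (fastforce simp: words_def top_I_def top_II_def top_colours_def simp del: upt_Suc)+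

lemma low_pf_cong:
  assumes "\<And>q. 1 \<le> q \<Longrightarrow> q \<le> Suc p \<Longrightarrow> xvars V' q = xvars V q"
    "\<And>q. 1 \<le> q \<Longrightarrow> q \<le> p \<Longrightarrow> yI V' q = yI V q"
    "\<And>q. 1 \<le> q \<Longrightarrow> q \<le> p \<Longrightarrow> yII V' q = yII V q"
    "\<And>q. 1 \<le> q \<Longrightarrow> q \<le> p \<Longrightarrow> top_I V' J q = top_I V I q"
    "\<And>q. 1 \<le> q \<Longrightarrow> q \<le> p \<Longrightarrow> top_II V' J q = top_II V I q"
  shows "low_pf n V' J p g = low_pf n V I p g"
  using assms
proof (induction p arbitrary: g)
  case (Suc p)
  have "low_pf n V' J p l = low_pf n V I p l" for l
    by (rule Suc.IH) (use Suc.prems in auto)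
  then show ?case using Suc.prems by simp
qed simp

lemma low_pf_restrict_colours:
  assumes "n \<le> n'" "p < n" "length g = k_size V (Suc p)"
  shows "low_pf n' V I p g = (if set g \<subseteq> {1..n} then low_pf n V I p g else 0)"
  using assms(2,3)
proof (induction p arbitrary: g)
  case 0
  then show ?case by (auto simp: subset_iff)
next
  case (Suc p)
  let ?ys = "yI V (Suc p) @ xvars V (Suc (Suc p)) @ yII V (Suc p)"
  let ?G = "\<lambda>n l. grid_pf n (xvars V (Suc p)) ?ys l (replicate (length ?ys) (p + 2)) (p + 2)
          (top_I V I (Suc p) @ g @ top_II V I (Suc p))"
  have tops: "set (top_I V I (Suc p)) \<subseteq> {1..n}" "set (top_II V I (Suc p)) \<subseteq> {1..n}"
      "length (top_I V I (Suc p)) = L_I V (Suc p)" "length (top_II V I (Suc p)) = L_II V (Suc p)"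
    using top_I_words[of "Suc p" n V I] top_II_words[of "Suc p" n V I] Suc.prems by (auto simp: words_def)
  have "low_pf n' V I (Suc p) g = (\<Sum>l\<in>words n' (k_size V (Suc p)). if set l \<subseteq> {1..n} then
     low_pf n V I p l * (if set g \<subseteq> {1..n} then ?G n l else 0) else 0)"
    unfolding low_pf.simps Let_def
  proof (intro sum.cong refl)
    fix l assume l: "l \<in> words n' (k_size V (Suc p))"
    have "?G n' l = (if set (top_I V I (Suc p) @ g @ top_II V I (Suc p)) \<subseteq> {1..n} then ?G n l else 0)" if "set l \<subseteq> {1..n}"
      by (rule grid_pf_restrict_colours[OF assms(1) that]) (use l Suc.prems tops in \<open>auto simp: words_def\<close>)
    then show "low_pf n' V I p l * ?G n' l = (if set l \<subseteq> {1..n} then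
     low_pf n V I p l * (if set g \<subseteq> {1..n} then ?G n l else 0) else 0)"
      using Suc.IH[of l] Suc.prems l tops by (simp add: length_words)
  qed
  also have "\<dots> = (\<Sum>l\<in>words n (k_size V (Suc p)).
     low_pf n V I p l * (if set g \<subseteq> {1..n} then ?G n l else 0))"
    by (rule sum_words_restrict[OF assms(1)])
  finally show ?case by (simp add: Let_def)
qed

lemma low_pf_swap:
  assumes "Suc k < k_size V (Suc p)" "Suc p < n" "g \<in> words n (k_size V (Suc p))"
  defines "u \<equiv> xvars V (Suc p) ! k - xvars V (Suc p) ! Suc k"
    and "V' \<equiv> V\<lparr>xvars := (xvars V)(Suc p := swapl k (xvars V (Suc p)))\<rparr>"
  shows "u * low_pf n V I p (swapl k g) + low_pf n V I p g = (u + 1) * low_pf n V' I p g"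
proof (cases p)
  case 0
  \<comment> \<open>Without lower layers \<open>low_pf\<close> only tests whether all entries of
    \<open>g\<close> are 1, and P does not affect this.\<close>
  then show ?thesis by (simp add: distrib_right)
next
  case (Suc m)
  let ?xs = "xvars V (Suc p)" and ?tI = "top_I V I p" and ?tII = "top_II V I p"
  let ?ys = "yI V p @ ?xs @ yII V p" and ?K = "L_I V p + k"
  let ?bs = "replicate (length ?ys) (m + 2)"
  have tops: "?tI \<in> words n (L_I V p)" "?tII \<in> words n (L_II V p)"
    using assms(2) by (auto intro!: top_I_words top_II_words)
  have top': "top_I V' I q = top_I V I q" "top_II V' I q = top_II V I q" for q
    by (simp_all add: V'_def top_I_def top_II_def offset_I_def offset_II_def)
  have sw: "swapl ?K (pre @ zs @ post) = pre @ swapl k zs @ post"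
    if "length pre = L_I V p" "length zs = length ?xs" for pre zs post :: "'c list"
    using that assms(1) swapl_append1[of pre k "zs @ post"] by (simp add: swapl_append2)
  have low': "low_pf n V' I m l = low_pf n V I m l" for l
  proof (rule low_pf_cong)
    show "xvars V' q = xvars V q" if "q \<le> Suc m" for q
      using that Suc by (simp add: V'_def)
    show "yI V' q = yI V q" "yII V' q = yII V q" for q
      by (simp_all add: V'_def)
  qed (rule top')+
  let ?G = "\<lambda>ys l g. grid_pf n (xvars V p) ys l ?bs (m + 2) (?tI @ g @ ?tII)"
  have G: "u * ?G ?ys l (swapl k g) + ?G ?ys l g = (u + 1) * ?G (swapl ?K ?ys) l g"
    if "l \<in> words n (k_size V p)" for l
  proof -
    have u: "?ys ! ?K - ?ys ! Suc ?K = u"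
      using assms(1) by (simp add: u_def nth_append)
    have swd: "swapl ?K (?tI @ g @ ?tII) = ?tI @ swapl k g @ ?tII"
      using tops assms(3) by (intro sw) (auto simp: words_def)
    have "u * grid_pf n (xvars V p) ?ys l ?bs (m + 2) (swapl ?K (?tI @ g @ ?tII)) + ?G ?ys l g =
      u * grid_pf n (xvars V p) (swapl ?K ?ys) l (swapl ?K ?bs) (m + 2) (?tI @ g @ ?tII) + ?G (swapl ?K ?ys) l g"
      unfolding u[symmetric]
      by (rule grid_pf_swap_columns) (use that tops assms(1-3) Suc in \<open>auto simp: words_def\<close>)
    then show ?thesis
      unfolding swd swapl_replicate by (simp only: distrib_right mult_1)
  qed
  have "u * low_pf n V I p (swapl k g) + low_pf n V I p g =
    (\<Sum>l\<in>words n (k_size V p). low_pf n V I m l * (u * ?G ?ys l (swapl k g) + ?G ?ys l g))"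
    by (simp add: Suc Let_def sum_regroup')
  also have "\<dots> = (\<Sum>l\<in>words n (k_size V p). low_pf n V I m l * ((u + 1) * ?G (swapl ?K ?ys) l g))"
    using G by simp
  also have "\<dots> = (u + 1) * low_pf n V' I p g"
    by (simp add: Suc Let_def top' low' sum_distrib_left mult.left_commute sw[unfolded Suc])
      (simp add: V'_def Suc)
  finally show ?thesis .
qed

section \<open>The partition function as a sum over the colours between layers\<close>

lemma sum_PiE_insert:
  assumes "x \<notin> A"
  shows "(\<Sum>f\<in>PiE (insert x A) B. \<phi> f) = (\<Sum>c\<in>B x. \<Sum>f\<in>PiE A B. \<phi> (f(x := c)))"
proof -
  have "inj_on (\<lambda>(y, g). g(x := y)) (B x \<times> PiE A B)"
  proof (rule inj_onI, clarify)
    fix y g y' g' assume *: "g \<in> PiE A B" "g' \<in> PiE A B" "g(x := y) = g'(x := y')"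
    have "g x = undefined" "g' x = undefined"
      using *(1,2) assms by (auto simp: PiE_def extensional_def)
    then show "y = y' \<and> g = g'"
      using *(3) by (metis fun_upd_same fun_upd_triv fun_upd_upd)
  qed
  then show ?thesis
    by (simp add: PiE_insert_eq sum.reindex sum.cartesian_product case_prod_unfold)
qed

text \<open>Currying turns a colouring of a disjoint union of edge sets into a family of independent
  colourings, over which a sum of products factors. In \<open>sum_h_edges\<close> this separates the
  layers, and then the rows of a layer.\<close>

lemma sum_PiE_Sigma_prod:
  fixes \<phi> :: "'i \<Rightarrow> ('j \<Rightarrow> 'c) \<Rightarrow> 'b::comm_semiring_1"
  assumes "finite A" "\<And>a. a \<in> A \<Longrightarrow> finite (B a)" "finite C"
  shows "(\<Sum>h\<in>PiE (Sigma A B) (\<lambda>_. C). \<Prod>a\<in>A. \<phi> a (\<lambda>b. h (a, b))) =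
    (\<Prod>a\<in>A. \<Sum>f\<in>PiE (B a) (\<lambda>_. C). \<phi> a f)"
proof -
  have "(\<Prod>a\<in>A. \<Sum>f\<in>PiE (B a) (\<lambda>_. C). \<phi> a f) =
    (\<Sum>g\<in>PiE A (\<lambda>a. PiE (B a) (\<lambda>_. C)). \<Prod>a\<in>A. \<phi> a (g a))"
    using assms by (intro prod_sum_PiE) (auto intro: finite_PiE)
  also have "\<dots> = (\<Sum>h\<in>PiE (Sigma A B) (\<lambda>_. C). \<Prod>a\<in>A. \<phi> a (\<lambda>b. h (a, b)))"
  \<comment> \<open>Only the outer abstraction over \<open>a\<close> needs to be restricted:
    \<open>h\<close> is already \<open>undefined\<close> off \<open>Sigma A B\<close>, which makes
    \<open>\<lambda>b. h (a, b)\<close> extensional on \<open>B a\<close>.\<close>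
  proof (rule sum.reindex_bij_witness[of _ "\<lambda>h. \<lambda>a\<in>A. \<lambda>b. h (a, b)"
        "\<lambda>g. \<lambda>z\<in>Sigma A B. g (fst z) (snd z)"])
    fix g assume g: "g \<in> PiE A (\<lambda>a. PiE (B a) (\<lambda>_. C))"
    have out: "g a b = undefined" if "a \<in> A" "b \<notin> B a" for a b
      using PiE_mem[OF g that(1)] that(2) by (auto simp: PiE_def extensional_def)
    have out2: "g a = undefined" if "a \<notin> A" for a
      using g that by (auto simp: PiE_def extensional_def)
    show "(\<lambda>a\<in>A. \<lambda>b. (\<lambda>z\<in>Sigma A B. g (fst z) (snd z)) (a, b)) = g"
      by (auto simp: fun_eq_iff out out2 restrict_def)
    show "(\<lambda>z\<in>Sigma A B. g (fst z) (snd z)) \<in> PiE (Sigma A B) (\<lambda>_. C)"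
      using g by (auto simp: PiE_def Pi_def)
    show "(\<Prod>a\<in>A. \<phi> a (\<lambda>b. (\<lambda>z\<in>Sigma A B. g (fst z) (snd z)) (a, b))) = (\<Prod>a\<in>A. \<phi> a (g a))"
      by (intro prod.cong refl arg_cong2[where f = \<phi>]) (auto simp: fun_eq_iff out)
  next
    fix h assume h: "h \<in> PiE (Sigma A B) (\<lambda>_. C)"
    then show "(\<lambda>z\<in>Sigma A B. (\<lambda>a\<in>A. \<lambda>b. h (a, b)) (fst z) (snd z)) = h"
      by (auto simp: fun_eq_iff PiE_def extensional_def restrict_def)
    show "(\<lambda>a\<in>A. \<lambda>b. h (a, b)) \<in> PiE A (\<lambda>a. PiE (B a) (\<lambda>_. C))"
      using h by (auto simp: PiE_def Pi_def extensional_def)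
  qed
  finally show ?thesis by simp
qed

section \<open>Summing over the edges of one row and of one layer\<close>

lemma of_bool_ball: "finite A \<Longrightarrow> of_bool (\<forall>x\<in>A. P x) = (\<Prod>x\<in>A. of_bool (P x) :: 'b::comm_semiring_1)"
  by (induction A rule: finite_induct) (auto simp: of_bool_conj)

text \<open>\<open>f s\<close> is the colour of the horizontal edge to the right of column
  \<open>s\<close>, and \<open>f 0\<close> that of the left end. Reverse induction suits the index
  set \<open>{0..length ys}\<close>, to which a new last column adds one index.\<close>

lemma sum_row_colourings:
  fixes b d :: "nat \<Rightarrow> nat"
  assumes "a \<in> {1..n}" "c \<in> {1..n}"
  shows "(\<Sum>f\<in>PiE {0..length ys} (\<lambda>_. {1..n}). of_bool (f 0 = a \<and> f (length ys) = c) *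
      (\<Prod>s\<in>{1..length ys}. weight x (ys ! (s - 1)) (f (s - 1)) (b s) (f s) (d s))) =
    row_pf n x ys a (map b [1..<Suc (length ys)]) c (map d [1..<Suc (length ys)])"
  using assms(2)
proof (induction ys arbitrary: c rule: rev_induct)
  case Nil
  have "(\<Sum>f\<in>PiE {0::nat} (\<lambda>_. {1..n}). of_bool (f 0 = a \<and> f 0 = c) :: 'a) = (\<Sum>e\<in>{1..n}. of_bool (e = a) * of_bool (e = c))"
    by (simp add: sum_PiE_insert[where A = "{}"] of_bool_conj del: sum_mult_of_bool_eq sum_of_bool_mult_eq)
  also have "\<dots> = of_bool (a = c)"
    by (rule sum_of_bool_eq) (use assms in auto)
  finally show ?case by simp
next
  case (snoc y ys)
  let ?N = "length ys" and ?C = "{1..n}"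
  let ?w = "\<lambda>f. (\<Prod>s\<in>{1..?N}. weight x (ys ! (s - 1)) (f (s - 1)) (b s) (f s) (d s))"
  let ?F = "PiE {0..?N} (\<lambda>_. ?C)"
  have term_eq: "of_bool ((f(Suc ?N := e)) 0 = a \<and> (f(Suc ?N := e)) (Suc ?N) = c) *
      (\<Prod>s\<in>{1..Suc ?N}. weight x ((ys @ [y]) ! (s - 1)) ((f(Suc ?N := e)) (s - 1)) (b s) ((f(Suc ?N := e)) s) (d s)) =
    of_bool (e = c) * (of_bool (f 0 = a) * ?w f * weight x y (f ?N) (b (Suc ?N)) c (d (Suc ?N)))" for e f
  proof -
    have "(\<Prod>s\<in>{1..?N}. weight x ((ys @ [y]) ! (s - 1)) ((f(Suc ?N := e)) (s - 1)) (b s) ((f(Suc ?N := e)) s) (d s)) = ?w f"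
      by (intro prod.cong refl) (auto simp: nth_append)
    moreover have "{1..Suc ?N} = insert (Suc ?N) {1..?N}" by auto
    ultimately show ?thesis by (auto simp del: One_nat_def)
  qed
  have ins: "{0..Suc ?N} = insert (Suc ?N) {0..?N}" "Suc ?N \<notin> {0..?N}" by auto
  have "(\<Sum>f\<in>PiE {0..length (ys @ [y])} (\<lambda>_. ?C). of_bool (f 0 = a \<and> f (length (ys @ [y])) = c) *
      (\<Prod>s\<in>{1..length (ys @ [y])}. weight x ((ys @ [y]) ! (s - 1)) (f (s - 1)) (b s) (f s) (d s))) =
    (\<Sum>e\<in>?C. \<Sum>f\<in>?F. of_bool (e = c) * (of_bool (f 0 = a) * ?w f *
       weight x y (f ?N) (b (Suc ?N)) c (d (Suc ?N))))"
    unfolding length_append_singleton ins(1) sum_PiE_insert[OF ins(2)] by (simp only: ins(1)[symmetric] term_eq)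
  also have "\<dots> = (\<Sum>f\<in>?F. of_bool (f 0 = a) * ?w f * weight x y (f ?N) (b (Suc ?N)) c (d (Suc ?N)))"
    unfolding sum_distrib_left[symmetric] using snoc.prems by (intro sum_of_bool_eq) auto
  also have "\<dots> = (\<Sum>f\<in>?F. \<Sum>e\<in>?C. of_bool (f ?N = e) * (of_bool (f 0 = a) * ?w f * weight x y e (b (Suc ?N)) c (d (Suc ?N))))"
    by (intro sum.cong refl sum_of_bool_eq(2)[symmetric]) auto
  also have "\<dots> = (\<Sum>e\<in>?C. \<Sum>f\<in>?F. of_bool (f ?N = e) * (of_bool (f 0 = a) * ?w f * weight x y e (b (Suc ?N)) c (d (Suc ?N))))"
    by (rule sum.swap)
  also have "\<dots> = (\<Sum>e\<in>?C. row_pf n x ys a (map b [1..<Suc ?N]) e (map d [1..<Suc ?N]) * weight x y e (b (Suc ?N)) c (d (Suc ?N)))"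
  proof (intro sum.cong refl)
    fix e assume e: "e \<in> ?C"
    show "(\<Sum>f\<in>?F. of_bool (f ?N = e) * (of_bool (f 0 = a) * ?w f * weight x y e (b (Suc ?N)) c (d (Suc ?N)))) =
      row_pf n x ys a (map b [1..<Suc ?N]) e (map d [1..<Suc ?N]) * weight x y e (b (Suc ?N)) c (d (Suc ?N))"
      unfolding snoc.IH[OF e, symmetric] sum_distrib_right
      by (intro sum.cong refl) (simp only: of_bool_conj mult_ac)
  qed
  also have "\<dots> = row_pf n x (ys @ [y]) a (map b [1..<Suc ?N] @ [b (Suc ?N)]) c (map d [1..<Suc ?N] @ [d (Suc ?N)])"
    by (rule row_pf_snoc[symmetric]) (use assms snoc.prems in \<open>auto simp del: upt_Suc\<close>)
  finally show ?case by simp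
qed

text \<open>\<open>u r\<close> is the word of the vertical edges below row \<open>r\<close>, and
  \<open>u 0\<close> that of the top edges; the horizontal edges have already been summed out in
  \<open>row_pf\<close>.\<close>

lemma sum_layer_colourings:
  assumes "set l \<subseteq> {1..n}" "length l = length xs" "bs \<in> words n (length ys)" "ts \<in> words n (length ys)"
  shows "(\<Sum>u\<in>PiE {0..length xs} (\<lambda>_. words n (length ys)). of_bool (u 0 = ts \<and> u (length xs) = bs) *
      (\<Prod>r\<in>{1..length xs}. row_pf n (xs ! (r - 1)) ys (l ! (r - 1)) (u r) q (u (r - 1)))) =
    grid_pf n xs ys l bs q ts"
  using assms(1-3)
proof (induction xs arbitrary: l bs rule: rev_induct)
  case Nil
  let ?W = "words n (length ys)"
  have "(\<Sum>f\<in>PiE {0::nat} (\<lambda>_. ?W). of_bool (f 0 = ts \<and> f 0 = bs) :: 'a) = (\<Sum>e\<in>?W. of_bool (e = ts) * of_bool (e = bs))"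
    by (simp add: sum_PiE_insert[where A = "{}"] of_bool_conj del: sum_mult_of_bool_eq sum_of_bool_mult_eq)
  also have "\<dots> = (\<Sum>e\<in>?W. if e = ts then of_bool (ts = bs) else 0)"
    by (intro sum.cong refl) simp
  also have "\<dots> = of_bool (bs = ts)"
    using assms(4) by (subst sum.delta) auto
  finally show ?case by simp
next
  case (snoc x xs)
  let ?k = "length xs" and ?W = "words n (length ys)"
  obtain l' a where l: "l = l' @ [a]" "length l' = length xs" "set l' \<subseteq> {1..n}"
    using snoc.prems by (cases l rule: rev_cases) auto
  let ?w = "\<lambda>u. (\<Prod>r\<in>{1..?k}. row_pf n (xs ! (r - 1)) ys (l' ! (r - 1)) (u r) q (u (r - 1)))"
  let ?F = "PiE {0..?k} (\<lambda>_. ?W)"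
  have term_eq: "of_bool ((u(Suc ?k := e)) 0 = ts \<and> (u(Suc ?k := e)) (Suc ?k) = bs) *
      (\<Prod>r\<in>{1..Suc ?k}. row_pf n ((xs @ [x]) ! (r - 1)) ys (l ! (r - 1)) ((u(Suc ?k := e)) r) q ((u(Suc ?k := e)) (r - 1))) =
    (if e = bs then of_bool (u 0 = ts) * ?w u * row_pf n x ys a bs q (u ?k) else 0)" for e u
  proof -
    have "(\<Prod>r\<in>{1..?k}. row_pf n ((xs @ [x]) ! (r - 1)) ys (l ! (r - 1)) ((u(Suc ?k := e)) r) q ((u(Suc ?k := e)) (r - 1))) = ?w u"
      by (intro prod.cong refl) (auto simp: nth_append l)
    moreover have "{1..Suc ?k} = insert (Suc ?k) {1..?k}" by auto
    moreover have "l ! ?k = a" using l by (simp add: nth_append)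
    ultimately show ?thesis by (auto simp del: One_nat_def)
  qed
  have ins: "{0..Suc ?k} = insert (Suc ?k) {0..?k}" "Suc ?k \<notin> {0..?k}" by auto
  have "(\<Sum>u\<in>PiE {0..length (xs @ [x])} (\<lambda>_. ?W). of_bool (u 0 = ts \<and> u (length (xs @ [x])) = bs) *
      (\<Prod>r\<in>{1..length (xs @ [x])}. row_pf n ((xs @ [x]) ! (r - 1)) ys (l ! (r - 1)) (u r) q (u (r - 1)))) =
    (\<Sum>e\<in>?W. \<Sum>u\<in>?F. if e = bs then of_bool (u 0 = ts) * ?w u * row_pf n x ys a bs q (u ?k) else 0)"
    unfolding length_append_singleton ins(1) sum_PiE_insert[OF ins(2)] by (simp only: ins(1)[symmetric] term_eq)
  also have "\<dots> = (\<Sum>u\<in>?F. of_bool (u 0 = ts) * ?w u * row_pf n x ys a bs q (u ?k))"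
    using snoc.prems(3) by (subst sum.swap) (simp del: sum_mult_of_bool_eq sum_of_bool_mult_eq)
  also have "\<dots> = (\<Sum>u\<in>?F. \<Sum>es\<in>?W. if u ?k = es then of_bool (u 0 = ts) * ?w u * row_pf n x ys a bs q es else 0)"
    by (intro sum.cong refl) auto
  also have "\<dots> = (\<Sum>es\<in>?W. \<Sum>u\<in>?F. if u ?k = es then of_bool (u 0 = ts) * ?w u * row_pf n x ys a bs q es else 0)"
    by (rule sum.swap)
  also have "\<dots> = (\<Sum>es\<in>?W. grid_pf n xs ys l' es q ts * row_pf n x ys a bs q es)"
    by (intro sum.cong refl) (auto simp: snoc.IH[OF l(3,2), symmetric] sum_distrib_right intro!: sum.cong simp del: sum_mult_of_bool_eq sum_of_bool_mult_eq)
  also have "\<dots> = grid_pf n (xs @ [x]) ys (l' @ [a]) bs q ts"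
    using l snoc.prems assms by (intro grid_pf_snoc[symmetric]) auto
  finally show ?case by (simp add: l)
qed

section \<open>Joining the layers\<close>

definition inner_colours :: "'a variables \<Rightarrow> nat \<Rightarrow> nat list \<Rightarrow> nat list" where
  "inner_colours V p t = take (k_size V (Suc p)) (drop (L_I V p) t)"

text \<open>Below the top layer the middle part of \<open>t\<close> is copied from \<open>t\<close>
  itself, which leaves the edges leading to the next layer unconstrained.\<close>

definition top_ok :: "'a variables \<Rightarrow> (nat \<Rightarrow> nat set) \<Rightarrow> nat \<Rightarrow> nat list \<Rightarrow> bool" where
  "top_ok V I p t \<longleftrightarrow>
     (if p < layers V then t = top_I V I p @ inner_colours V p t @ top_II V I p else t = top_colours V I)"

text \<open>The contribution of layer \<open>p\<close> for left colours \<open>l\<close> and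
  vertical words \<open>u\<close>, once the horizontal edges have been summed out.\<close>

definition layer_term ::
  "'a::comm_ring_1 variables \<Rightarrow> (nat \<Rightarrow> nat set) \<Rightarrow> nat \<Rightarrow> nat list \<Rightarrow> (nat \<Rightarrow> nat list) \<Rightarrow> 'a" where
  "layer_term V I p l u =
     of_bool (top_ok V I p (u 0) \<and> u (k_size V p) = replicate (N_size V p) (p + 1)) *
     (\<Prod>r\<in>{1..k_size V p}. row_pf (layers V + 1) (xvars V p ! (r - 1)) (columns V p)
        (l ! (r - 1)) (u r) (p + 1) (u (r - 1)))"

definition left_colours :: "'a variables \<Rightarrow> (nat \<Rightarrow> nat \<Rightarrow> nat list) \<Rightarrow> nat \<Rightarrow> nat list" where
  "left_colours V u p = (if p = 0 then replicate (k_size V 1) 1 else inner_colours V p (u p 0))"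

abbreviation rows_set :: "'a variables \<Rightarrow> nat \<Rightarrow> (nat \<Rightarrow> nat list) set" where
  "rows_set V p \<equiv> PiE {0..k_size V p} (\<lambda>_. words (layers V + 1) (N_size V p))"

text \<open>\<open>\<psi>\<close> stands for the layers above, which see layer \<open>p\<close> only
  through its top word \<open>u 0\<close>.\<close>

lemma sum_layer_term:
  assumes "l \<in> words (layers V + 1) (k_size V p)" "p \<le> layers V"
  shows "(\<Sum>u\<in>rows_set V p. layer_term V I p l u * \<psi> (u 0)) =
    (\<Sum>ts | ts \<in> words (layers V + 1) (N_size V p) \<and> top_ok V I p ts.
      grid_pf (layers V + 1) (xvars V p) (columns V p) l (replicate (N_size V p) (p + 1)) (p + 1) ts * \<psi> ts)"
proof -
  let ?n = "layers V + 1"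
  let ?W = "words ?n (N_size V p)" and ?bs = "replicate (N_size V p) (p + 1)"
  let ?w = "\<lambda>u. (\<Prod>r\<in>{1..k_size V p}. row_pf ?n (xvars V p ! (r - 1)) (columns V p)
        (l ! (r - 1)) (u r) (p + 1) (u (r - 1)))"
  have bs: "?bs \<in> ?W"
    using assms(2) by (auto simp: words_def)
  have "(\<Sum>u\<in>rows_set V p. layer_term V I p l u * \<psi> (u 0)) =
    (\<Sum>u\<in>rows_set V p. \<Sum>ts\<in>?W. if u 0 = ts then layer_term V I p l u * \<psi> ts else 0)"
    by (intro sum.cong refl) auto
  also have "\<dots> = (\<Sum>ts\<in>?W. \<Sum>u\<in>rows_set V p. if u 0 = ts then layer_term V I p l u * \<psi> ts else 0)"
    by (rule sum.swap)
  also have "\<dots> = (\<Sum>ts\<in>?W. if top_ok V I p ts then (\<Sum>u\<in>rows_set V p. of_bool (u 0 = ts \<and> u (k_size V p) = ?bs) * ?w u) * \<psi> ts else 0)"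
    by (intro sum.cong refl) (auto simp: layer_term_def sum_distrib_right intro!: sum.cong sum.neutral
        simp del: sum_mult_of_bool_eq sum_of_bool_mult_eq)
  also have "\<dots> = (\<Sum>ts\<in>?W. if top_ok V I p ts then
      grid_pf ?n (xvars V p) (columns V p) l ?bs (p + 1) ts * \<psi> ts else 0)"
    using assms(1) bs by (intro sum.cong refl if_cong arg_cong2[where f = "(*)"] sum_layer_colourings) (auto simp: words_def)
  finally show ?thesis by (simp only: sum.inter_filter finite_words)
qed

text \<open>The induction needs an arbitrary \<open>\<psi>\<close>: the sum over layer
  \<open>p + 1\<close>, taken as a function of its left colours, becomes the \<open>\<psi>\<close>
  for the layers below it.\<close>

lemma sum_layers_below:
  assumes "p < layers V"
  shows "(\<Sum>u\<in>PiE {1..p} (rows_set V). (\<Prod>q\<in>{1..p}. layer_term V I q (left_colours V u (q - 1)) (u q)) * \<psi> (left_colours V u p)) =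
    (\<Sum>g\<in>words (layers V + 1) (k_size V (Suc p)). low_pf (layers V + 1) V I p g * \<psi> g)"
  using assms
proof (induction p arbitrary: \<psi>)
  case 0
  have "(\<Sum>g\<in>words (layers V + 1) (k_size V 1). of_bool (set g \<subseteq> {1}) * \<psi> g) =
      (\<Sum>g\<in>words (layers V + 1) (k_size V 1). if g = replicate (k_size V 1) 1 then \<psi> (replicate (k_size V 1) 1) else 0)"
    by (rule sum.cong) (auto simp: words_def replicate_eqI subset_iff dest!: in_set_replicate[THEN iffD1])
  moreover have "replicate (k_size V 1) 1 \<in> words (layers V + 1) (k_size V 1)"
    by (auto simp: words_def)
  ultimately show ?case
    by (simp add: left_colours_def del: sum_mult_of_bool_eq sum_of_bool_mult_eq)
next
  case (Suc p)
  let ?n = "layers V + 1"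
  let ?U = "PiE {1..p} (rows_set V)"
  let ?P = "\<lambda>u. \<Prod>q\<in>{1..p}. layer_term V I q (left_colours V u (q - 1)) (u q)"
  let ?ys = "columns V (Suc p)"
  let ?G = "\<lambda>l ts. grid_pf ?n (xvars V (Suc p)) ?ys l (replicate (length ?ys) (p + 2)) (p + 2) ts"
  let ?top = "\<lambda>g. top_I V I (Suc p) @ g @ top_II V I (Suc p)"
  have tops: "top_I V I (Suc p) \<in> words ?n (L_I V (Suc p))" "top_II V I (Suc p) \<in> words ?n (L_II V (Suc p))"
    using Suc.prems by (auto intro!: top_I_words top_II_words)
  have ins: "{1..Suc p} = insert (Suc p) {1..p}" by auto
  have "(\<Sum>u\<in>PiE {1..Suc p} (rows_set V). (\<Prod>q\<in>{1..Suc p}. layer_term V I q (left_colours V u (q - 1)) (u q)) * \<psi> (left_colours V u (Suc p))) =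
    (\<Sum>c\<in>rows_set V (Suc p). \<Sum>u\<in>?U. ?P u * (layer_term V I (Suc p) (left_colours V u p) c * \<psi> (inner_colours V (Suc p) (c 0))))"
    unfolding ins
    by (subst sum_PiE_insert) (auto simp: left_colours_def mult_ac intro!: sum.cong prod.cong arg_cong2[where f = "(*)"])
  also have "\<dots> = (\<Sum>u\<in>?U. ?P u * (\<Sum>c\<in>rows_set V (Suc p). layer_term V I (Suc p) (left_colours V u p) c * \<psi> (inner_colours V (Suc p) (c 0))))"
    by (subst sum.swap) (simp add: sum_distrib_left)
  also have "\<dots> = (\<Sum>l\<in>words ?n (k_size V (Suc p)). low_pf ?n V I p l *
      (\<Sum>c\<in>rows_set V (Suc p). layer_term V I (Suc p) l c * \<psi> (inner_colours V (Suc p) (c 0))))"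
    using Suc.prems by (intro Suc.IH[of "\<lambda>l. \<Sum>c\<in>rows_set V (Suc p). layer_term V I (Suc p) l c * \<psi> (inner_colours V (Suc p) (c 0))"]) simp
  also have "\<dots> = (\<Sum>l\<in>words ?n (k_size V (Suc p)). low_pf ?n V I p l *
      (\<Sum>g\<in>words ?n (k_size V (Suc (Suc p))). ?G l (?top g) * \<psi> g))"
  proof (intro sum.cong refl arg_cong2[where f = "(*)"])
    fix l assume l: "l \<in> words ?n (k_size V (Suc p))"
    have inner: "inner_colours V (Suc p) (?top g) = g" if "g \<in> words ?n (k_size V (Suc (Suc p)))" for g
      using that tops by (simp add: inner_colours_def words_def)
    have "{ts. ts \<in> words ?n (length ?ys) \<and> top_ok V I (Suc p) ts} = ?top ` words ?n (k_size V (Suc (Suc p)))" (is "?L = ?R")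
    proof (intro equalityI subsetI)
      fix ts assume ts: "ts \<in> ?L"
      then have "ts = ?top (inner_colours V (Suc p) ts)"
        using Suc.prems by (simp add: top_ok_def)
      moreover have "inner_colours V (Suc p) ts \<in> words ?n (k_size V (Suc (Suc p)))"
        using ts Suc.prems set_take_subset set_drop_subset
        by (fastforce simp: words_def inner_colours_def columns_def)
      ultimately show "ts \<in> ?R" by blast
    next
      fix ts assume "ts \<in> ?R"
      then show "ts \<in> ?L"
        using tops Suc.prems by (auto simp: top_ok_def inner columns_def append_words length_words)
    qed
    moreover have "inj_on ?top (words ?n (k_size V (Suc (Suc p))))"
      by (auto simp: inj_on_def)
    ultimately show "(\<Sum>c\<in>rows_set V (Suc p). layer_term V I (Suc p) l c * \<psi> (inner_colours V (Suc p) (c 0))) =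
      (\<Sum>g\<in>words ?n (k_size V (Suc (Suc p))). ?G l (?top g) * \<psi> g)"
      using sum_layer_term[OF l, of I "\<lambda>t. \<psi> (inner_colours V (Suc p) t)"] Suc.prems
      by (simp add: sum.reindex inner)
  qed
  also have "\<dots> = (\<Sum>g\<in>words ?n (k_size V (Suc (Suc p))). low_pf ?n V I (Suc p) g * \<psi> g)"
  proof -
    have "columns V (Suc p) = yI V (Suc p) @ xvars V (Suc (Suc p)) @ yII V (Suc p)"
      using Suc.prems by (simp add: columns_def)
    then show ?thesis
      unfolding low_pf.simps Let_def sum_distrib_left sum_distrib_right
      by (subst sum.swap) (simp add: mult.assoc)
  qed
  finally show ?case .
qed

lemma sum_layers:
  assumes "1 \<le> layers V"
  shows "(\<Sum>u\<in>PiE {1..layers V} (rows_set V). \<Prod>q\<in>{1..layers V}. layer_term V I q (left_colours V u (q - 1)) (u q)) =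
    (\<Sum>g\<in>words (layers V + 1) (k_size V (layers V)). low_pf (layers V + 1) V I (layers V - 1) g *
       grid_pf (layers V + 1) (xvars V (layers V)) (ytop V) g
         (replicate (L_top V) (layers V + 1)) (layers V + 1) (top_colours V I))"
proof -
  define p where "p = layers V - 1"
  have M: "layers V = Suc p" using assms by (simp add: p_def)
  let ?n = "layers V + 1"
  let ?U = "PiE {1..p} (rows_set V)"
  let ?P = "\<lambda>u. \<Prod>q\<in>{1..p}. layer_term V I q (left_colours V u (q - 1)) (u q)"
  have ins: "{1..layers V} = insert (Suc p) {1..p}" using M by auto
  have "(\<Sum>u\<in>PiE {1..layers V} (rows_set V). \<Prod>q\<in>{1..layers V}. layer_term V I q (left_colours V u (q - 1)) (u q)) =
    (\<Sum>c\<in>rows_set V (Suc p). \<Sum>u\<in>?U. ?P u * layer_term V I (Suc p) (left_colours V u p) c)"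
    unfolding ins
    by (subst sum_PiE_insert) (auto simp: left_colours_def mult_ac intro!: sum.cong prod.cong arg_cong2[where f = "(*)"])
  also have "\<dots> = (\<Sum>u\<in>?U. ?P u * (\<Sum>c\<in>rows_set V (Suc p). layer_term V I (Suc p) (left_colours V u p) c))"
    by (subst sum.swap) (simp add: sum_distrib_left)
  also have "\<dots> = (\<Sum>l\<in>words ?n (k_size V (Suc p)). low_pf ?n V I p l *
      (\<Sum>c\<in>rows_set V (Suc p). layer_term V I (Suc p) l c))"
    using M by (intro sum_layers_below[of p V I "\<lambda>l. \<Sum>c\<in>rows_set V (Suc p). layer_term V I (Suc p) l c"]) simp
  also have "\<dots> = (\<Sum>l\<in>words ?n (k_size V (Suc p)). low_pf ?n V I p l *
      grid_pf ?n (xvars V (Suc p)) (ytop V) l (replicate (L_top V) (p + 2)) (p + 2) (top_colours V I))"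
  proof (intro sum.cong refl arg_cong2[where f = "(*)"])
    fix l assume l: "l \<in> words ?n (k_size V (Suc p))"
    have "{ts. ts \<in> words ?n (N_size V (Suc p)) \<and> top_ok V I (Suc p) ts} = {top_colours V I}"
      using top_colours_words[of V ?n I] M by (auto simp: top_ok_def columns_def)
    then show "(\<Sum>c\<in>rows_set V (Suc p). layer_term V I (Suc p) l c) =
      grid_pf ?n (xvars V (Suc p)) (ytop V) l (replicate (L_top V) (p + 2)) (p + 2) (top_colours V I)"
      using sum_layer_term[OF l, of I "\<lambda>_. 1"] M by (simp add: columns_def)
  qed
  finally show ?thesis by (simp add: M)
qed

section \<open>From colourings of all edges to words\<close>

definition left_edge :: "'a variables \<Rightarrow> (nat \<times> nat \<times> nat \<Rightarrow> nat) \<Rightarrow> nat \<Rightarrow> nat \<Rightarrow> nat" where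
  "left_edge V v p r = (if p = 1 then 1 else v (p - 1, 0, L_I V (p - 1) + r))"

definition v_row :: "'a variables \<Rightarrow> (nat \<times> nat \<times> nat \<Rightarrow> nat) \<Rightarrow> nat \<Rightarrow> nat \<Rightarrow> nat list" where
  "v_row V v p r = map (\<lambda>s. v (p, r, s)) [1..<Suc (N_size V p)]"

definition v_boundary :: "'a variables \<Rightarrow> (nat \<Rightarrow> nat set) \<Rightarrow> (nat \<times> nat \<times> nat \<Rightarrow> nat) \<Rightarrow> bool" where
  "v_boundary V I v \<longleftrightarrow>
     (\<forall>p\<in>{1..layers V}. top_ok V I p (v_row V v p 0) \<and>
        v_row V v p (k_size V p) = replicate (N_size V p) (p + 1))"

lemma v_row_nth: "s < N_size V p \<Longrightarrow> v_row V v p r ! s = v (p, r, Suc s)"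
  by (simp add: v_row_def nth_append del: upt_Suc)

lemma length_v_row [simp]: "length (v_row V v p r) = N_size V p"
  by (simp add: v_row_def del: upt_Suc)

lemma ball_1_iff: "(\<forall>s\<in>{1..m}. P s) \<longleftrightarrow> (\<forall>s<m. P (Suc s))"
  unfolding image_Suc_lessThan[symmetric] by auto

lemma v_row_eq_iff: "v_row V v p r = w \<longleftrightarrow> length w = N_size V p \<and> (\<forall>s\<in>{1..N_size V p}. v (p, r, s) = w ! (s - 1))"
  unfolding ball_1_iff by (auto simp: list_eq_iff_nth_eq v_row_nth)

lemma length_tops [simp]:
  "length (top_I V I p) = L_I V p" "length (top_II V I p) = L_II V p"
  "length (top_colours V I) = L_top V"
  by (simp_all add: top_I_def top_II_def top_colours_def del: upt_Suc)

lemma tops_nth: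
  "s < L_I V p \<Longrightarrow> top_I V I p ! s = colour_of I p (offset_I V p + Suc s)"
  "s < L_II V p \<Longrightarrow> top_II V I p ! s = colour_of I p (offset_II V p + Suc s)"
  "s < L_top V \<Longrightarrow> top_colours V I ! s = colour_of I (layers V) (offset_I V (layers V) + Suc s)"
  by (simp_all add: top_I_def top_II_def top_colours_def del: upt_Suc)

lemma top_ok_v_row:
  assumes "p \<in> {1..layers V}"
  shows "top_ok V I p (v_row V v p 0) \<longleftrightarrow>
    (if p < layers V then (\<forall>s\<in>{1..L_I V p}. v (p, 0, s) = colour_of I p (offset_I V p + s)) \<and>
       (\<forall>s\<in>{1..L_II V p}. v (p, 0, L_I V p + k_size V (p + 1) + s) = colour_of I p (offset_II V p + s))
     else (\<forall>s\<in>{1..L_top V}. v (layers V, 0, s) = colour_of I (layers V) (offset_I V (layers V) + s)))"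
proof (cases "p < layers V")
  case True
  let ?w = "v_row V v p 0"
  have N: "N_size V p = L_I V p + (k_size V (p + 1) + L_II V p)"
    using True by (simp add: columns_def)
  define a b c where "a = take (L_I V p) ?w" and "b = take (k_size V (p + 1)) (drop (L_I V p) ?w)"
    and "c = drop (k_size V (p + 1)) (drop (L_I V p) ?w)"
  have w: "?w = a @ b @ c"
    unfolding a_def b_def c_def by (simp only: append_take_drop_id)
  have len: "length a = L_I V p" "length b = k_size V (p + 1)" "length c = L_II V p"
    by (simp_all add: a_def b_def c_def N)
  have "inner_colours V p ?w = b"
    by (simp add: inner_colours_def b_def)
  then have "top_ok V I p ?w \<longleftrightarrow> a = top_I V I p \<and> c = top_II V I p"
    using True len by (simp add: top_ok_def) (simp add: w)
  moreover have "a = top_I V I p \<longleftrightarrow> (\<forall>s\<in>{1..L_I V p}. v (p, 0, s) = colour_of I p (offset_I V p + s))"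
  proof -
    have "a ! s = v (p, 0, Suc s)" if "s < L_I V p" for s
      unfolding a_def using that by (simp add: N v_row_nth)
    then show ?thesis
      unfolding ball_1_iff by (simp add: list_eq_iff_nth_eq len tops_nth)
  qed
  moreover have "c = top_II V I p \<longleftrightarrow>
      (\<forall>s\<in>{1..L_II V p}. v (p, 0, L_I V p + k_size V (p + 1) + s) = colour_of I p (offset_II V p + s))"
  proof -
    have c: "c = drop (L_I V p + k_size V (p + 1)) ?w"
      by (simp add: c_def add.commute)
    have "c ! s = v (p, 0, L_I V p + k_size V (p + 1) + Suc s)" if "s < L_II V p" for s
      unfolding c using that by (subst nth_drop) (simp_all add: N v_row_nth)
    then show ?thesis
      unfolding ball_1_iff by (simp add: list_eq_iff_nth_eq len tops_nth)
  qed
  ultimately show ?thesis using True by simp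
next
  case False
  then have "p = layers V" using assms by simp
  then show ?thesis
    unfolding ball_1_iff
    by (auto simp: top_ok_def list_eq_iff_nth_eq tops_nth v_row_nth columns_def)
qed

text \<open>For fixed vertical colours the remaining conditions concern the two ends of each
  horizontal line separately, including the left ends glued to the layer below. This is why the sum
  over horizontal colours factors over the rows.\<close>

lemma boundary_iff:
  assumes "1 \<le> layers V"
  shows "boundary V I h v \<longleftrightarrow> v_boundary V I v \<and>
    (\<forall>p\<in>{1..layers V}. \<forall>r\<in>{1..k_size V p}. h (p, r, 0) = left_edge V v p r \<and> h (p, r, N_size V p) = p + 1)"
proof -
  have left: "(\<forall>p\<in>{1..layers V}. \<forall>r\<in>{1..k_size V p}. h (p, r, 0) = left_edge V v p r) \<longleftrightarrow>
     (\<forall>r\<in>{1..k_size V 1}. h (1, r, 0) = 1) \<and>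
     (\<forall>p\<in>{1..<layers V}. \<forall>r\<in>{1..k_size V (p + 1)}. h (p + 1, r, 0) = v (p, 0, L_I V p + r))" (is "?A \<longleftrightarrow> ?B")
  proof
    assume A: ?A
    show ?B
      using A[rule_format, of 1] A[rule_format, of "_ + 1"] assms by (auto simp: left_edge_def)
  next
    assume B: ?B
    show ?A
    proof (intro ballI)
      fix p r assume "p \<in> {1..layers V}" "r \<in> {1..k_size V p}"
      then show "h (p, r, 0) = left_edge V v p r"
        using B by (cases p; cases "p = 1") (auto simp: left_edge_def)
    qed
  qed
  have bottom: "v_row V v p (k_size V p) = replicate (N_size V p) (p + 1) \<longleftrightarrow>
      (\<forall>s\<in>{1..N_size V p}. v (p, k_size V p, s) = p + 1)" for p
    by (auto simp: v_row_eq_iff)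
  have top: "(\<forall>p\<in>{1..layers V}. top_ok V I p (v_row V v p 0)) \<longleftrightarrow>
     (\<forall>p\<in>{1..<layers V}. \<forall>s\<in>{1..L_I V p}. v (p, 0, s) = colour_of I p (offset_I V p + s)) \<and>
     (\<forall>p\<in>{1..<layers V}. \<forall>s\<in>{1..L_II V p}.
        v (p, 0, L_I V p + k_size V (p + 1) + s) = colour_of I p (offset_II V p + s)) \<and>
     (\<forall>s\<in>{1..L_top V}. v (layers V, 0, s) = colour_of I (layers V) (offset_I V (layers V) + s))"
    (is "?A \<longleftrightarrow> ?B1 \<and> ?B2 \<and> ?B3")
  proof -
    have "{1..layers V} = insert (layers V) {1..<layers V}" using assms by auto
    then have "?A \<longleftrightarrow> top_ok V I (layers V) (v_row V v (layers V) 0) \<and>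
        (\<forall>p\<in>{1..<layers V}. top_ok V I p (v_row V v p 0))" by simp
    also have "top_ok V I (layers V) (v_row V v (layers V) 0) \<longleftrightarrow> ?B3"
      using top_ok_v_row[of "layers V" V I v] assms by simp
    also have "(\<forall>p\<in>{1..<layers V}. top_ok V I p (v_row V v p 0)) \<longleftrightarrow> ?B1 \<and> ?B2"
      using top_ok_v_row[of _ V I v] by (auto simp del: One_nat_def)
    finally show ?thesis by blast
  qed
  show ?thesis
    unfolding boundary_def v_boundary_def ball_conj_distrib bottom top left by blast
qed

lemma finite_edges [simp]: "finite (h_edges V)" "finite (v_edges V)"
proof -
  have "h_edges V = Sigma {1..layers V} (\<lambda>p. {1..k_size V p} \<times> {0..N_size V p})"
    "v_edges V = Sigma {1..layers V} (\<lambda>p. {0..k_size V p} \<times> {1..N_size V p})"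
    by (auto simp: h_edges_def v_edges_def)
  then show "finite (h_edges V)" "finite (v_edges V)" by auto
qed

lemma left_edge_bounds:
  assumes "v \<in> v_edges V \<rightarrow>\<^sub>E {1..layers V + 1}" "p \<in> {1..layers V}" "r \<in> {1..k_size V p}"
  shows "left_edge V v p r \<in> {1..layers V + 1}"
proof (cases "p = 1")
  case False
  then have "(p - 1, 0, L_I V (p - 1) + r) \<in> v_edges V"
    using assms(2,3) by (auto simp: v_edges_def columns_def)
  then show ?thesis using PiE_mem[OF assms(1)] False by (simp add: left_edge_def del: One_nat_def)
qed (simp add: left_edge_def)

lemma sum_h_edges:
  assumes "v \<in> v_edges V \<rightarrow>\<^sub>E {1..layers V + 1}"
  shows "(\<Sum>h\<in>h_edges V \<rightarrow>\<^sub>E {1..layers V + 1}.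
      of_bool (\<forall>p\<in>{1..layers V}. \<forall>r\<in>{1..k_size V p}. h (p, r, 0) = left_edge V v p r \<and> h (p, r, N_size V p) = p + 1) *
      (\<Prod>p\<in>{1..layers V}. \<Prod>r\<in>{1..k_size V p}. \<Prod>s\<in>{1..N_size V p}.
          weight (xvars V p ! (r - 1)) (columns V p ! (s - 1))
            (h (p, r, s - 1)) (v (p, r, s)) (h (p, r, s)) (v (p, r - 1, s)))) =
    (\<Prod>p\<in>{1..layers V}. \<Prod>r\<in>{1..k_size V p}. row_pf (layers V + 1) (xvars V p ! (r - 1)) (columns V p)
       (left_edge V v p r) (v_row V v p r) (p + 1) (v_row V v p (r - 1)))"
proof -
  let ?C = "{1..layers V + 1}" and ?P = "{1..layers V}" and ?R = "\<lambda>p. {1..k_size V p}"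
  define \<phi> where "\<phi> p r f = of_bool (f 0 = left_edge V v p r \<and> f (N_size V p) = p + 1) * (\<Prod>s\<in>{1..N_size V p}.
      weight (xvars V p ! (r - 1)) (columns V p ! (s - 1)) (f (s - 1)) (v (p, r, s)) (f s) (v (p, r - 1, s)))" for p r f
  have "of_bool (\<forall>p\<in>?P. \<forall>r\<in>?R p. h (p, r, 0) = left_edge V v p r \<and> h (p, r, N_size V p) = p + 1) *
      (\<Prod>p\<in>?P. \<Prod>r\<in>?R p. \<Prod>s\<in>{1..N_size V p}.
          weight (xvars V p ! (r - 1)) (columns V p ! (s - 1))
            (h (p, r, s - 1)) (v (p, r, s)) (h (p, r, s)) (v (p, r - 1, s))) =
      (\<Prod>p\<in>?P. \<Prod>r\<in>?R p. \<phi> p r (\<lambda>s. h (p, r, s)))" for h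
    by (simp only: of_bool_ball finite_atLeastAtMost prod.distrib[symmetric] \<phi>_def)
  moreover have "h_edges V = Sigma ?P (\<lambda>p. Sigma (?R p) (\<lambda>_. {0..N_size V p}))"
    by (auto simp: h_edges_def)
  ultimately have "(\<Sum>h\<in>h_edges V \<rightarrow>\<^sub>E ?C.
      of_bool (\<forall>p\<in>?P. \<forall>r\<in>?R p. h (p, r, 0) = left_edge V v p r \<and> h (p, r, N_size V p) = p + 1) *
      (\<Prod>p\<in>?P. \<Prod>r\<in>?R p. \<Prod>s\<in>{1..N_size V p}.
          weight (xvars V p ! (r - 1)) (columns V p ! (s - 1))
            (h (p, r, s - 1)) (v (p, r, s)) (h (p, r, s)) (v (p, r - 1, s)))) =
     (\<Sum>h\<in>PiE (Sigma ?P (\<lambda>p. Sigma (?R p) (\<lambda>_. {0..N_size V p}))) (\<lambda>_. ?C).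
        \<Prod>p\<in>?P. \<Prod>r\<in>?R p. \<phi> p r (\<lambda>s. h (p, r, s)))"
    by simp
  also have "\<dots> = (\<Prod>p\<in>?P. \<Sum>g\<in>PiE (Sigma (?R p) (\<lambda>_. {0..N_size V p})) (\<lambda>_. ?C). \<Prod>r\<in>?R p. \<phi> p r (\<lambda>s. g (r, s)))"
    by (rule sum_PiE_Sigma_prod[where \<phi> = "\<lambda>p g. \<Prod>r\<in>?R p. \<phi> p r (\<lambda>s. g (r, s))"]) auto
  also have "\<dots> = (\<Prod>p\<in>?P. \<Prod>r\<in>?R p. \<Sum>f\<in>PiE {0..N_size V p} (\<lambda>_. ?C). \<phi> p r f)"
    by (intro prod.cong refl sum_PiE_Sigma_prod) auto
  also have "\<dots> = (\<Prod>p\<in>?P. \<Prod>r\<in>?R p. row_pf (layers V + 1) (xvars V p ! (r - 1)) (columns V p)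
       (left_edge V v p r) (v_row V v p r) (p + 1) (v_row V v p (r - 1)))"
    unfolding \<phi>_def v_row_def
    by (intro prod.cong refl sum_row_colourings left_edge_bounds[OF assms]) auto
  finally show ?thesis .
qed

lemma psi_eq_sum_v_edges:
  assumes "1 \<le> layers V"
  shows "psi V I = (\<Sum>v\<in>v_edges V \<rightarrow>\<^sub>E {1..layers V + 1}. of_bool (v_boundary V I v) *
    (\<Prod>p\<in>{1..layers V}. \<Prod>r\<in>{1..k_size V p}. row_pf (layers V + 1) (xvars V p ! (r - 1)) (columns V p)
       (left_edge V v p r) (v_row V v p r) (p + 1) (v_row V v p (r - 1))))"
proof -
  let ?H = "h_edges V \<rightarrow>\<^sub>E {1..layers V + 1}" and ?E = "v_edges V \<rightarrow>\<^sub>E {1..layers V + 1}"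
  let ?B = "\<lambda>h v. \<forall>p\<in>{1..layers V}. \<forall>r\<in>{1..k_size V p}. h (p, r, 0) = left_edge V v p r \<and> h (p, r, N_size V p) = p + 1"
  let ?w = "\<lambda>h v. (\<Prod>p\<in>{1..layers V}. \<Prod>r\<in>{1..k_size V p}. \<Prod>s\<in>{1..N_size V p}.
          weight (xvars V p ! (r - 1)) (columns V p ! (s - 1))
            (h (p, r, s - 1)) (v (p, r, s)) (h (p, r, s)) (v (p, r - 1, s)))"
  have "configurations V I = {x \<in> ?H \<times> ?E. v_boundary V I (snd x) \<and> ?B (fst x) (snd x)}"
    using boundary_iff[OF assms, of I] by (auto simp: configurations_def)
  moreover have "finite (?H \<times> ?E)"
    by (intro finite_cartesian_product finite_PiE) auto
  ultimately have "psi V I = (\<Sum>x\<in>?H \<times> ?E. if v_boundary V I (snd x) \<and> ?B (fst x) (snd x) then ?w (fst x) (snd x) else 0)"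
    unfolding psi_def case_prod_unfold by (simp only: sum.inter_filter)
  also have "\<dots> = (\<Sum>h\<in>?H. \<Sum>v\<in>?E. of_bool (v_boundary V I v) * (of_bool (?B h v) * ?w h v))"
    unfolding sum.cartesian_product by (intro sum.cong refl) auto
  also have "\<dots> = (\<Sum>v\<in>?E. of_bool (v_boundary V I v) * (\<Sum>h\<in>?H. of_bool (?B h v) * ?w h v))"
    unfolding sum_distrib_left by (rule sum.swap)
  finally show ?thesis
    by (simp only: sum_h_edges cong: sum.cong)
qed

lemma layer_term_v_row:
  assumes "v_boundary V I v" "1 \<le> layers V"
  defines "u \<equiv> (\<lambda>p\<in>{1..layers V}. \<lambda>r\<in>{0..k_size V p}. v_row V v p r)"
  assumes "p \<in> {1..layers V}"
  shows "layer_term V I p (left_colours V u (p - 1)) (u p) =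
    (\<Prod>r\<in>{1..k_size V p}. row_pf (layers V + 1) (xvars V p ! (r - 1)) (columns V p)
       (left_edge V v p r) (v_row V v p r) (p + 1) (v_row V v p (r - 1)))"
proof -
  have "left_colours V u (p - 1) ! (r - 1) = left_edge V v p r" if "r \<in> {1..k_size V p}" for r
  proof (cases "p = 1")
    case True
    then show ?thesis using that by (auto simp: left_colours_def left_edge_def)
  next
    case False
    then obtain m where m: "p = Suc (Suc m)"
      using assms(4) by (cases p; cases "p - 1") auto
    have "u (Suc m) 0 = v_row V v (Suc m) 0"
      using assms(4) by (simp add: u_def m)
    moreover have "v_row V v (Suc m) 0 ! (L_I V (Suc m) + (r - 1)) = v (Suc m, 0, L_I V (Suc m) + r)"
      using that assms(4) by (subst v_row_nth) (auto simp: columns_def m)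
    ultimately show ?thesis
      using that assms(4) by (auto simp: left_colours_def left_edge_def inner_colours_def m columns_def)
  qed
  then show ?thesis
    using assms(1,4) by (auto simp: layer_term_def v_boundary_def u_def simp del: One_nat_def intro!: prod.cong)
qed

lemma psi_eq_sum_layers:
  assumes "1 \<le> layers V"
  shows "psi V I = (\<Sum>u\<in>PiE {1..layers V} (rows_set V). \<Prod>q\<in>{1..layers V}. layer_term V I q (left_colours V u (q - 1)) (u q))"
proof -
  let ?U = "\<lambda>v. \<lambda>p\<in>{1..layers V}. \<lambda>r\<in>{0..k_size V p}. v_row V v p r"
  let ?V = "\<lambda>u. \<lambda>z\<in>v_edges V. u (fst z) (fst (snd z)) ! (snd (snd z) - 1)"
  show ?thesis
    unfolding psi_eq_sum_v_edges[OF assms]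
  proof (rule sum.reindex_bij_witness[of _ ?V ?U])
    fix v assume v: "v \<in> v_edges V \<rightarrow>\<^sub>E {1..layers V + 1}"
    show "?V (?U v) = v"
    proof
      fix z :: "nat \<times> nat \<times> nat" obtain p r s where z: "z = (p, r, s)" by (metis prod_cases3)
      show "?V (?U v) z = v z"
      proof (cases "z \<in> v_edges V")
        case True
        then have "p \<in> {1..layers V}" "r \<in> {0..k_size V p}" "s \<in> {1..N_size V p}"
          by (auto simp: v_edges_def z)
        then show ?thesis using True by (auto simp: z v_row_nth)
      next
        case False
        then show ?thesis using PiE_arb[OF v] by simp
      qed
    qed
    show "?U v \<in> PiE {1..layers V} (rows_set V)"
    proof (intro restrict_PiE_iff[THEN iffD2] ballI)
      fix p r assume pr: "p \<in> {1..layers V}" "r \<in> {0..k_size V p}"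
      have "v (p, r, s) \<in> {1..layers V + 1}" if "s \<in> {1..N_size V p}" for s
        using PiE_mem[OF v, of "(p, r, s)"] pr that by (auto simp: v_edges_def)
      then show "v_row V v p r \<in> words (layers V + 1) (N_size V p)"
        by (auto simp: words_def v_row_def simp del: upt_Suc)
    qed
    show "(\<Prod>q\<in>{1..layers V}. layer_term V I q (left_colours V (?U v) (q - 1)) (?U v q)) =
      of_bool (v_boundary V I v) * (\<Prod>p\<in>{1..layers V}. \<Prod>r\<in>{1..k_size V p}.
        row_pf (layers V + 1) (xvars V p ! (r - 1)) (columns V p)
         (left_edge V v p r) (v_row V v p r) (p + 1) (v_row V v p (r - 1)))"
    proof (cases "v_boundary V I v")
      case True
      then show ?thesis
        by (simp only: layer_term_v_row[OF True assms] of_bool_eq mult_1 cong: prod.cong)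
    next
      case False
      \<comment> \<open>A violated condition makes the factor of its layer zero, in agreement with
        the indicator of \<open>v_boundary\<close> on the other side.\<close>
      then obtain p where p: "p \<in> {1..layers V}" "\<not> (top_ok V I p (v_row V v p 0) \<and>
        v_row V v p (k_size V p) = replicate (N_size V p) (p + 1))"
        by (auto simp: v_boundary_def)
      then have "layer_term V I p (left_colours V (?U v) (p - 1)) (?U v p) = 0"
        by (auto simp: layer_term_def)
      then have "(\<Prod>q\<in>{1..layers V}. layer_term V I q (left_colours V (?U v) (q - 1)) (?U v q)) = 0"
        using p(1) by (intro prod_zero) blast+
      then show ?thesis using False by simp
    qed
  next
    fix u assume u: "u \<in> PiE {1..layers V} (rows_set V)"
    have len: "length (u p r) = N_size V p" "set (u p r) \<subseteq> {1..layers V + 1}"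
      if "p \<in> {1..layers V}" "r \<in> {0..k_size V p}" for p r
      using PiE_mem[OF PiE_mem[OF u that(1)] that(2)] by (auto simp: words_def)
    have row: "v_row V (?V u) p r = u p r" if "p \<in> {1..layers V}" "r \<in> {0..k_size V p}" for p r
      using that len[OF that] by (auto simp: v_row_eq_iff v_edges_def)
    show "?U (?V u) = u"
    proof (intro ext)
      fix p r
      show "?U (?V u) p r = u p r"
      proof (cases "p \<in> {1..layers V}")
        case True
        then show ?thesis using row[OF True, of r] PiE_arb[OF PiE_mem[OF u True], of r]
          by (cases "r \<in> {0..k_size V p}") (auto simp del: One_nat_def)
      next
        case False
        then show ?thesis using PiE_arb[OF u False] by (auto simp del: One_nat_def)
      qed
    qed
    show "?V u \<in> v_edges V \<rightarrow>\<^sub>E {1..layers V + 1}"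
    proof (intro restrict_PiE_iff[THEN iffD2] ballI)
      fix z assume "z \<in> v_edges V"
      then obtain p r s where z: "z = (p, r, s)" "p \<in> {1..layers V}" "r \<in> {0..k_size V p}" "s \<in> {1..N_size V p}"
        by (auto simp: v_edges_def)
      then have "s - 1 < length (u p r)" using len(1)[OF z(2,3)] by auto
      from nth_mem[OF this] show "u (fst z) (fst (snd z)) ! (snd (snd z) - 1) \<in> {1..layers V + 1}"
        using len(2)[OF z(2,3)] by (auto simp: z(1))
    qed
  qed
qed

lemma psi_eq:
  assumes "1 \<le> layers V"
  shows "psi V I =
    (\<Sum>g\<in>words (layers V + 1) (k_size V (layers V)). low_pf (layers V + 1) V I (layers V - 1) g *
       grid_pf (layers V + 1) (xvars V (layers V)) (ytop V) g
         (replicate (L_top V) (layers V + 1)) (layers V + 1) (top_colours V I))"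
  using psi_eq_sum_layers[OF assms] sum_layers[OF assms] by simp

section \<open>Colourings under the removal of a coordinate or of a layer\<close>

lemma low_coords_admissible:
  assumes "admissible V i I" "j \<in> {1..layers V}"
  shows "low_coords V I j = {c \<in> I_hat V j. i c \<in> {1..j + 1}}"
proof -
  have "colour_of I p c = i c" if "p \<in> {j..layers V}" "c \<in> layer_coords V p" for p c
    using that assms(2) by (intro colour_of_admissible[OF assms(1)]) auto
  then show ?thesis
    unfolding low_coords_def I_hat_def by fastforce
qed

lemma admissible_colour_set:
  "admissible V i I \<Longrightarrow> j \<in> {1..layers V} \<Longrightarrow> I j = {c \<in> I_hat V j. i c \<in> {1..j}}"
  by (simp add: admissible_def colour_set_def)

lemma admissible_card: "admissible V i I \<Longrightarrow> j \<in> {1..layers V} \<Longrightarrow> card (I j) = k_size V j"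
  unfolding admissible_def by blast

text \<open>Deleting coordinates is encoded by an embedding \<open>g\<close> of the new coordinates
  into the old ones. The sets keep their sizes because only coordinates outside every
  \<open>I j\<close> are skipped.\<close>

lemma admissible_vimage:
  assumes adm: "admissible V i I" and g: "inj g" and M: "layers V' \<le> layers V"
    and hat: "\<And>j. j \<in> {1..layers V'} \<Longrightarrow> I_hat V' j = g -` I_hat V j"
    and col: "is_colouring V' (i \<circ> g)"
    and J: "\<And>j. j \<in> {1..layers V'} \<Longrightarrow> J j = g -` I j"
    and range: "\<And>j. j \<in> {1..layers V'} \<Longrightarrow> I j \<subseteq> range g"
    and k: "\<And>j. j \<in> {1..layers V'} \<Longrightarrow> k_size V' j = k_size V j"
  shows "admissible V' (i \<circ> g) J"
  unfolding admissible_def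
proof (intro conjI ballI col)
  fix j assume j: "j \<in> {1..layers V'}"
  then have jV: "j \<in> {1..layers V}" using M by auto
  show "J j = colour_set V' (i \<circ> g) j"
    using admissible_colour_set[OF adm jV] hat[OF j] J[OF j] by (auto simp: colour_set_def)
  have "card (J j) = card (I j)"
    unfolding J[OF j] by (rule card_vimage_inj[OF g range[OF j]])
  then show "card (J j) = k_size V' j"
    using admissible_card[OF adm jV] k[OF j] by simp
qed

text \<open>The label of a coordinate is the number of low coordinates up to it. An increasing
  \<open>g\<close> that misses none of these preserves the count.\<close>

lemma relabelled_vimage:
  assumes adm: "admissible V i I" "admissible V' (i \<circ> g) J" and g: "strict_mono g"
    and j: "j \<in> {1..layers V}" "j \<in> {1..layers V'}"
    and hat: "I_hat V' j = g -` I_hat V j" and J: "J j = g -` I j"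
    and range: "low_coords V I j \<subseteq> range g"
  shows "relabelled V' J j = relabelled V I j"
proof -
  have low: "low_coords V' J j = g -` low_coords V I j"
    using low_coords_admissible[OF adm(1) j(1)] low_coords_admissible[OF adm(2) j(2)] hat by auto
  have "I j \<subseteq> low_coords V I j"
    using low_coords_admissible[OF adm(1) j(1)] admissible_colour_set[OF adm(1) j(1)] by auto
  then have Ij: "I j = g ` J j"
    using range J by auto
  have "{a \<in> low_coords V I j. a \<le> g c} = g ` {a \<in> low_coords V' J j. a \<le> c}" for c
    using range by (auto simp: low strict_mono_less_eq[OF g])
  then have "card {a \<in> low_coords V I j. a \<le> g c} = card {a \<in> low_coords V' J j. a \<le> c}" for c
    using card_image[OF inj_on_subset[OF strict_mono_imp_inj_on[OF g] subset_UNIV]] by simp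
  then show ?thesis
    unfolding relabelled_def Ij by (simp add: image_image)
qed

lemma offset_I_mono: "p < q \<Longrightarrow> 1 \<le> p \<Longrightarrow> offset_I V p + L_I V p \<le> offset_I V q"
proof -
  assume "p < q" "1 \<le> p"
  then have "offset_I V p + L_I V p = (\<Sum>r\<in>insert p {1..<p}. L_I V r)"
    by (simp add: offset_I_def)
  also have "\<dots> \<le> offset_I V q"
    unfolding offset_I_def using \<open>p < q\<close> \<open>1 \<le> p\<close> by (intro sum_mono2) auto
  finally show ?thesis .
qed

lemma L_sum_in_layer: "1 \<le> L_top V \<Longrightarrow> L_sum V \<in> layer_coords V (layers V)"
  by (auto simp: layer_coords_def L_sum_def)

lemma L_sum_le_offset_II: "L_sum V \<le> offset_II V p"
  by (simp add: L_sum_def offset_II_def)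

lemma I_hat_top: "I_hat V (layers V) = layer_coords V (layers V)"
  by (simp add: I_hat_def)

lemma admissible_L_sum_mem:
  assumes "admissible V i I" "1 \<le> layers V" "1 \<le> L_top V" "i (L_sum V) \<noteq> layers V + 1"
  shows "L_sum V \<in> I (layers V)" "i (L_sum V) \<in> {1..layers V}"
proof -
  have "i (L_sum V) \<in> {1..layers V + 1}"
    using assms L_sum_in_layer[of V] unfolding admissible_def is_colouring_def by fastforce
  with assms(4) show "i (L_sum V) \<in> {1..layers V}" by auto
  then show "L_sum V \<in> I (layers V)"
    using admissible_colour_set[OF assms(1), of "layers V"] L_sum_in_layer[OF assms(3)] assms(2)
    by (auto simp: I_hat_top)
qed

section \<open>Moving the last row variable to the layer below (case A)\<close>

definition move_last_row :: "'a variables \<Rightarrow> 'a variables" where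
  "move_last_row V = V\<lparr>xvars := (xvars V)(layers V := butlast (xvars V (layers V))),
     yII := (yII V)(layers V - 1 := last (xvars V (layers V)) # yII V (layers V - 1)),
     ytop := butlast (ytop V)\<rparr>"

lemma move_last_row_simps [simp]:
  "layers (move_last_row V) = layers V"
  "xvars (move_last_row V) = (xvars V)(layers V := butlast (xvars V (layers V)))"
  "yI (move_last_row V) = yI V"
  "yII (move_last_row V) = (yII V)(layers V - 1 := last (xvars V (layers V)) # yII V (layers V - 1))"
  "ytop (move_last_row V) = butlast (ytop V)"
  "offset_I (move_last_row V) = offset_I V"
  by (simp_all add: move_last_row_def offset_I_def fun_eq_iff)

text \<open>\<open>ytop\<close> loses its last variable and \<open>yII (M - 1)\<close> gains one at
  the front, in the same coordinate \<open>L_sum\<close>. Offsets counted across both are unchanged;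
  only the border between the two lists shifts.\<close>

lemma offset_II_move_last_row:
  assumes "2 \<le> layers V" "1 \<le> L_top V" "p < layers V"
  shows "offset_II (move_last_row V) p = (if p = layers V - 1 then L_sum V - 1 else offset_II V p)"
proof (cases "p = layers V - 1")
  case True
  then have "{p<..<layers V} = {}" using assms by auto
  then show ?thesis using True assms by (simp add: offset_II_def L_sum_def)
next
  case False
  then have "{p<..<layers V} = insert (layers V - 1) {p<..<layers V - 1}" using assms by auto
  then show ?thesis using False assms by (simp add: offset_II_def)
qed

lemma offset_II_last: "1 \<le> layers V \<Longrightarrow> offset_II V (layers V - 1) = L_sum V"
proof -
  have "{layers V - 1<..<layers V} = {}" by auto
  then show ?thesis by (simp add: offset_II_def L_sum_def)
qed

lemma layer_coords_move_last_row:
  assumes "2 \<le> layers V" "1 \<le> L_top V"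
  shows "layer_coords (move_last_row V) (layers V) = layer_coords V (layers V) - {L_sum V}"
    "layer_coords (move_last_row V) (layers V - 1) = insert (L_sum V) (layer_coords V (layers V - 1))"
    "p < layers V - 1 \<Longrightarrow> layer_coords (move_last_row V) p = layer_coords V p"
proof -
  obtain t where t: "L_top V = Suc t" using assms(2) by (cases "L_top V") auto
  then show "layer_coords (move_last_row V) (layers V) = layer_coords V (layers V) - {L_sum V}"
    by (auto simp: layer_coords_def L_sum_def)
  have "1 \<le> L_sum V" using assms by (simp add: L_sum_def)
  then show "layer_coords (move_last_row V) (layers V - 1) = insert (L_sum V) (layer_coords V (layers V - 1))"
    using assms offset_II_last[of V] by (auto simp: layer_coords_def offset_II_move_last_row)
  show "layer_coords (move_last_row V) p = layer_coords V p" if "p < layers V - 1"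
    using assms that by (simp add: layer_coords_def offset_II_move_last_row)
qed

lemma I_hat_move_last_row:
  assumes "2 \<le> layers V" "1 \<le> L_top V" "j \<in> {1..layers V - 1}"
  shows "I_hat (move_last_row V) j = I_hat V j"
proof -
  have split: "{j..layers V} = insert (layers V) (insert (layers V - 1) {j..<layers V - 1})"
    using assms by auto
  have "(\<Union>p\<in>{j..<layers V - 1}. layer_coords (move_last_row V) p) = (\<Union>p\<in>{j..<layers V - 1}. layer_coords V p)"
    using layer_coords_move_last_row(3)[OF assms(1,2)] by simp
  then show ?thesis
    using layer_coords_move_last_row(1,2)[OF assms(1,2)] L_sum_in_layer[OF assms(2)]
    unfolding I_hat_def move_last_row_simps split by auto
qed

text \<open>In case A the colour of \<open>L_sum\<close> is at most \<open>M\<close>, hence legal in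
  layer \<open>M - 1\<close>. The set of level \<open>M\<close> loses \<open>L_sum\<close>, as
  \<open>k_M - 1\<close> requires, while at lower levels the coordinate is counted as
  before.\<close>

lemma admissible_move_last_row:
  assumes adm: "admissible V i I" and M: "2 \<le> layers V" and L: "1 \<le> L_top V"
    and A: "i (L_sum V) \<noteq> layers V + 1"
  defines "J \<equiv> (\<lambda>j. if j = layers V then I (layers V) - {L_sum V} else I j)"
  shows "admissible (move_last_row V) i J"
    and "j \<in> {1..layers V - 1} \<Longrightarrow> relabelled (move_last_row V) J j = relabelled V I j"
proof -
  let ?V = "move_last_row V"
  have mem: "L_sum V \<in> I (layers V)" "i (L_sum V) \<in> {1..layers V}"
    using admissible_L_sum_mem[OF adm _ L A] M by auto
  have col: "is_colouring ?V i"
    unfolding is_colouring_def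
  proof (intro ballI)
    fix p c assume p: "p \<in> {1..layers ?V}" "c \<in> layer_coords ?V p"
    consider "p = layers V" | "p = layers V - 1" | "p < layers V - 1" using p by fastforce
    then have "c \<in> layer_coords V p \<or> c = L_sum V \<and> p = layers V - 1"
      using p(2) layer_coords_move_last_row[OF M L] by cases auto
    then show "i c \<in> {1..p + 1}"
      using adm p(1) mem(2) unfolding admissible_def is_colouring_def by fastforce
  qed
  show admV: "admissible ?V i J"
    unfolding admissible_def
  proof (intro conjI ballI col)
    fix j assume "j \<in> {1..layers ?V}"
    then have j: "j \<in> {1..layers V}" by simp
    note Ij = admissible_colour_set[OF adm j]
    have card: "card (I j) = k_size V j" by (rule admissible_card[OF adm j])
    have M1: "layers V \<in> {1..layers V}" using M by auto
    show "J j = colour_set ?V i j"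
    proof (cases "j = layers V")
      case True
      have "I_hat ?V (layers V) = I_hat V (layers V) - {L_sum V}"
        using I_hat_top[of ?V] by (simp add: I_hat_top layer_coords_move_last_row(1)[OF M L])
      then show ?thesis
        using admissible_colour_set[OF adm M1] unfolding J_def colour_set_def True by auto
    next
      case False
      then have "j \<in> {1..layers V - 1}" using j by auto
      from I_hat_move_last_row[OF M L this] show ?thesis
        using Ij False by (simp add: J_def colour_set_def)
    qed
    show "card (J j) = k_size ?V j"
      using card mem(1) by (auto simp: J_def)
  qed
  show "relabelled ?V J j = relabelled V I j" if j: "j \<in> {1..layers V - 1}"
    \<comment> \<open>No coordinate is renumbered, so the embedding is \<open>id\<close>.\<close>
    using relabelled_vimage[OF adm, of ?V id J j] admV j I_hat_move_last_row[OF M L j]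
    by (auto simp: strict_mono_def J_def)
qed

section \<open>Deleting the last coordinate of the top layer (case B)\<close>

definition drop_top :: "'a variables \<Rightarrow> 'a variables" where
  "drop_top V = V\<lparr>ytop := butlast (ytop V)\<rparr>"

lemma drop_top_simps [simp]:
  "layers (drop_top V) = layers V" "xvars (drop_top V) = xvars V"
  "yI (drop_top V) = yI V" "yII (drop_top V) = yII V" "ytop (drop_top V) = butlast (ytop V)"
  "offset_I (drop_top V) = offset_I V"
  by (simp_all add: drop_top_def offset_I_def fun_eq_iff)

definition skip_coord :: "nat \<Rightarrow> nat \<Rightarrow> nat" where
  "skip_coord l c = (if c < l then c else c + 1)"

lemma skip_coord_strict_mono: "strict_mono (skip_coord l)"
  by (auto simp: strict_mono_def skip_coord_def)

lemma range_skip_coord: "range (skip_coord l) = - {l}"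
proof (intro equalityI subsetI)
  fix c assume "c \<in> - {l}"
  then have "c = skip_coord l (if c < l then c else c - 1)"
    by (auto simp: skip_coord_def)
  then show "c \<in> range (skip_coord l)" by blast
qed (auto simp: skip_coord_def)

lemma offset_II_drop_top: "1 \<le> L_top V \<Longrightarrow> offset_II V p = offset_II (drop_top V) p + 1"
  by (simp add: offset_II_def)

lemma layer_coords_drop_top:
  assumes "1 \<le> L_top V" "p \<in> {1..layers V}"
  shows "layer_coords (drop_top V) p = skip_coord (L_sum V) -` layer_coords V p"
proof (cases "p < layers V")
  case True
  have "offset_I V p + L_I V p < L_sum V"
    using offset_I_mono[OF True, of V] assms by (simp add: L_sum_def)
  moreover have "L_sum V \<le> offset_II V p" by (rule L_sum_le_offset_II)
  ultimately show ?thesis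
    using offset_II_drop_top[OF assms(1), of p] True
    by (intro set_eqI, case_tac "x < L_sum V") (auto simp: layer_coords_def skip_coord_def)
next
  case False
  moreover obtain t where t: "L_top V = Suc t" using assms(1) by (cases "L_top V") auto
  ultimately show ?thesis
    using assms(2) by (auto simp: layer_coords_def skip_coord_def L_sum_def split: if_splits)
qed

text \<open>The colour \<open>M + 1\<close> keeps \<open>L_sum\<close> out of every
  \<open>I j\<close>, and out of the low coordinates at each level \<open>j < M\<close>. Deleting it
  only renumbers the coordinates beyond it.\<close>

lemma admissible_drop_top:
  assumes adm: "admissible V i I" and M: "1 \<le> layers V" and L: "1 \<le> L_top V"
    and B: "i (L_sum V) = layers V + 1"
  defines "J \<equiv> (\<lambda>j. if j = layers V then I (layers V)
     else {c \<in> I j. c \<le> L_sum V} \<union> {c - 1 | c. c \<in> I j \<and> c > L_sum V})"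
  shows "admissible (drop_top V) (i \<circ> skip_coord (L_sum V)) J"
    and "j \<in> {1..layers V - 1} \<Longrightarrow> relabelled (drop_top V) J j = relabelled V I j"
proof -
  let ?V = "drop_top V" and ?g = "skip_coord (L_sum V)"
  have hat: "I_hat ?V j = ?g -` I_hat V j" if "j \<in> {1..layers V}" for j
    using that layer_coords_drop_top[OF L] by (auto simp: I_hat_def)
  have notin: "L_sum V \<notin> I j" if "j \<in> {1..layers V}" for j
    using admissible_colour_set[OF adm that] B that by auto
  have J: "J j = ?g -` I j" if j: "j \<in> {1..layers V}" for j
  proof (cases "j = layers V")
    case True
    \<comment> \<open>\<open>I M\<close> lies in the top layer, whose last coordinate is
      \<open>L_sum\<close>, so none of its elements is shifted.\<close>
    have lt: "c < L_sum V" if "c \<in> I (layers V)" for c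
    proof -
      have "c \<in> layer_coords V (layers V)"
        using admissible_colour_set[OF adm j] that unfolding True I_hat_top by blast
      then have "c \<le> L_sum V" by (simp add: layer_coords_def L_sum_def)
      moreover have "c \<noteq> L_sum V" using notin[OF j] that True by blast
      ultimately show ?thesis by simp
    qed
    have "c \<in> I (layers V) \<longleftrightarrow> ?g c \<in> I (layers V)" for c
      using lt[of c] lt[of "c + 1"] by (auto simp: skip_coord_def)
    then show ?thesis by (auto simp: J_def True)
  next
    case False
    have "c \<in> J j \<longleftrightarrow> ?g c \<in> I j" for c
    proof (cases "c < L_sum V")
      case True
      then have "c \<noteq> d - 1" if "d > L_sum V" for d using that by simp
      then show ?thesis using False True by (auto simp: J_def skip_coord_def)
    next
      case ge: False
      have "(\<exists>d. c = d - 1 \<and> d \<in> I j \<and> d > L_sum V) \<longleftrightarrow> c + 1 \<in> I j"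
      proof
        assume "\<exists>d. c = d - 1 \<and> d \<in> I j \<and> d > L_sum V"
        then obtain d where d: "c = d - 1" "d \<in> I j" "d > L_sum V" by blast
        then have "d = c + 1" by simp
        then show "c + 1 \<in> I j" using d by simp
      next
        assume "c + 1 \<in> I j"
        then show "\<exists>d. c = d - 1 \<and> d \<in> I j \<and> d > L_sum V"
          using ge by (intro exI[of _ "c + 1"]) simp
      qed
      moreover have "\<not> (c \<in> I j \<and> c \<le> L_sum V)" using ge notin[OF j] le_antisym not_less by metis
      moreover have "c \<in> J j \<longleftrightarrow> c \<in> I j \<and> c \<le> L_sum V \<or> (\<exists>d. c = d - 1 \<and> d \<in> I j \<and> d > L_sum V)"
        using False by (simp add: J_def)
      moreover have "?g c = c + 1" using ge by (simp add: skip_coord_def)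
      ultimately show ?thesis by argo
    qed
    then show ?thesis by auto
  qed
  have col: "is_colouring ?V (i \<circ> ?g)"
    unfolding is_colouring_def
  proof (intro ballI)
    fix p c assume "p \<in> {1..layers ?V}" "c \<in> layer_coords ?V p"
    then have "p \<in> {1..layers V}" "?g c \<in> layer_coords V p"
      using layer_coords_drop_top[OF L, of p] by auto
    then show "(i \<circ> ?g) c \<in> {1..p + 1}"
      using adm unfolding admissible_def is_colouring_def by fastforce
  qed
  show admV: "admissible ?V (i \<circ> ?g) J"
  proof (rule admissible_vimage[OF adm strict_mono_imp_inj_on[OF skip_coord_strict_mono]])
    fix j assume "j \<in> {1..layers ?V}"
    then have j: "j \<in> {1..layers V}" by simp
    show "I_hat ?V j = ?g -` I_hat V j" "J j = ?g -` I j" using hat[OF j] J[OF j] by auto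
    show "I j \<subseteq> range ?g" using notin[OF j] by (auto simp: range_skip_coord)
  qed (use col in auto)
  show "relabelled ?V J j = relabelled V I j" if j: "j \<in> {1..layers V - 1}"
  proof (rule relabelled_vimage[OF adm admV skip_coord_strict_mono])
    show jV: "j \<in> {1..layers V}" "j \<in> {1..layers ?V}" using j by auto
    show "I_hat ?V j = ?g -` I_hat V j" "J j = ?g -` I j"
      using hat J jV by auto
    show "low_coords V I j \<subseteq> range ?g"
      using low_coords_admissible[OF adm jV(1)] B j by (auto simp: range_skip_coord)
  qed
qed

section \<open>Removing the top layer (initial condition)\<close>

definition remove_layer :: "'a variables \<Rightarrow> 'a variables" where
  "remove_layer V = V\<lparr>layers := layers V - 1,
     ytop := yI V (layers V - 1) @ [hd (xvars V (layers V))] @ yII V (layers V - 1)\<rparr>"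

lemma remove_layer_simps [simp]:
  "layers (remove_layer V) = layers V - 1" "xvars (remove_layer V) = xvars V"
  "yI (remove_layer V) = yI V" "yII (remove_layer V) = yII V"
  "ytop (remove_layer V) = yI V (layers V - 1) @ [hd (xvars V (layers V))] @ yII V (layers V - 1)"
  "offset_I (remove_layer V) = offset_I V"
  by (simp_all add: remove_layer_def offset_I_def fun_eq_iff)

text \<open>The increasing enumeration of the coordinates outside \<open>{l<..l + m}\<close>, used
  for the interval of all coordinates of layer \<open>M\<close> except the last.\<close>

definition skip_coords :: "nat \<Rightarrow> nat \<Rightarrow> nat \<Rightarrow> nat" where
  "skip_coords l m c = (if c \<le> l then c else c + m)"

lemma skip_coords_strict_mono: "strict_mono (skip_coords l m)"
  by (auto simp: strict_mono_def skip_coords_def)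

lemma range_skip_coords: "range (skip_coords l m) = - {l<..l + m}"
proof (intro equalityI subsetI)
  fix c assume "c \<in> - {l<..l + m}"
  then have "c = skip_coords l m (if c \<le> l then c else c - m)"
    by (auto simp: skip_coords_def)
  then show "c \<in> range (skip_coords l m)" by blast
qed (auto simp: skip_coords_def)

lemma offset_I_last:
  assumes "2 \<le> layers V"
  shows "offset_I V (layers V) = offset_I V (layers V - 1) + L_I V (layers V - 1)"
proof -
  have "{1..<layers V} = insert (layers V - 1) {1..<layers V - 1}" using assms by auto
  then show ?thesis by (simp add: offset_I_def)
qed

lemma offset_II_remove_layer:
  assumes "2 \<le> layers V" "1 \<le> L_top V" "p < layers V - 1"
  shows "offset_II V p = offset_II (remove_layer V) p + (L_top V - 1)"
    "offset_I V (layers V) < offset_II (remove_layer V) p"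
proof -
  have "{p<..<layers V} = insert (layers V - 1) {p<..<layers V - 1}" using assms by auto
  moreover obtain t where "L_top V = Suc t" using assms(2) by (cases "L_top V") auto
  ultimately show "offset_II V p = offset_II (remove_layer V) p + (L_top V - 1)"
    using assms offset_I_last[OF assms(1)] by (simp add: offset_II_def)
  show "offset_I V (layers V) < offset_II (remove_layer V) p"
    using offset_I_last[OF assms(1)] by (simp add: offset_II_def)
qed

text \<open>Of the coordinates of layer \<open>M\<close> only \<open>L_sum\<close> survives. It
  joins those of layer \<open>M - 1\<close>, between \<open>yI\<close> and \<open>yII\<close>, where
  the variable \<open>x\<close> of the single row now stands.\<close>

lemma layer_coords_remove_layer:
  assumes "2 \<le> layers V" "1 \<le> L_top V"
  defines "g \<equiv> skip_coords (offset_I V (layers V)) (L_top V - 1)"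
  shows "layer_coords (remove_layer V) (layers V - 1) =
      g -` (layer_coords V (layers V - 1) \<union> layer_coords V (layers V))"
    "g -` layer_coords V (layers V) = g -` {L_sum V}"
    "1 \<le> p \<Longrightarrow> p < layers V - 1 \<Longrightarrow> layer_coords (remove_layer V) p = g -` layer_coords V p"
proof -
  obtain t where t: "L_top V = Suc t" using assms(2) by (cases "L_top V") auto
  show "layer_coords (remove_layer V) (layers V - 1) =
      g -` (layer_coords V (layers V - 1) \<union> layer_coords V (layers V))"
    using assms(1) offset_I_last[OF assms(1)] offset_II_last[of V]
    by (intro set_eqI, case_tac "x \<le> offset_I V (layers V)")
      (auto simp: layer_coords_def g_def skip_coords_def L_sum_def t)
  show "g -` layer_coords V (layers V) = g -` {L_sum V}"
    by (auto simp: layer_coords_def g_def skip_coords_def L_sum_def t split: if_splits)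
  show "layer_coords (remove_layer V) p = g -` layer_coords V p" if p: "1 \<le> p" "p < layers V - 1"
  proof -
    have "offset_I V p + L_I V p \<le> offset_I V (layers V)"
      using p by (intro offset_I_mono) auto
    then show ?thesis
      using p offset_II_remove_layer[OF assms(1,2) p(2)]
      by (intro set_eqI, case_tac "x \<le> offset_I V (layers V)")
        (auto simp: layer_coords_def g_def skip_coords_def t)
  qed
qed

text \<open>Since \<open>L_sum\<close> belongs to \<open>I M\<close> and \<open>k_M = 1\<close>, all
  other coordinates of layer \<open>M\<close> have colour \<open>M + 1\<close>. They lie in no low
  set at a level below \<open>M\<close>, so skipping them preserves the sets and their
  relabellings.\<close>

lemma admissible_remove_layer:
  assumes adm: "admissible V i I" and M: "2 \<le> layers V" and L: "1 \<le> L_top V"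
    and A: "i (L_sum V) \<noteq> layers V + 1" and k: "k_size V (layers V) = 1"
  defines "J \<equiv> (\<lambda>j. {c \<in> I j. c < L_sum V} \<union> {c - L_top V + 1 | c. c \<in> I j \<and> c \<ge> L_sum V})"
  shows "admissible (remove_layer V) (i \<circ> skip_coords (offset_I V (layers V)) (L_top V - 1)) J"
    and "j \<in> {1..layers V - 1} \<Longrightarrow> relabelled (remove_layer V) J j = relabelled V I j"
    and "(\<lambda>c. c - offset_I V (layers V - 1)) ` J (layers V - 1) = relabelled V I (layers V - 1)"
    and "I (layers V) = {L_sum V}"
proof -
  let ?V = "remove_layer V" and ?g = "skip_coords (offset_I V (layers V)) (L_top V - 1)"
  let ?M = "layers V"
  have mem: "L_sum V \<in> I ?M" "i (L_sum V) \<in> {1..?M}"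
    using admissible_L_sum_mem[OF adm _ L A] M by auto
  have "card (I ?M) = 1" using admissible_card[OF adm, of ?M] M k by simp
  then show IM: "I ?M = {L_sum V}"
    using mem(1) by (auto simp: card_1_singleton_iff)
  have Mm: "?M \<in> {1..?M}" using M by auto
  have top: "c = L_sum V" if "c \<in> layer_coords V ?M" "i c \<in> {1..?M}" for c
    using admissible_colour_set[OF adm Mm] IM that by (auto simp: I_hat_top)
  have gap: "c \<in> range ?g" if "c \<in> layer_coords V p" "p \<in> {1..?M}" "p = ?M \<longrightarrow> c = L_sum V" for c p
  proof (cases "p = ?M")
    case True
    then show ?thesis using that L by (auto simp: range_skip_coords L_sum_def)
  next
    case False
    then have p: "p < ?M" "1 \<le> p" using that(2) by auto
    show ?thesis
      using that(1) p offset_I_mono[OF p, of V] L_sum_le_offset_II[of V p]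
      by (auto simp: range_skip_coords layer_coords_def L_sum_def)
  qed
  have low: "{c \<in> I_hat V j. i c \<in> {1..j + 1}} \<subseteq> range ?g" if j: "j \<in> {1..?M - 1}" for j
  proof
    fix c assume "c \<in> {c \<in> I_hat V j. i c \<in> {1..j + 1}}"
    then obtain p where p: "p \<in> {j..?M}" "c \<in> layer_coords V p" and c: "i c \<in> {1..?M}"
      using j by (auto simp: I_hat_def)
    then show "c \<in> range ?g"
      using gap[OF p(2)] top[of c] j by auto
  qed
  have hat: "I_hat ?V j = ?g -` I_hat V j" if j: "j \<in> {1..?M - 1}" for j
  proof -
    have split: "{j..?M} = insert ?M (insert (?M - 1) {j..<?M - 1})" "{j..?M - 1} = insert (?M - 1) {j..<?M - 1}"
      using j by auto
    have "(\<Union>p\<in>{j..<?M - 1}. layer_coords ?V p) = ?g -` (\<Union>p\<in>{j..<?M - 1}. layer_coords V p)"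
      using layer_coords_remove_layer(3)[OF M L] j by auto
    then show ?thesis
      using layer_coords_remove_layer(1)[OF M L]
      unfolding I_hat_def remove_layer_simps split by auto
  qed
  have J: "J j = ?g -` I j" if j: "j \<in> {1..?M - 1}" for j
  proof -
    have "I j \<subseteq> range ?g"
      using admissible_colour_set[OF adm, of j] j low[OF j] by auto
    then have out: "c \<le> offset_I V ?M \<or> L_sum V \<le> c" if "c \<in> I j" for c
      using that L by (cases "L_top V") (auto simp: range_skip_coords L_sum_def)
    have "c \<in> J j \<longleftrightarrow> ?g c \<in> I j" for c
    proof (cases "c \<le> offset_I V ?M")
      case True
      then have "c < L_sum V" using L by (simp add: L_sum_def)
      moreover have "c \<noteq> d - L_top V + 1" if "d \<ge> L_sum V" for d
        using True that L by (simp add: L_sum_def)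
      ultimately show ?thesis using True by (auto simp: J_def skip_coords_def)
    next
      case False
      define e where "e = c + (L_top V - 1)"
      have e: "e \<ge> L_sum V" "c = e - L_top V + 1"
        using False L by (auto simp: L_sum_def e_def)
      have "(\<exists>d. c = d - L_top V + 1 \<and> d \<in> I j \<and> d \<ge> L_sum V) \<longleftrightarrow> e \<in> I j"
      proof
        assume "\<exists>d. c = d - L_top V + 1 \<and> d \<in> I j \<and> d \<ge> L_sum V"
        then obtain d where d: "c = d - L_top V + 1" "d \<in> I j" "d \<ge> L_sum V" by blast
        then have "d = e" using L by (simp add: L_sum_def e_def)
        then show "e \<in> I j" using d by simp
      next
        assume "e \<in> I j"
        then show "\<exists>d. c = d - L_top V + 1 \<and> d \<in> I j \<and> d \<ge> L_sum V"
          using e by blast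
      qed
      moreover have "\<not> (c \<in> I j \<and> c < L_sum V)"
        using out[of c] False by linarith
      moreover have "c \<in> J j \<longleftrightarrow> c \<in> I j \<and> c < L_sum V \<or> (\<exists>d. c = d - L_top V + 1 \<and> d \<in> I j \<and> d \<ge> L_sum V)"
        by (simp add: J_def)
      moreover have "?g c = e" using False by (simp add: skip_coords_def e_def)
      ultimately show ?thesis by argo
    qed
    then show ?thesis by auto
  qed
  have col: "is_colouring ?V (i \<circ> ?g)"
    unfolding is_colouring_def
  proof (intro ballI)
    fix p c assume p: "p \<in> {1..layers ?V}" "c \<in> layer_coords ?V p"
    then have pM: "p \<in> {1..?M}" by auto
    have "?g c \<in> layer_coords V p \<or> ?g c = L_sum V \<and> p = ?M - 1"
      using p layer_coords_remove_layer[OF M L] by (cases "p = ?M - 1") auto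
    then show "(i \<circ> ?g) c \<in> {1..p + 1}"
      using adm pM mem(2) unfolding admissible_def is_colouring_def by fastforce
  qed
  show admV: "admissible ?V (i \<circ> ?g) J"
  proof (rule admissible_vimage[OF adm strict_mono_imp_inj_on[OF skip_coords_strict_mono]])
    fix j assume "j \<in> {1..layers ?V}"
    then have j: "j \<in> {1..?M - 1}" by simp
    show "I_hat ?V j = ?g -` I_hat V j" "J j = ?g -` I j" using hat[OF j] J[OF j] by auto
    show "I j \<subseteq> range ?g"
      using admissible_colour_set[OF adm, of j] j low[OF j] by auto
  qed (use col in auto)
  have rel: "relabelled ?V J j = relabelled V I j" if j: "j \<in> {1..?M - 1}" for j
  proof (rule relabelled_vimage[OF adm admV skip_coords_strict_mono])
    show jV: "j \<in> {1..?M}" "j \<in> {1..layers ?V}" using j by auto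
    show "I_hat ?V j = ?g -` I_hat V j" "J j = ?g -` I j"
      using hat J j by auto
    show "low_coords V I j \<subseteq> range ?g"
      using low_coords_admissible[OF adm jV(1)] low[OF j] by auto
  qed
  then show "j \<in> {1..layers V - 1} \<Longrightarrow> relabelled ?V J j = relabelled V I j" by simp
  have m: "?M - 1 \<in> {1..layers ?V}" using M by auto
  \<comment> \<open>In the new top layer every colour is at most \<open>M\<close>, so relabelling
    counts all coordinates of an interval and is a shift by its offset.\<close>
  have "low_coords ?V J (?M - 1) = layer_coords ?V (?M - 1)"
    using low_coords_admissible[OF admV m] col m I_hat_top[of ?V]
    unfolding is_colouring_def by fastforce
  moreover have "J (?M - 1) \<subseteq> layer_coords ?V (?M - 1)"
    using admissible_colour_set[OF admV m] I_hat_top[of ?V] by auto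
  moreover have "card {a \<in> layer_coords ?V (?M - 1). a \<le> c} = c - offset_I V (?M - 1)"
    if "c \<in> layer_coords ?V (?M - 1)" for c
  proof -
    have "{a \<in> layer_coords ?V (?M - 1). a \<le> c} = {offset_I V (?M - 1)<..c}"
      using that by (auto simp: layer_coords_def)
    then show ?thesis by simp
  qed
  ultimately have "relabelled ?V J (?M - 1) = (\<lambda>c. c - offset_I V (?M - 1)) ` J (?M - 1)"
    unfolding relabelled_def by (intro image_cong) auto
  then show "(\<lambda>c. c - offset_I V (?M - 1)) ` J (?M - 1) = relabelled V I (?M - 1)"
    using rel[of "?M - 1"] M by simp
qed

section \<open>Symmetry and recursion\<close>

lemma layer_coords_I: "p < layers V \<Longrightarrow> s \<in> {1..L_I V p} \<Longrightarrow> offset_I V p + s \<in> layer_coords V p"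
  and layer_coords_II: "p < layers V \<Longrightarrow> s \<in> {1..L_II V p} \<Longrightarrow> offset_II V p + s \<in> layer_coords V p"
  and layer_coords_top: "s \<in> {1..L_top V} \<Longrightarrow> offset_I V (layers V) + s \<in> layer_coords V (layers V)"
  by (auto simp: layer_coords_def)

lemma top_I_admissible:
  assumes "admissible V i I" "p \<in> {1..<layers V}"
  shows "top_I V I p = map (\<lambda>s. i (offset_I V p + s)) [1..<Suc (L_I V p)]"
    "top_II V I p = map (\<lambda>s. i (offset_II V p + s)) [1..<Suc (L_II V p)]"
  unfolding top_I_def top_II_def
  using assms by (auto intro!: colour_of_admissible layer_coords_I layer_coords_II simp del: upt_Suc)

lemma top_colours_admissible:
  assumes "admissible V i I" "1 \<le> layers V"
  shows "top_colours V I = map (\<lambda>s. i (offset_I V (layers V) + s)) [1..<Suc (L_top V)]"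
  unfolding top_colours_def
  using assms by (auto intro!: colour_of_admissible layer_coords_top simp del: upt_Suc)

lemma top_colours_snoc:
  assumes "admissible V i I" "1 \<le> layers V" "1 \<le> L_top V"
  shows "top_colours V I = map (\<lambda>s. i (offset_I V (layers V) + s)) [1..<L_top V] @ [i (L_sum V)]"
  using assms by (simp add: top_colours_admissible L_sum_def)

lemma prod_list_map_nth: "(\<Prod>y\<leftarrow>ys. f y) = (\<Prod>j<length ys. f (ys ! j))"
  by (induction ys) (simp_all add: prod.lessThan_Suc_shift del: prod.lessThan_Suc)

lemma words_set: "w \<in> words n m \<Longrightarrow> set w \<subseteq> {1..n}"
  by (simp add: words_def)

section \<open>Symmetry in the row variables of the top layer\<close>

lemma top_update:
  assumes "layers V' = layers V" "yI V' = yI V" "yII V' = yII V" "L_top V' = L_top V"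
  shows "top_I V' I = top_I V I" "top_II V' I = top_II V I" "top_colours V' I = top_colours V I"
  using assms by (simp_all add: fun_eq_iff top_I_def top_II_def top_colours_def offset_I_def offset_II_def)

lemma psi_swap:
  fixes V :: "'a::{idom, ring_char_0} variables"
  assumes "1 \<le> layers V" "Suc k < k_size V (layers V)"
  defines "V' \<equiv> V\<lparr>xvars := (xvars V)(layers V := swapl k (xvars V (layers V)))\<rparr>"
  shows "psi V' I = psi V I"
proof -
  have *: "(xvars V (layers V) ! k - xvars V (layers V) ! Suc k + 1) * psi V I =
      (xvars V (layers V) ! k - xvars V (layers V) ! Suc k + 1) *
      psi (V\<lparr>xvars := (xvars V)(layers V := swapl k (xvars V (layers V)))\<rparr>) I"
    if "1 \<le> layers V" "Suc k < k_size V (layers V)" for V :: "'a variables"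
  proof -
    let ?M = "layers V" and ?n = "layers V + 1"
    let ?xs = "xvars V ?M"
    let ?V = "V\<lparr>xvars := (xvars V)(?M := swapl k ?xs)\<rparr>"
    let ?u = "?xs ! k - ?xs ! Suc k" and ?W = "words ?n (length ?xs)"
    let ?L = "\<lambda>V. low_pf ?n V I (?M - 1)"
    let ?G = "\<lambda>xs g. grid_pf ?n xs (ytop V) g (replicate (L_top V) ?n) ?n (top_colours V I)"
    have low: "?u * ?L V (swapl k g) + ?L V g = (?u + 1) * ?L ?V g" if "g \<in> ?W" for g
      using low_pf_swap[of k V "?M - 1" ?n g I] that \<open>1 \<le> ?M\<close> \<open>Suc k < length ?xs\<close> by simp
    have grid: "(?u + 1) * ?G ?xs g = ?u * ?G (swapl k ?xs) (swapl k g) + ?G (swapl k ?xs) g" if "g \<in> ?W" for g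
      by (rule grid_pf_swap_rows)
        (use that \<open>Suc k < length ?xs\<close> top_colours_words[of V ?n I] in \<open>auto simp: length_words\<close>)
    have top: "top_colours ?V I = top_colours V I"
      by (rule top_update) auto
    have "(?u + 1) * psi V I = (\<Sum>g\<in>?W. ?L V g * (?u * ?G (swapl k ?xs) (swapl k g) + ?G (swapl k ?xs) g))"
      unfolding psi_eq[OF \<open>1 \<le> ?M\<close>] sum_distrib_left
      by (intro sum.cong refl) (simp only: grid[symmetric] mult.left_commute)
    \<comment> \<open>A double swap is inserted so that reindexing \<open>g\<close> moves P from the
      left edges of the top layer to the top edges of the lower layers, where
      \<open>low_pf_swap\<close> absorbs it.\<close>
    also have "\<dots> = ?u * (\<Sum>g\<in>?W. ?L V (swapl k (swapl k g)) * ?G (swapl k ?xs) (swapl k g)) + (\<Sum>g\<in>?W. ?L V g * ?G (swapl k ?xs) g)"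
      by (simp add: sum_regroup')
    also have "(\<Sum>g\<in>?W. ?L V (swapl k (swapl k g)) * ?G (swapl k ?xs) (swapl k g)) =
        (\<Sum>g\<in>?W. ?L V (swapl k g) * ?G (swapl k ?xs) g)"
      by (rule sum_words_swapl)
    also have "?u * \<dots> + (\<Sum>g\<in>?W. ?L V g * ?G (swapl k ?xs) g) =
       (\<Sum>g\<in>?W. (?u * ?L V (swapl k g) + ?L V g) * ?G (swapl k ?xs) g)"
      by (rule sum_regroup)
    also have "\<dots> = (\<Sum>g\<in>?W. ((?u + 1) * ?L ?V g) * ?G (swapl k ?xs) g)"
      using low by simp
    also have "\<dots> = (?u + 1) * psi ?V I"
      using \<open>1 \<le> ?M\<close> by (subst psi_eq) (simp_all add: sum_distrib_left mult.assoc top)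
    finally show ?thesis .
  qed
  let ?xs = "xvars V (layers V)"
  let ?u = "?xs ! k - ?xs ! Suc k"
  have nth: "swapl k xs ! k = xs ! Suc k" "swapl k xs ! Suc k = xs ! k" if "Suc k < length xs" for xs :: "'a list"
    using that by (induction k xs rule: swapl.induct) auto
  have "(?u + 1) * psi V I = (?u + 1) * psi V' I"
    unfolding V'_def by (rule *) (use assms in auto)
  moreover have "(- ?u + 1) * psi V' I = (- ?u + 1) * psi V I"
    using *[of V'] assms(1,2) by (simp add: V'_def nth)
  \<comment> \<open>\<open>?u + 1\<close> may vanish, but it and its counterpart \<open>- ?u + 1\<close> add up to \<open>2\<close>.\<close>
  ultimately have "(?u + 1) * (psi V I - psi V' I) + (- ?u + 1) * (psi V I - psi V' I) = 0"
    by (simp only: right_diff_distrib diff_self add_0)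
  then have "2 * (psi V I - psi V' I) = 0"
    by (simp add: distrib_right[symmetric] del: mult_eq_0_iff)
  then show ?thesis by simp
qed

text \<open>Adjacent transpositions generate all permutations: \<open>move\<close> carries an entry
  leftwards past \<open>zs\<close>, and the entries are put into place one after another, with those
  already placed collected in \<open>pre\<close>.\<close>

lemma invariant_mset:
  assumes "\<And>k xs. Suc k < length xs \<Longrightarrow> length xs = m \<Longrightarrow> F (swapl k xs) = F xs"
  shows "mset xs = mset ys \<Longrightarrow> length xs = m \<Longrightarrow> F xs = F ys"
proof -
  have move: "F (pre @ zs @ x # post) = F (pre @ x # zs @ post)" if "length (pre @ zs @ x # post) = m" for pre zs x post
    using that
  proof (induction zs arbitrary: pre)
    case Nil
    then show ?case by simp
  next
    case (Cons z zs)
    have "F (pre @ (z # zs) @ x # post) = F ((pre @ [z]) @ x # zs @ post)"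
      using Cons.IH[of "pre @ [z]"] Cons.prems by simp
    also have "\<dots> = F (swapl (length pre) (pre @ x # z # zs @ post))"
      using swapl_append1[of pre 0 "x # z # zs @ post"] by simp
    also have "\<dots> = F (pre @ x # z # zs @ post)"
      using Cons.prems by (intro assms) auto
    finally show ?case by simp
  qed
  have "F (pre @ xs) = F (pre @ ys)" if "mset xs = mset ys" "length (pre @ xs) = m" for pre
    using that
  proof (induction xs arbitrary: pre ys)
    case Nil
    then show ?case by simp
  next
    case (Cons x xs)
    have "x \<in> set ys" using Cons.prems(1) by (metis list.set_intros(1) mset_eq_setD)
    then obtain zs post where ys: "ys = zs @ x # post" by (meson split_list)
    have "mset xs = mset (zs @ post)" using Cons.prems(1) by (simp add: ys)
    then have "F ((pre @ [x]) @ xs) = F ((pre @ [x]) @ zs @ post)"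
      using Cons.prems(2) by (intro Cons.IH) auto
    moreover have "length ys = length (x # xs)" using Cons.prems(1) by (metis size_mset)
    ultimately show ?case using move[of pre zs x post] Cons.prems(2) by (simp add: ys)
  qed
  from this[of "[]"] show "mset xs = mset ys \<Longrightarrow> length xs = m \<Longrightarrow> F xs = F ys" by simp
qed

lemma psi_symmetric:
  fixes V :: "'a::{idom, ring_char_0} variables"
  assumes M: "1 \<le> layers V" and "mset xs = mset (xvars V (layers V))"
  shows "psi (V\<lparr>xvars := (xvars V)(layers V := xs)\<rparr>) I = psi V I"
proof -
  let ?F = "\<lambda>xs. psi (V\<lparr>xvars := (xvars V)(layers V := xs)\<rparr>) I"
  have "?F xs = ?F (xvars V (layers V))"
  proof (rule invariant_mset[where m = "length xs"])
    fix k and zs :: "'a list" assume "Suc k < length zs"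
    then show "?F (swapl k zs) = ?F zs"
      using psi_swap[of "V\<lparr>xvars := (xvars V)(layers V := zs)\<rparr>" k I] M by simp
  qed (use assms in auto)
  then show ?thesis by simp
qed

section \<open>Evaluating the last column of the top layer\<close>

lemma replicate_length_butlast:
  "ys \<noteq> [] \<Longrightarrow> replicate (length ys) q = replicate (length (butlast ys)) q @ [q]"
  by (cases ys rule: rev_cases) (auto simp: replicate_append_same)

lemma top_colours_last:
  assumes "admissible V i I" "1 \<le> layers V" "ytop V \<noteq> []"
  obtains ts where "top_colours V I = ts @ [i (L_sum V)]" "ts \<in> words (layers V + 1) (length (butlast (ytop V)))"
    "i (L_sum V) \<in> {1..layers V + 1}" "ts = map (\<lambda>s. i (offset_I V (layers V) + s)) [1..<L_top V]"
proof -
  let ?ts = "map (\<lambda>s. i (offset_I V (layers V) + s)) [1..<L_top V]"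
  have L: "1 \<le> L_top V" using assms(3) by (cases "ytop V") auto
  note top = top_colours_snoc[OF assms(1,2) L]
  then have "set (?ts @ [i (L_sum V)]) \<subseteq> {1..layers V + 1}"
    using words_set[OF top_colours_words[of V "layers V + 1" I]] by simp
  then show ?thesis using that[OF top] by (auto simp: words_def)
qed

lemma psi_update_ytop:
  assumes "1 \<le> layers V" "length zs = L_top V"
  shows "psi (V\<lparr>ytop := zs\<rparr>) I =
    (\<Sum>g\<in>words (layers V + 1) (k_size V (layers V)). low_pf (layers V + 1) V I (layers V - 1) g *
       grid_pf (layers V + 1) (xvars V (layers V)) zs g
         (replicate (L_top V) (layers V + 1)) (layers V + 1) (top_colours V I))"
proof -
  note top = top_update[of "V\<lparr>ytop := zs\<rparr>" V]
  have "low_pf n (V\<lparr>ytop := zs\<rparr>) I p g = low_pf n V I p g" for n p g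
    by (rule low_pf_cong) (use assms top in auto)
  then show ?thesis
    using assms top by (subst psi_eq) auto
qed

text \<open>Only the top layer contains \<open>ytop\<close>, so \<open>psi\<close> is a linear
  combination of the polynomials from \<open>grid_pf_degree\<close>, with the values of
  \<open>low_pf\<close> as coefficients.\<close>

lemma psi_degree:
  fixes V :: "'a::{idom, ring_char_0} variables"
  assumes adm: "admissible V i I" and M: "1 \<le> layers V" and L: "ytop V \<noteq> []"
    and A: "i (L_sum V) \<noteq> layers V + 1"
  shows "\<exists>q :: 'a poly. degree q \<le> k_size V (layers V) - 1 \<and>
    (\<forall>y. psi (V\<lparr>ytop := (ytop V)[L_top V - 1 := y]\<rparr>) I = poly q y)"
proof -
  let ?n = "layers V + 1" and ?ys = "butlast (ytop V)"
  obtain ts where ts: "top_colours V I = ts @ [i (L_sum V)]" "ts \<in> words ?n (length ?ys)" "i (L_sum V) \<in> {1..?n}"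
    using top_colours_last[OF adm M L] by blast
  have upd: "(ytop V)[L_top V - 1 := y] = ?ys @ [y]" for y
    using L by (cases "ytop V" rule: rev_cases) auto
  have rep: "replicate (L_top V) ?n = replicate (length ?ys) ?n @ [?n]"
    using L by (rule replicate_length_butlast)
  have "psi (V\<lparr>ytop := (ytop V)[L_top V - 1 := y]\<rparr>) I =
    (\<Sum>g\<in>words ?n (k_size V (layers V)). low_pf ?n V I (layers V - 1) g *
       grid_pf ?n (xvars V (layers V)) (?ys @ [y]) g (replicate (length ?ys) ?n @ [?n]) ?n (ts @ [i (L_sum V)]))" for y
    by (subst psi_update_ytop[OF M length_list_update]) (simp only: upd rep ts(1))
  then show ?thesis
    using ts A by (simp only:) (intro ex_poly_sum grid_pf_degree finite_words, auto simp: words_def)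
qed

lemma psi_case_A:
  fixes V :: "'a::{idom, ring_char_0} variables"
  assumes adm: "admissible V i I" and M: "2 \<le> layers V" and L: "ytop V \<noteq> []"
    and A: "i (L_sum V) \<noteq> layers V + 1"
  defines "J \<equiv> (\<lambda>j. if j = layers V then I (layers V) - {L_sum V} else I j)"
    and "x \<equiv> last (xvars V (layers V))"
  shows "psi (V\<lparr>ytop := (ytop V)[L_top V - 1 := x + 1]\<rparr>) I =
    (\<Prod>j<L_top V - 1. x - ytop V ! j) * (\<Prod>j<k_size V (layers V) - 1. xvars V (layers V) ! j - x - 1) *
    psi (move_last_row V) J"
proof -
  let ?M = "layers V" let ?n = "?M + 1" and ?ys = "butlast (ytop V)" and ?d = "i (L_sum V)"
  let ?V = "move_last_row V"
  have M1: "1 \<le> ?M" and L1: "1 \<le> L_top V" using M L by (auto simp: Suc_le_eq)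
  note admV = admissible_move_last_row(1)[OF adm M L1 A, folded J_def]
  obtain ts where ts: "top_colours V I = ts @ [?d]" "ts \<in> words ?n (length ?ys)" "?d \<in> {1..?n}"
     "ts = map (\<lambda>s. i (offset_I V ?M + s)) [1..<L_top V]"
    using top_colours_last[OF adm M1 L] by blast
  \<comment> \<open>Case A puts \<open>L_sum\<close> into \<open>I M\<close>; hence
    \<open>k_M \<ge> 1\<close>, and there is a last row to remove.\<close>
  have "I ?M \<noteq> {}" "finite (I ?M)"
    using admissible_L_sum_mem(1)[OF adm M1 L1 A] admissible_colour_set[OF adm, of ?M] M1
    by (auto simp: I_hat_top layer_coords_def)
  then have "xvars V ?M \<noteq> []"
    using admissible_card[OF adm, of ?M] M1 by auto
  then obtain xs where xs: "xvars V ?M = xs @ [x]"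
    unfolding x_def by (metis append_butlast_last_id)
  have upd: "(ytop V)[L_top V - 1 := x + 1] = ?ys @ [x + 1]"
    using L by (cases "ytop V" rule: rev_cases) auto
  have rep: "replicate (L_top V) ?n = replicate (length ?ys) ?n @ [?n]"
    using L by (rule replicate_length_butlast)
  let ?P = "(\<Prod>z\<leftarrow>xs. z - x - 1) * (\<Prod>y\<leftarrow>?ys. x - y)"
  let ?G = "\<lambda>g. grid_pf ?n xs ?ys g (replicate (length ?ys) ?n) ?n ts"
  let ?L = "low_pf ?n V I (?M - 1)"
  have grid: "grid_pf ?n (xs @ [x]) (?ys @ [x + 1]) (g @ [a]) (replicate (length ?ys) ?n @ [?n]) ?n (ts @ [?d]) =
      ?P * of_bool (a = ?d) * ?G g" if "g \<in> words ?n (length xs)" "a \<in> {1..?n}" for g a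
    by (rule grid_pf_specialize) (use that ts(2,3) A in \<open>auto simp: words_def\<close>)
  \<comment> \<open>Once its top colour is fixed to \<open>?d\<close>, the column of
    \<open>x\<close> in layer \<open>M - 1\<close> becomes the first column of the new
    \<open>yII\<close>: the lists of columns and of top colours are merely bracketed
    differently.\<close>
  have low: "?L (g @ [?d]) = low_pf ?n ?V J (?M - 1) g" if "length g = length xs" for g
  proof -
    obtain m where m: "?M = Suc (Suc m)" using M by (metis Suc_le_D numeral_2_eq_2 Suc_le_mono)
    have adj: "top_I ?V J q = top_I V I q" if "1 \<le> q" "q \<le> Suc m" for q
      using that m top_I_admissible(1)[OF adm, of q] top_I_admissible(1)[OF admV, of q] by simp
    have adjII: "top_II ?V J q = top_II V I q" if "1 \<le> q" "q \<le> m" for q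
      using that m M L1 top_I_admissible(2)[OF adm, of q] top_I_admissible(2)[OF admV, of q]
      by (simp add: offset_II_move_last_row)
    have adjM: "top_II ?V J (Suc m) = ?d # top_II V I (Suc m)"
    proof -
      have off: "offset_II ?V (Suc m) = L_sum V - 1" "offset_II V (Suc m) = L_sum V" "1 \<le> L_sum V"
        using m M L1 offset_II_last[of V] by (auto simp: offset_II_move_last_row L_sum_def)
      have upt: "[1..<Suc (Suc k)] = 1 # map Suc [1..<Suc k]" for k
        by (simp add: map_Suc_upt upt_conv_Cons del: upt_Suc)
      have "top_II ?V J (Suc m) = map (\<lambda>s. i (L_sum V - 1 + s)) [1..<Suc (Suc (L_II V (Suc m)))]"
        using top_I_admissible(2)[OF admV, of "Suc m"] m off(1) by (simp del: upt_Suc)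
      also have "\<dots> = ?d # map (\<lambda>s. i (L_sum V + s)) [1..<Suc (L_II V (Suc m))]"
        unfolding upt using off(3) by (simp del: upt_Suc)
      also have "map (\<lambda>s. i (L_sum V + s)) [1..<Suc (L_II V (Suc m))] = top_II V I (Suc m)"
        using top_I_admissible(2)[OF adm, of "Suc m"] m off(2) by (simp del: upt_Suc)
      finally show ?thesis .
    qed
    have "low_pf ?n ?V J m l = low_pf ?n V I m l" for l
      by (rule low_pf_cong) (use m adj adjII in auto)
    then show ?thesis
      using m adj[of "Suc m"] by (simp add: Let_def adjM xs[unfolded m])
  qed
  have "psi (V\<lparr>ytop := (ytop V)[L_top V - 1 := x + 1]\<rparr>) I =
    (\<Sum>g\<in>words ?n (Suc (length xs)). ?L g *
       grid_pf ?n (xs @ [x]) (?ys @ [x + 1]) g (replicate (length ?ys) ?n @ [?n]) ?n (ts @ [?d]))"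
    by (subst psi_update_ytop[OF M1 length_list_update]) (simp only: upd rep ts(1) xs length_append_singleton)
  also have "\<dots> = (\<Sum>g\<in>words ?n (length xs). \<Sum>a\<in>{1..?n}. of_bool (a = ?d) * (?P * (?L (g @ [a]) * ?G g)))"
    unfolding sum_words_snoc by (intro sum.cong refl) (simp only: grid mult_ac)
  also have "\<dots> = (\<Sum>g\<in>words ?n (length xs). ?P * (?L (g @ [?d]) * ?G g))"
    using ts(3) by (intro sum.cong refl sum_of_bool_eq) auto
  also have "\<dots> = ?P * (\<Sum>g\<in>words ?n (length xs). low_pf ?n ?V J (?M - 1) g * ?G g)"
    unfolding sum_distrib_left by (intro sum.cong refl) (simp only: low[OF length_words])
  also have "(\<Sum>g\<in>words ?n (length xs). low_pf ?n ?V J (?M - 1) g * ?G g) = psi ?V J"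
  proof -
    have "top_colours ?V J = ts"
      using top_colours_admissible[OF admV] M1 by (simp add: ts(4) L del: upt_Suc)
    then show ?thesis
      using M1 L1 by (subst psi_eq) (simp_all add: xs)
  qed
  finally show ?thesis
    by (simp add: prod_list_map_nth xs nth_append nth_butlast mult.commute)
qed

lemma psi_case_B:
  fixes V :: "'a::{idom, ring_char_0} variables"
  assumes adm: "admissible V i I" and M: "1 \<le> layers V" and L: "ytop V \<noteq> []"
    and B: "i (L_sum V) = layers V + 1"
  defines "J \<equiv> (\<lambda>j. if j = layers V then I (layers V)
     else {c \<in> I j. c \<le> L_sum V} \<union> {c - 1 | c. c \<in> I j \<and> c > L_sum V})"
  shows "psi V I = (\<Prod>j<k_size V (layers V). xvars V (layers V) ! j - last (ytop V) + 1) * psi (drop_top V) J"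
proof -
  let ?M = "layers V" let ?n = "?M + 1" and ?ys = "butlast (ytop V)"
  let ?V = "drop_top V"
  have L1: "1 \<le> L_top V" using L by (auto simp: Suc_le_eq)
  note admV = admissible_drop_top(1)[OF adm M L1 B, folded J_def]
  obtain ts where ts: "top_colours V I = ts @ [?n]" "ts \<in> words ?n (length ?ys)"
     "ts = map (\<lambda>s. i (offset_I V ?M + s)) [1..<L_top V]"
    using top_colours_last[OF adm M L] B by metis
  have ys: "ytop V = ?ys @ [last (ytop V)]" using L by simp
  have rep: "replicate (L_top V) ?n = replicate (length ?ys) ?n @ [?n]"
    using L by (rule replicate_length_butlast)
  let ?P = "\<Prod>x\<leftarrow>xvars V ?M. x - last (ytop V) + 1"
  let ?W = "words ?n (k_size V ?M)"
  let ?G = "\<lambda>g. grid_pf ?n (xvars V ?M) ?ys g (replicate (length ?ys) ?n) ?n ts"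
  have skip: "skip_coord (L_sum V) (offset_I V p + s) = offset_I V p + s"
    if "p \<in> {1..<?M}" "s \<le> L_I V p" for p s
    using that offset_I_mono[of p ?M V] L1 by (simp add: skip_coord_def L_sum_def)
  have skipII: "skip_coord (L_sum V) (offset_II ?V p + s) = offset_II V p + s" if "1 \<le> s" for p s
    using that offset_II_drop_top[OF L1, of p] L_sum_le_offset_II[of V p] by (simp add: skip_coord_def)
  have skip_top: "skip_coord (L_sum V) (offset_I V ?M + s) = offset_I V ?M + s" if "s < L_top V" for s
    using that by (simp add: skip_coord_def L_sum_def)
  \<comment> \<open>The lower layers keep their variables and colours; only the coordinates of the
    \<open>yII\<close> columns drop by one, which \<open>skip_coord\<close> undoes.\<close>
  have low: "low_pf ?n ?V J (?M - 1) g = low_pf ?n V I (?M - 1) g" for g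
  proof (rule low_pf_cong)
    fix q assume "1 \<le> q" "q \<le> ?M - 1"
    then have q: "q \<in> {1..<?M}" by auto
    then show "top_I ?V J q = top_I V I q" "top_II ?V J q = top_II V I q"
      using top_I_admissible[OF adm, of q] top_I_admissible[OF admV, of q] skip[OF q] skipII[of _ q]
      by (auto simp del: upt_Suc)
  qed auto
  have "psi V I = (\<Sum>g\<in>?W. low_pf ?n V I (?M - 1) g * grid_pf ?n (xvars V ?M) (?ys @ [last (ytop V)]) g
     (replicate (length ?ys) ?n @ [?n]) ?n (ts @ [?n]))"
    unfolding psi_eq[OF M] rep ts(1) using ys by simp
  also have "\<dots> = (\<Sum>g\<in>?W. low_pf ?n V I (?M - 1) g * (?P * ?G g))"
    using ts(2) by (intro sum.cong refl arg_cong2[where f = "(*)"] grid_pf_last_column) (auto simp: words_def)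
  also have "\<dots> = ?P * (\<Sum>g\<in>?W. low_pf ?n ?V J (?M - 1) g * ?G g)"
    unfolding sum_distrib_left by (intro sum.cong refl) (simp only: low mult.left_commute)
  also have "(\<Sum>g\<in>?W. low_pf ?n ?V J (?M - 1) g * ?G g) = psi ?V J"
  proof -
    have "top_colours ?V J = ts"
      using top_colours_admissible[OF admV] M L1 by (auto simp: ts(3) skip_top L simp del: upt_Suc)
    then show ?thesis
      using M by (subst psi_eq) simp_all
  qed
  finally show ?thesis by (simp add: prod_list_map_nth)
qed

lemma psi_initial:
  fixes V :: "'a::{idom, ring_char_0} variables"
  assumes adm: "admissible V i I" and M: "2 \<le> layers V" and L: "ytop V \<noteq> []"
    and A: "i (L_sum V) \<noteq> layers V + 1" and k: "k_size V (layers V) = 1"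
  defines "J \<equiv> (\<lambda>j. {c \<in> I j. c < L_sum V} \<union> {c - L_top V + 1 | c. c \<in> I j \<and> c \<ge> L_sum V})"
    and "x \<equiv> hd (xvars V (layers V))"
  shows "psi V I = (\<Prod>j<L_top V - 1. x - ytop V ! j) * psi (remove_layer V) J"
proof -
  let ?M = "layers V" let ?n = "?M + 1" and ?ys = "butlast (ytop V)" and ?d = "i (L_sum V)"
  let ?V = "remove_layer V" and ?g = "skip_coords (offset_I V (layers V)) (L_top V - 1)"
  have M1: "1 \<le> ?M" and L1: "1 \<le> L_top V" using M L by (auto simp: Suc_le_eq)
  obtain m where m: "?M = Suc (Suc m)" using M by (metis Suc_le_D numeral_2_eq_2 Suc_le_mono)
  note admV = admissible_remove_layer(1)[OF adm M L1 A k, folded J_def]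
  note IM = admissible_remove_layer(4)[OF adm M L1 A k]
  obtain ts where ts: "top_colours V I = ts @ [?d]" "ts \<in> words ?n (length ?ys)" "?d \<in> {1..?n}"
     "ts = map (\<lambda>s. i (offset_I V ?M + s)) [1..<L_top V]"
    using top_colours_last[OF adm M1 L] by blast
  have dM: "?d \<in> {1..?M}" using ts(3) A by auto
  have xs: "xvars V ?M = [x]"
    using k unfolding x_def by (cases "xvars V ?M") auto
  have ys: "ytop V = ?ys @ [last (ytop V)]" using L by simp
  have rep: "replicate (L_top V) ?n = replicate (length ?ys) ?n @ [?n]"
    using L by (rule replicate_length_butlast)
  \<comment> \<open>Because \<open>I M = {L_sum}\<close>, all other top edges have colour
    \<open>M + 1\<close>, like the bottom edges; this is the indicator in
    \<open>grid_pf_single_row\<close>.\<close>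
  have ts_rep: "replicate (length ?ys) ?n = ts"
  proof -
    have "i c = ?n" if "c \<in> layer_coords V ?M" "c \<noteq> L_sum V" for c
    proof -
      have "i c \<in> {1..?n}"
        using adm that M1 unfolding admissible_def is_colouring_def by fastforce
      moreover have "c \<notin> I ?M" using that(2) IM by simp
      ultimately show ?thesis
        using admissible_colour_set[OF adm, of ?M] that(1) M1 by (auto simp: I_hat_top)
    qed
    then have "i (offset_I V ?M + s) = ?n" if "s \<in> {1..<L_top V}" for s
      using that layer_coords_top[of s V] by (auto simp: L_sum_def)
    then have "\<forall>c\<in>set ts. c = ?n" by (auto simp: ts(4))
    moreover have "length ts = length ?ys" by (simp add: ts(4))
    ultimately show ?thesis by (metis replicate_eqI)
  qed
  let ?P = "\<Prod>y\<leftarrow>?ys. x - y"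
  let ?L = "low_pf ?n V I (?M - 1)"
  have "psi V I = (\<Sum>a\<in>{1..?n}. ?L [a] * grid_pf ?n [x] (?ys @ [last (ytop V)]) [a]
     (replicate (length ?ys) ?n @ [?n]) ?n (ts @ [?d]))"
    unfolding psi_eq[OF M1] rep ts(1) xs using ys by (simp add: sum_words_Cons)
  also have "\<dots> = (\<Sum>a\<in>{1..?n}. of_bool (a = ?d) * (?P * ?L [a]))"
  proof (intro sum.cong refl)
    fix a assume "a \<in> {1..?n}"
    then have "grid_pf ?n [x] (?ys @ [last (ytop V)]) [a] (replicate (length ?ys) ?n @ [?n]) ?n (ts @ [?d]) =
        of_bool (a = ?d \<and> replicate (length ?ys) ?n = ts) * ?P"
      using ts A by (intro grid_pf_single_row) auto
    then show "?L [a] * grid_pf ?n [x] (?ys @ [last (ytop V)]) [a] (replicate (length ?ys) ?n @ [?n]) ?n (ts @ [?d]) =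
        of_bool (a = ?d) * (?P * ?L [a])"
      unfolding ts_rep by (simp only: simp_thms mult_ac)
  qed
  also have "\<dots> = ?P * ?L [?d]"
    using ts(3) by (intro sum_of_bool_eq) auto
  \<comment> \<open>Here the palette shrinks from \<open>M + 1\<close> to \<open>M\<close> colours,
    as \<open>?d\<close> is at most \<open>M\<close> in case A.\<close>
  also have "?L [?d] = low_pf ?M V I (?M - 1) [?d]"
    using low_pf_restrict_colours[of ?M ?n "?M - 1" "[?d]" V I] m dM k by simp
  also have "\<dots> = psi ?V J"
  proof -
    have skip: "?g (offset_I V p + s) = offset_I V p + s" if "p \<in> {1..Suc m}" "s \<le> L_I V p" for p s
      using that m offset_I_mono[of p ?M V] by (simp add: skip_coords_def)
    have skipII: "?g (offset_II ?V p + s) = offset_II V p + s" if "p < Suc m" for p s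
      using that m offset_II_remove_layer[OF M L1, of p] by (simp add: skip_coords_def)
    have "low_pf ?M ?V J m l = low_pf ?M V I m l" for l
    proof (rule low_pf_cong)
      fix q assume "1 \<le> q" "q \<le> m"
      then have q: "q \<in> {1..<?M}" "q \<in> {1..<layers ?V}" "q < Suc m" "q \<in> {1..Suc m}" using m by auto
      then show "top_I ?V J q = top_I V I q" "top_II ?V J q = top_II V I q"
        using top_I_admissible[OF adm q(1)] top_I_admissible[OF admV q(2)] skip[OF q(4)] skipII[OF q(3)]
        by (auto simp del: upt_Suc)
    qed auto
    \<comment> \<open>With its only inner edge fixed to \<open>?d\<close>, layer
      \<open>M - 1\<close> has a completely prescribed top word, as a top layer must. The middle
      entry belongs to the new coordinate of \<open>x\<close>, which \<open>?g\<close> sends to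
      \<open>L_sum\<close>.\<close>
    moreover have "top_colours ?V J = top_I V I (Suc m) @ [?d] @ top_II V I (Suc m)"
    proof -
      have off: "offset_I V ?M = offset_I V (Suc m) + L_I V (Suc m)" "offset_II V (Suc m) = L_sum V"
        "L_sum V = offset_I V ?M + L_top V"
        using offset_I_last[OF M] offset_II_last[of V] m by (auto simp: L_sum_def)
      have g_gt: "?g (offset_I V (Suc m) + (L_I V (Suc m) + Suc s)) = L_sum V + s" for s
        using off L1 by (simp add: skip_coords_def)
      have S: "[1..<Suc (L_I V (Suc m) + Suc (L_II V (Suc m)))] =
          [1..<Suc (L_I V (Suc m))] @ map (\<lambda>s. L_I V (Suc m) + Suc s) [0..<Suc (L_II V (Suc m))]"
        by (rule nth_equalityI) (auto simp: nth_append simp del: upt_Suc)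
      have S2: "[0..<Suc (L_II V (Suc m))] = 0 # map (\<lambda>s. s) [1..<Suc (L_II V (Suc m))]"
        by (subst upt_conv_Cons) (auto simp del: upt_Suc)
      have "top_colours ?V J = map (\<lambda>s. i (?g (offset_I V (Suc m) + s))) [1..<Suc (L_I V (Suc m) + Suc (L_II V (Suc m)))]"
        using top_colours_admissible[OF admV] m by (simp del: upt_Suc)
      also have "\<dots> = map (\<lambda>s. i (offset_I V (Suc m) + s)) [1..<Suc (L_I V (Suc m))] @
         map (\<lambda>s. i (L_sum V + s)) [0..<Suc (L_II V (Suc m))]"
        unfolding S using skip[of "Suc m"] g_gt by (auto simp del: upt_Suc)
      also have "\<dots> = top_I V I (Suc m) @ [?d] @ top_II V I (Suc m)"
        unfolding S2 using top_I_admissible[OF adm, of "Suc m"] m off(2) by (simp del: upt_Suc)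
      finally show ?thesis .
    qed
    ultimately show ?thesis
      using m by (subst psi_eq) (simp_all add: Let_def xs[unfolded m])
  qed
  finally show ?thesis
    by (simp add: prod_list_map_nth nth_butlast)
qed

theorem proposition2p1:
  fixes V :: "'a::{idom, ring_char_0} variables"
    and M :: nat and i :: "nat \<Rightarrow> nat" and I :: "nat \<Rightarrow> nat set"
  assumes M: "M = layers V" "M \<ge> 1"
    and L_top: "L_top V \<ge> 1"
    and adm: "admissible V i I"
  shows
   "\<comment> \<open>1. degree in the last variable of the top layer (case A)\<close>
    (i (L_sum V) \<noteq> M + 1 \<longrightarrow>
      (\<exists>q :: 'a poly. degree q \<le> k_size V M - 1 \<and>
        (\<forall>y. psi (V\<lparr>ytop := (ytop V)[L_top V - 1 := y]\<rparr>) I = poly q y))) \<and>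
    \<comment> \<open>2. symmetry\<close>
    (\<forall>xs. mset xs = mset (xvars V M) \<longrightarrow>
      psi (V\<lparr>xvars := (xvars V)(M := xs)\<rparr>) I = psi V I) \<and>
    \<comment> \<open>3. recursion (case A)\<close>
    (M \<ge> 2 \<and> i (L_sum V) \<noteq> M + 1 \<longrightarrow>
      (let x = last (xvars V M);
           V' = V\<lparr>xvars := (xvars V)(M := butlast (xvars V M)),
                  yII := (yII V)(M - 1 := x # yII V (M - 1)),
                  ytop := butlast (ytop V)\<rparr>;
           J = (\<lambda>j. if j = M then I M - {L_sum V} else I j)
       in admissible_tuple V' J \<and>
          (\<forall>j\<in>{1..M - 1}. relabelled V' J j = relabelled V I j) \<and>
          psi (V\<lparr>ytop := (ytop V)[L_top V - 1 := x + 1]\<rparr>) I =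
            (\<Prod>j<L_top V - 1. x - ytop V ! j) *
            (\<Prod>j<k_size V M - 1. xvars V M ! j - x - 1) * psi V' J)) \<and>
    \<comment> \<open>4. recursion (case B)\<close>
    (i (L_sum V) = M + 1 \<longrightarrow>
      (let V' = V\<lparr>ytop := butlast (ytop V)\<rparr>;
           J = (\<lambda>j. if j = M then I M
                    else {c \<in> I j. c \<le> L_sum V} \<union> {c - 1 | c. c \<in> I j \<and> c > L_sum V})
       in admissible_tuple V' J \<and>
          (\<forall>j\<in>{1..M - 1}. relabelled V' J j = relabelled V I j) \<and>
          psi V I = (\<Prod>j<k_size V M. xvars V M ! j - last (ytop V) + 1) * psi V' J)) \<and>
    \<comment> \<open>5. initial condition; here \<open>V'\<close> has \<open>M - 1\<close> layers\<close>
    (M \<ge> 2 \<and> k_size V M = 1 \<and> i (L_sum V) \<noteq> M + 1 \<longrightarrow>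
      (let x = hd (xvars V M);
           V' = V\<lparr>layers := M - 1, ytop := yI V (M - 1) @ [x] @ yII V (M - 1)\<rparr>;
           J = (\<lambda>j. {c \<in> I j. c < L_sum V} \<union>
                    {c - L_top V + 1 | c. c \<in> I j \<and> c \<ge> L_sum V})
       in admissible_tuple V' J \<and>
          (\<forall>j\<in>{1..<M - 1}. relabelled V' J j = relabelled V I j) \<and>
          (\<lambda>c. c - (\<Sum>q\<in>{1..<M - 1}. L_I V q)) ` J (M - 1) = relabelled V I (M - 1) \<and>
          psi V I = (\<Prod>j<L_top V - 1. x - ytop V ! j) * psi V' J))"
proof (intro conjI impI allI)
  have M1: "1 \<le> layers V" using M by simp
  have L: "ytop V \<noteq> []" using L_top by auto
  show "\<exists>q :: 'a poly. degree q \<le> k_size V M - 1 \<and>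
      (\<forall>y. psi (V\<lparr>ytop := (ytop V)[L_top V - 1 := y]\<rparr>) I = poly q y)" if "i (L_sum V) \<noteq> M + 1"
    using psi_degree[OF adm M1 L] that unfolding M(1) by blast
  show "psi (V\<lparr>xvars := (xvars V)(M := xs)\<rparr>) I = psi V I" if "mset xs = mset (xvars V M)" for xs
    using psi_symmetric[OF M1] that unfolding M(1) by blast
  show "let x = last (xvars V M);
           V' = V\<lparr>xvars := (xvars V)(M := butlast (xvars V M)),
                  yII := (yII V)(M - 1 := x # yII V (M - 1)),
                  ytop := butlast (ytop V)\<rparr>;
           J = (\<lambda>j. if j = M then I M - {L_sum V} else I j)
       in admissible_tuple V' J \<and>
          (\<forall>j\<in>{1..M - 1}. relabelled V' J j = relabelled V I j) \<and>
          psi (V\<lparr>ytop := (ytop V)[L_top V - 1 := x + 1]\<rparr>) I =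
            (\<Prod>j<L_top V - 1. x - ytop V ! j) *
            (\<Prod>j<k_size V M - 1. xvars V M ! j - x - 1) * psi V' J"
    if "M \<ge> 2 \<and> i (L_sum V) \<noteq> M + 1"
  proof -
    have A: "2 \<le> layers V" "i (L_sum V) \<noteq> layers V + 1" using that M(1) by auto
    show ?thesis
      using admissible_move_last_row[OF adm A(1) L_top A(2)] psi_case_A[OF adm A(1) L A(2)]
      unfolding M(1) Let_def admissible_tuple_def move_last_row_def by blast
  qed
  show "let V' = V\<lparr>ytop := butlast (ytop V)\<rparr>;
           J = (\<lambda>j. if j = M then I M
                    else {c \<in> I j. c \<le> L_sum V} \<union> {c - 1 | c. c \<in> I j \<and> c > L_sum V})
       in admissible_tuple V' J \<and>
          (\<forall>j\<in>{1..M - 1}. relabelled V' J j = relabelled V I j) \<and>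
          psi V I = (\<Prod>j<k_size V M. xvars V M ! j - last (ytop V) + 1) * psi V' J"
    if "i (L_sum V) = M + 1"
  proof -
    have B: "i (L_sum V) = layers V + 1" using that M(1) by auto
    show ?thesis
      using admissible_drop_top[OF adm M1 L_top B] psi_case_B[OF adm M1 L B]
      unfolding M(1) Let_def admissible_tuple_def drop_top_def by blast
  qed
  show "let x = hd (xvars V M);
           V' = V\<lparr>layers := M - 1, ytop := yI V (M - 1) @ [x] @ yII V (M - 1)\<rparr>;
           J = (\<lambda>j. {c \<in> I j. c < L_sum V} \<union>
                    {c - L_top V + 1 | c. c \<in> I j \<and> c \<ge> L_sum V})
       in admissible_tuple V' J \<and>
          (\<forall>j\<in>{1..<M - 1}. relabelled V' J j = relabelled V I j) \<and>
          (\<lambda>c. c - (\<Sum>q\<in>{1..<M - 1}. L_I V q)) ` J (M - 1) = relabelled V I (M - 1) \<and>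
          psi V I = (\<Prod>j<L_top V - 1. x - ytop V ! j) * psi V' J"
    if "M \<ge> 2 \<and> k_size V M = 1 \<and> i (L_sum V) \<noteq> M + 1"
  proof -
    have A: "2 \<le> layers V" "i (L_sum V) \<noteq> layers V + 1" "k_size V (layers V) = 1" using that M(1) by auto
    have "\<forall>j\<in>{1..<layers V - 1}. j \<in> {1..layers V - 1}" by simp
    then show ?thesis
      using admissible_remove_layer(1-3)[OF adm A(1) L_top A(2,3)] psi_initial[OF adm A(1) L A(2,3)]
      unfolding M(1) Let_def admissible_tuple_def remove_layer_def offset_I_def by blast
  qed
qed

end
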